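(* Let $a>0$ and let $\phi(z)=cz+d$ where $c\in\mathbb{R}$ with $0<|c|\leq 1$ and $d\in\mathbb{C}$. Then the spectrum $\sigma(C_\phi)$ of the composition operator $C_\phi f=f\circ\phi$ acting on $B^2_a$ is: (1) $\sigma(C_\phi)=\{-1,1\}$, when $c=-1$; (2) $\sigma(C_\phi)=\{\lambda\in\mathbb{C}:|\lambda|\leq 1/\sqrt{|c|}\}$, when $0<|c|<1$; (3) $\sigma(C_\phi)=\{e^{idt}:t\in[-a,a]\}$, when $c=1$.
   Context: For $a>0$, the Paley-Wiener space $B^2_a$ is the Hilbert space of all entire functions of exponential type less than or equal to $a$ whose restriction to $\mathbb{R}$ belongs to $L^2(\mathbb{R})$, with inner product $\langle f,g\rangle=\int_{-\infty}^{\infty}f(t)\overline{g(t)}\,dt$ and norm $\|\cdot\|_a$. For symbols $\phi(z)=cz+d$ ($z\in\mathbb{C}$) with $c\in\mathbb{R}$, $0<|c|\leq1$, $d\in\mathbb{C}$, the operator $C_\phi$ is a bounded linear operator on $B^2_a$. The spectrum of a bounded operator $T$ is $\sigma(T)=\{\lambda\in\mathbb{C}: T-\lambda I\text{ is not invertible}\}$. *)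

theory Defs
  imports "HOL-Complex_Analysis.Complex_Analysis"
begin

definition exponential_type_le :: "real \<Rightarrow> (complex \<Rightarrow> complex) \<Rightarrow> bool" where
  "exponential_type_le a f \<longleftrightarrow>
     (\<forall>\<epsilon>>0. \<exists>C. \<forall>z. cmod (f z) \<le> C * exp ((a + \<epsilon>) * cmod z))"

definition paley_wiener :: "real \<Rightarrow> (complex \<Rightarrow> complex) set" where
  "paley_wiener a =
     {f. f holomorphic_on UNIV \<and> exponential_type_le a f \<and>
         integrable lborel (\<lambda>t::real. (cmod (f (of_real t)))\<^sup>2)}"

definition pw_inner :: "(complex \<Rightarrow> complex) \<Rightarrow> (complex \<Rightarrow> complex) \<Rightarrow> complex" where
  "pw_inner f g = (LINT t|lborel. f (of_real t) * cnj (g (of_real t)))"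

definition pw_norm :: "(complex \<Rightarrow> complex) \<Rightarrow> real" where
  "pw_norm f = sqrt (Re (pw_inner f f))"

text \<open>
  An operator on the Paley-Wiener space is a total map on functions, of which only the values
  on the carrier \<^term>\<open>paley_wiener a\<close> matter.
\<close>

definition pw_bounded_operator ::
    "real \<Rightarrow> ((complex \<Rightarrow> complex) \<Rightarrow> (complex \<Rightarrow> complex)) \<Rightarrow> bool" where
  "pw_bounded_operator a T \<longleftrightarrow>
     (\<forall>f\<in>paley_wiener a. T f \<in> paley_wiener a) \<and>
     (\<forall>f\<in>paley_wiener a. \<forall>g\<in>paley_wiener a. T (\<lambda>z. f z + g z) = (\<lambda>z. T f z + T g z)) \<and>
     (\<forall>f\<in>paley_wiener a. \<forall>k. T (\<lambda>z. k * f z) = (\<lambda>z. k * T f z)) \<and>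
     (\<exists>K. \<forall>f\<in>paley_wiener a. pw_norm (T f) \<le> K * pw_norm f)"

text \<open>Invertibility in the algebra of bounded linear operators on the Paley-Wiener space.\<close>

definition pw_invertible ::
    "real \<Rightarrow> ((complex \<Rightarrow> complex) \<Rightarrow> (complex \<Rightarrow> complex)) \<Rightarrow> bool" where
  "pw_invertible a T \<longleftrightarrow> pw_bounded_operator a T \<and>
     (\<exists>S. pw_bounded_operator a S \<and> (\<forall>f\<in>paley_wiener a. S (T f) = f \<and> T (S f) = f))"

definition pw_spectrum ::
    "real \<Rightarrow> ((complex \<Rightarrow> complex) \<Rightarrow> (complex \<Rightarrow> complex)) \<Rightarrow> complex set" where
  "pw_spectrum a T = {\<mu>. \<not> pw_invertible a (\<lambda>f z. T f z - \<mu> * f z)}"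

definition composition_operator ::
    "(complex \<Rightarrow> complex) \<Rightarrow> (complex \<Rightarrow> complex) \<Rightarrow> (complex \<Rightarrow> complex)" where
  "composition_operator \<phi> f = f \<circ> \<phi>"

end

theory Submission
  imports Defs "HOL-Real_Asymp.Real_Asymp" "HOL-Probability.Sinc_Integral"
begin

text \<open>
  The Fourier side of the space is replaced by the following duality. If \<open>f\<close> has type \<open>a\<close> and \<open>\<psi>\<close> is
  continuous with compact support, then \<open>G z = \<integral> f (z + t) \<psi> t dt\<close> has type \<open>a\<close> and is bounded on the
  real line, so by Phragmen and Lindelof \<open>\<bar>G z\<bar> \<le> M e\<^bsup>a\<bar>Im z\<bar>\<^esup>\<close>. Scalar estimates for such \<open>G\<close> become
  operator norm estimates for linear combinations of translations.

  For \<open>c = - 1\<close> the operator is an involution with an even and an odd eigenfunction about \<open>d / 2\<close>.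

  For \<open>\<bar>c\<bar> < 1\<close> the iterates have norm \<open>O(\<bar>c\<bar>\<^bsup>-n/2\<^esup>)\<close>. Conversely, recentre at the fixed point and take
  \<open>g \<noteq> 0\<close> orthogonal to all functions of type \<open>a \<bar>c\<bar>\<close>: a solution of \<open>f (c z) - \<mu> f z = g z\<close> satisfies
  \<open>\<bar>\<mu>\<bar>\<^sup>2 \<parallel>f\<parallel>\<^sup>2 = \<parallel>f\<parallel>\<^sup>2 / \<bar>c\<bar> + \<parallel>g\<parallel>\<^sup>2\<close> by Pythagoras, which is impossible if \<open>\<bar>\<mu>\<bar>\<^sup>2 \<le> 1 / \<bar>c\<bar>\<close>.

  For \<open>c = 1\<close>, modulated sinc functions of small bandwidth are approximate eigenvectors. If \<open>\<mu>\<close> is off the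
  curve, factor \<open>T\<^sub>d - \<mu>\<close> into factors \<open>T\<^sub>h - \<nu>\<close> with \<open>h = d / 2\<^sup>m\<close> small. If \<open>\<nu>\<close> is far from \<open>1\<close>,
  use a Neumann series around the identity; otherwise \<open>\<nu> = e\<^bsup>h\<omega>\<^esup>\<close> with \<open>\<omega>\<close> bounded and at a fixed distance from
  \<open>\<i> [- a, a]\<close>, and \<open>(T\<^sub>h - e\<^bsup>h\<omega>\<^esup>) / h\<close> is close to \<open>(T\<^sub>k - e\<^bsup>k\<omega>\<^esup>) / k\<close> for every small \<open>k\<close>. The
  direction of \<open>k\<close> can be chosen so that the latter is inverted by a Neumann series.
\<close>

section \<open>The Phragmen-Lindelof principle\<close>

text \<open>The hypotheses place \<open>q\<close> in the sector
  \<open>\<bar>arg q\<bar> \<le> pi / 4\<close>, so the argument of \<open>q powr (3/2)\<close> is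
  at most \<open>3 * pi / 8 < pi / 2\<close> in modulus and its real part is comparable to its
  modulus.\<close>

lemma Re_powr_three_halves_ge:
  assumes "Re q > 0" "\<bar>Im q\<bar> \<le> Re q"
  shows "cos (3 * pi / 8) * cmod q powr (3/2) \<le> Re (q powr (3/2))"
proof -
  have q: "q \<noteq> 0" using assms by auto
  define t where "t = Im (Ln q)"
  have t: "\<bar>t\<bar> < pi / 2"
    using assms(1) q Re_Ln_pos_lt[of q] by (simp add: t_def)
  have qe: "q = of_real (cmod q) * exp (\<i> * t)"
  proof -
    have "q = exp (Ln q)" using q by simp
    also have "Ln q = of_real (ln (cmod q)) + \<i> * t"
      using q by (simp add: complex_eq_iff t_def)
    finally show ?thesis using q by (simp add: exp_add exp_of_real)
  qed
  have re: "Re q = cmod q * cos t" and im: "Im q = cmod q * sin t"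
    by (subst qe, simp add: Re_exp Im_exp)+
  have "(Im q)\<^sup>2 \<le> (Re q)\<^sup>2"
    using assms by (metis abs_le_square_iff abs_of_pos)
  then have "(cmod q)\<^sup>2 * (sin t)\<^sup>2 \<le> (cmod q)\<^sup>2 * (cos t)\<^sup>2"
    by (simp add: re im power_mult_distrib)
  then have "(sin t)\<^sup>2 \<le> (cos t)\<^sup>2" using q by simp
  then have c2: "cos (2 * t) \<ge> 0" by (simp add: cos_double)
  have "\<bar>t\<bar> \<le> pi / 4"
  proof (rule ccontr)
    assume "\<not> \<bar>t\<bar> \<le> pi / 4"
    then have "cos (2 * \<bar>t\<bar>) < cos (pi / 2)"
      using t by (intro cos_monotone_0_pi) auto
    moreover have "cos (2 * \<bar>t\<bar>) = cos (2 * t)" by (simp add: abs_if)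
    ultimately show False using c2 by simp
  qed
  then have "cos (3 * pi / 8) \<le> cos (\<bar>3/2 * t\<bar>)"
    by (intro cos_monotone_0_pi_le) auto
  then have "cos (3 * pi / 8) \<le> cos (3/2 * t)" by (simp only: cos_abs_real)
  moreover have "Re (q powr (3/2)) = cmod q powr (3/2) * cos (3/2 * t)"
  proof -
    have "Re (q powr (3/2)) = Re (exp (3/2 * Ln q))" using q by (simp add: powr_def)
    also have "\<dots> = exp (3/2 * ln (cmod q)) * cos (3/2 * t)"
      using q by (simp add: Re_exp t_def)
    finally show ?thesis using q by (simp add: powr_def)
  qed
  ultimately show ?thesis
    by (metis mult.commute mult_left_mono powr_ge_zero)
qed

text \<open>Multiplying by \<open>exp (- \<delta> q\<^sup>3\<^sup>/\<^sup>2)\<close> beats order one growth in a quadrant; the shift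
  of \<open>q\<close> by \<open>1\<close> keeps the branch point out of the region.\<close>

lemma phragmen_lindelof_quadrant:
  assumes holo: "H holomorphic_on UNIV"
    and growth: "\<And>z. cmod (H z) \<le> C * exp (A * cmod z)"
    and re: "\<And>x. x \<ge> 0 \<Longrightarrow> cmod (H (of_real x)) \<le> B"
    and im: "\<And>y. y \<ge> 0 \<Longrightarrow> cmod (H (\<i> * of_real y)) \<le> B"
    and A: "A > 0" and B: "B > 0" and z: "Re z \<ge> 0" "Im z \<ge> 0"
  shows "cmod (H z) \<le> B"
proof -
  \<comment> \<open>The rotation takes the first quadrant to the sector of half-opening
    \<open>pi / 4\<close> about the positive axis, where the preceding estimate applies.\<close>
  define q :: "complex \<Rightarrow> complex" where "q w = w * cis (- (pi / 4)) + 1" for w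
  define \<kappa> where "\<kappa> = cos (3 * pi / 8)"
  have \<kappa>: "\<kappa> > 0" unfolding \<kappa>_def by (rule cos_gt_zero) auto
  have req: "Re (q w) = (Re w + Im w) * (sqrt 2 / 2) + 1"
    and imq: "Im (q w) = (Im w - Re w) * (sqrt 2 / 2)" for w
    by (simp_all add: q_def cos_45 sin_45 algebra_simps)
  have qpos: "Re (q w) > 0" "\<bar>Im (q w)\<bar> \<le> Re (q w)" "cmod w \<le> cmod (q w)"
    if w: "Re w \<ge> 0" "Im w \<ge> 0" for w
  proof -
    have nn: "0 \<le> (Re w + Im w) * (sqrt 2 / 2)" using w by simp
    then show "Re (q w) > 0" unfolding req by linarith
    have "\<bar>Im w - Re w\<bar> * (sqrt 2 / 2) \<le> (Re w + Im w) * (sqrt 2 / 2)"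
      using w by (intro mult_right_mono) auto
    then show "\<bar>Im (q w)\<bar> \<le> Re (q w)"
      by (simp only: req imq abs_mult abs_divide abs_numeral real_sqrt_abs2 abs_of_nonneg[OF real_sqrt_ge_zero[OF zero_le_numeral]])
    have "Re (w * cis (- (pi / 4))) \<ge> 0"
      using nn req[of w] by (simp add: q_def)
    then have "cmod (w * cis (- (pi / 4))) \<le> cmod (w * cis (- (pi / 4)) + 1)"
      unfolding cmod_def by (intro real_sqrt_le_mono) (simp add: power2_eq_square algebra_simps)
    then show "cmod w \<le> cmod (q w)" by (simp add: q_def norm_mult)
  qed
  have bound: "cmod (H z * exp (- (of_real \<delta> * q z powr (3/2)))) \<le> B" if \<delta>: "\<delta> > 0" for \<delta> :: real
  proof -
    define P where "P w = H w * exp (- (of_real \<delta> * q w powr (3/2)))" for w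
    have P_le: "cmod (P w) \<le> cmod (H w) * exp (- (\<delta> * \<kappa> * cmod w powr (3/2)))"
      if w: "Re w \<ge> 0" "Im w \<ge> 0" for w
    proof -
      have "\<kappa> * cmod w powr (3/2) \<le> \<kappa> * cmod (q w) powr (3/2)"
        using qpos(3)[OF w] \<kappa> by (intro mult_left_mono powr_mono2) auto
      also have "\<dots> \<le> Re (q w powr (3/2))"
        unfolding \<kappa>_def by (rule Re_powr_three_halves_ge[OF qpos(1,2)[OF w]])
      finally have "\<delta> * (\<kappa> * cmod w powr (3/2)) \<le> \<delta> * Re (q w powr (3/2))"
        using \<delta> by simp
      then show ?thesis by (simp add: P_def norm_mult mult_left_mono mult.assoc)
    qed
    \<comment> \<open>The damping exponent \<open>3/2\<close> exceeds the order one of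
      \<open>H\<close>, so for large \<open>R\<close> the product is below \<open>B\<close> on the
      arc of radius \<open>R\<close>. Only the two axes remain for the maximum principle.\<close>
    have "((\<lambda>R. exp (A * R) * exp (- (\<delta> * \<kappa> * R powr (3/2)))) \<longlongrightarrow> 0) at_top"
      using \<delta> \<kappa> A by real_asymp
    from tendsto_mult_right_zero[OF this, of C]
    have "((\<lambda>R. C * exp (A * R) * exp (- (\<delta> * \<kappa> * R powr (3/2)))) \<longlongrightarrow> 0) at_top"
      by (simp only: mult.assoc)
    then have "\<forall>\<^sub>F R in at_top. C * exp (A * R) * exp (- (\<delta> * \<kappa> * R powr (3/2))) < B"
      using B by (rule order_tendstoD)
    then have "\<forall>\<^sub>F R in at_top. C * exp (A * R) * exp (- (\<delta> * \<kappa> * R powr (3/2))) < B \<and> R \<ge> cmod z"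
      using eventually_ge_at_top by eventually_elim auto
    then obtain R where R: "C * exp (A * R) * exp (- (\<delta> * \<kappa> * R powr (3/2))) < B" "R \<ge> cmod z"
      using eventually_happens'[OF trivial_limit_at_top_linorder] by blast
    define S where "S = {w. Re w \<ge> 0} \<inter> {w. Im w \<ge> 0} \<inter> cball 0 R"
    have "closed S" unfolding S_def
      by (intro closed_Int closed_halfspace_Re_ge closed_halfspace_Im_ge closed_cball)
    have holP: "P holomorphic_on S"
      unfolding P_def q_def S_def
      using qpos(1) by (intro holomorphic_intros holomorphic_on_subset[OF holo])
        (auto simp: q_def complex_nonpos_Reals_iff not_le)
    have "cmod (P z) \<le> B"
    proof (rule maximum_modulus_frontier[where f = P and S = S])
      show "P holomorphic_on interior S" using holP interior_subset holomorphic_on_subset by blast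
      show "continuous_on (closure S) P"
        using holP \<open>closed S\<close> by (simp add: holomorphic_on_imp_continuous_on)
      show "bounded S" unfolding S_def by (simp add: bounded_Int)
      show "z \<in> S" using z R by (simp add: S_def)
      fix w assume "w \<in> frontier S"
      then have w: "w \<in> S" "w \<notin> interior S"
        using \<open>closed S\<close> by (auto simp: frontier_def)
      have "open ({w. Re w > 0} \<inter> {w. Im w > 0} \<inter> ball 0 R)"
        by (intro open_Int open_halfspace_Re_gt open_halfspace_Im_gt open_ball)
      then have "{w. Re w > 0} \<inter> {w. Im w > 0} \<inter> ball 0 R \<subseteq> interior S"
        by (intro interior_maximal) (auto simp: S_def)
      then have "Re w = 0 \<or> Im w = 0 \<or> cmod w = R"
        using w by (force simp: S_def)
      moreover have w0: "Re w \<ge> 0" "Im w \<ge> 0" using w by (auto simp: S_def)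
      have le1: "exp (- (\<delta> * \<kappa> * cmod w powr (3/2))) \<le> 1"
        using \<delta> \<kappa> by simp
      moreover have "cmod (P w) \<le> B" if "Re w = 0 \<or> Im w = 0"
      proof -
        have "w = \<i> * of_real (Im w) \<or> w = of_real (Re w)"
          using that by (auto simp: complex_eq_iff)
        then have "cmod (H w) \<le> B" using re[OF w0(1)] im[OF w0(2)] by metis
        then show ?thesis using P_le[OF w0] le1
          by (smt (verit) mult_left_le norm_ge_zero)
      qed
      moreover have "cmod (P w) \<le> B" if "cmod w = R"
        using P_le[OF w0] growth[of w] R(1) that
        by (smt (verit) exp_ge_zero mult_right_mono)
      ultimately show "cmod (P w) \<le> B" by blast
    qed
    then show ?thesis by (simp add: P_def)
  qed
  \<comment> \<open>The bound \<open>B\<close> does not depend on \<open>\<delta>\<close>, so the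
    damping is removed by letting \<open>\<delta>\<close> tend to \<open>0\<close>.\<close>
  have "((\<lambda>\<delta>::real. cmod (H z * exp (- (of_real \<delta> * q z powr (3/2))))) \<longlongrightarrow>
      cmod (H z * exp (- (of_real 0 * q z powr (3/2))))) (at_right 0)"
    by (intro tendsto_intros)
  then have "cmod (H z * exp (- (of_real 0 * q z powr (3/2)))) \<le> B"
    by (rule tendsto_upperbound) (auto simp: eventually_at_right_less bound intro: eventually_mono[OF eventually_at_right_less[of 0]])
  then show ?thesis by simp
qed

text \<open>The maximum principle is applied to \<open>H z ^ n / (z + \<i>)\<close>: the denominator
  gives decay at infinity, and comparing \<open>n\<close>-th powers for large \<open>n\<close> makes
  its contribution disappear. Thus any crude bound \<open>C\<close> improves to the bound
  \<open>M\<close> on the real axis.\<close>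

lemma bounded_half_plane_le:
  assumes holo: "H holomorphic_on UNIV"
    and bdd: "\<And>z. Im z \<ge> 0 \<Longrightarrow> cmod (H z) \<le> C"
    and re: "\<And>x::real. cmod (H (of_real x)) \<le> M" and M: "M > 0" and z: "Im z \<ge> 0"
  shows "cmod (H z) \<le> M"
proof -
  have zi: "w + \<i> \<noteq> 0" "cmod (w + \<i>) \<ge> 1" if "Im w \<ge> 0" for w
    using that abs_Im_le_cmod[of "w + \<i>"] by (auto simp: complex_eq_iff)
  have C: "C \<ge> 0" using order_trans[OF norm_ge_zero bdd[of 0]] by simp
  have pow: "cmod (H z) ^ n \<le> M ^ n * cmod (z + \<i>)" for n
  proof -
    define P where "P w = H w ^ n / (w + \<i>)" for w
    \<comment> \<open>The second entry gives \<open>C ^ n \<le> M ^ n * (R - 1)\<close>, and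
      \<open>cmod (w + \<i>) \<ge> R - 1\<close> on the arc.\<close>
    define R where "R = max (cmod z) (C ^ n / M ^ n + 1)"
    define S where "S = {w. Im w \<ge> 0} \<inter> cball 0 R"
    have "closed S" unfolding S_def by (intro closed_Int closed_halfspace_Im_ge closed_cball)
    have holP: "P holomorphic_on S"
      unfolding P_def S_def using zi(1)
      by (intro holomorphic_intros holomorphic_on_subset[OF holo]) auto
    have "cmod (P z) \<le> M ^ n"
    proof (rule maximum_modulus_frontier[where f = P and S = S])
      show "P holomorphic_on interior S" using holP interior_subset holomorphic_on_subset by blast
      show "continuous_on (closure S) P"
        using holP \<open>closed S\<close> by (simp add: holomorphic_on_imp_continuous_on)
      show "bounded S" unfolding S_def by (simp add: bounded_Int)
      show "z \<in> S" using z by (simp add: S_def R_def)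
      fix w assume "w \<in> frontier S"
      then have w: "w \<in> S" "w \<notin> interior S"
        using \<open>closed S\<close> by (auto simp: frontier_def)
      have "open ({w. Im w > 0} \<inter> ball 0 R)"
        by (intro open_Int open_halfspace_Im_gt open_ball)
      then have "{w. Im w > 0} \<inter> ball 0 R \<subseteq> interior S"
        by (intro interior_maximal) (auto simp: S_def)
      then consider "Im w = 0" | "cmod w = R" using w by (force simp: S_def)
      moreover have w0: "Im w \<ge> 0" using w by (auto simp: S_def)
      ultimately show "cmod (P w) \<le> M ^ n"
      proof cases
        case 1
        then have "w = of_real (Re w)" by (simp add: complex_eq_iff)
        then have "cmod (H w) \<le> M" using re by metis
        then have "cmod (H w) ^ n \<le> M ^ n" by (simp add: power_mono)
        moreover have "cmod (P w) \<le> cmod (H w) ^ n"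
          using zi[OF w0] mult_left_mono[of 1 "cmod (w + \<i>)" "cmod (H w) ^ n"]
          by (simp add: P_def norm_divide norm_power divide_le_eq)
        ultimately show ?thesis by linarith
      next
        case 2
        have "C ^ n / M ^ n \<le> R - 1" by (simp add: R_def)
        also have "\<dots> \<le> cmod (w + \<i>)" using norm_diff_ineq[of w "\<i>"] 2 by simp
        finally have "C ^ n \<le> M ^ n * cmod (w + \<i>)"
          using M by (simp add: pos_divide_le_eq mult.commute)
        moreover have "cmod (H w) ^ n \<le> C ^ n" using bdd[OF w0] by (simp add: power_mono)
        ultimately show ?thesis using zi[OF w0]
          by (simp add: P_def norm_divide norm_power pos_divide_le_eq)
      qed
    qed
    then show ?thesis using zi[OF z] by (simp add: P_def norm_divide norm_power pos_divide_le_eq)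
  qed
  show ?thesis
  proof (rule ccontr)
    assume "\<not> cmod (H z) \<le> M"
    then have gt: "cmod (H z) / M > 1" using M by (simp add: less_divide_eq)
    obtain n where "cmod (z + \<i>) < (cmod (H z) / M) ^ n"
      using real_arch_pow[OF gt] by blast
    then show False using pow[of n] M by (simp add: power_divide less_divide_eq mult.commute)
  qed
qed

text \<open>The factor \<open>exp (\<i> * (a + \<epsilon>) * z)\<close> absorbs the growth along the
  positive imaginary axis and is unimodular on the real line. Phragmen-Lindelof in each of the two
  quadrants bounds the product, the half-plane lemma lowers the bound to \<open>M\<close>, and then
  \<open>\<epsilon>\<close> tends to \<open>0\<close>.\<close>

lemma exponential_type_le_bound_upper:
  assumes holo: "G holomorphic_on UNIV" and type: "exponential_type_le a G"
    and re: "\<And>x::real. cmod (G (of_real x)) \<le> M" and M: "M > 0" and z: "Im z \<ge> 0" and a: "a \<ge> 0"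
  shows "cmod (G z) \<le> M * exp (a * Im z)"
proof -
  have bound: "cmod (G z) \<le> M * exp ((a + \<epsilon>) * Im z)" if \<epsilon>: "\<epsilon> > 0" for \<epsilon>
  proof -
    obtain C where C: "\<And>z. cmod (G z) \<le> C * exp ((a + \<epsilon>) * cmod z)"
      using type \<epsilon> unfolding exponential_type_le_def by blast
    have "C \<ge> 0" using order_trans[OF norm_ge_zero C[of 0]] by simp
    define H where "H w = G w * exp (\<i> * of_real (a + \<epsilon>) * w)" for w
    have nH: "cmod (H w) = cmod (G w) * exp (- ((a + \<epsilon>) * Im w))" for w
      by (simp add: H_def norm_mult)
    have holH: "H holomorphic_on UNIV"
      unfolding H_def by (intro holomorphic_intros holo)
    have growth: "cmod (H w) \<le> C * exp ((2 * (a + \<epsilon>)) * cmod w)" for w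
    proof -
      have "- ((a + \<epsilon>) * Im w) \<le> (a + \<epsilon>) * cmod w"
        using abs_Im_le_cmod[of w] a \<epsilon> mult_left_mono[of "- Im w" "cmod w" "a + \<epsilon>"] by auto
      then have "cmod (H w) \<le> (C * exp ((a + \<epsilon>) * cmod w)) * exp ((a + \<epsilon>) * cmod w)"
        unfolding nH using C[of w] \<open>C \<ge> 0\<close> by (intro mult_mono) auto
      then show ?thesis by (simp add: exp_add[symmetric] algebra_simps)
    qed
    define B where "B = max M C"
    have reH: "cmod (H (of_real x)) \<le> M" for x :: real using re[of x] by (simp add: nH)
    have imH: "cmod (H (\<i> * of_real y)) \<le> C" if "y \<ge> 0" for y
    proof -
      have "cmod (G (\<i> * of_real y)) * exp (- ((a + \<epsilon>) * y))
          \<le> C * exp ((a + \<epsilon>) * y) * exp (- ((a + \<epsilon>) * y))"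
        using C[of "\<i> * of_real y"] that by (intro mult_right_mono) (auto simp: norm_mult)
      then show ?thesis by (simp add: nH mult.assoc exp_add[symmetric])
    qed
    have bdd: "cmod (H w) \<le> B" if w: "Im w \<ge> 0" for w
    proof (cases "Re w \<ge> 0")
      case True
      show ?thesis
        by (rule phragmen_lindelof_quadrant[OF holH growth _ _ _ _ True w])
          (use reH imH M a \<epsilon> in \<open>auto simp: B_def le_max_iff_disj less_max_iff_disj\<close>)
    next
      case False
      \<comment> \<open>The second quadrant is rotated onto the first; its two boundary rays
        exchange roles.\<close>
      have "cmod (H (\<i> * (- \<i> * w))) \<le> B"
      proof (rule phragmen_lindelof_quadrant[where H = "\<lambda>w. H (\<i> * w)"])
        show "(\<lambda>w. H (\<i> * w)) holomorphic_on UNIV"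
          by (rule holomorphic_on_compose[OF _ holomorphic_on_subset[OF holH], unfolded o_def])
            (auto intro!: holomorphic_intros)
        show "cmod (H (\<i> * w)) \<le> C * exp ((2 * (a + \<epsilon>)) * cmod w)" for w
          using growth[of "\<i> * w"] by (simp add: norm_mult)
        show "cmod (H (\<i> * of_real x)) \<le> B" if "x \<ge> 0" for x
          using imH[OF that] by (simp add: B_def)
        show "cmod (H (\<i> * (\<i> * of_real y))) \<le> B" for y
          using reH[of "- y"] by (simp add: B_def flip: mult.assoc)
      qed (use M False w a \<epsilon> in \<open>auto simp: B_def\<close>)
      then show ?thesis by (simp flip: mult.assoc)
    qed
    have "cmod (H z) \<le> M"
      by (rule bounded_half_plane_le[OF holH bdd reH M z])
    then have "cmod (G z) * exp (- ((a + \<epsilon>) * Im z)) * exp ((a + \<epsilon>) * Im z) \<le> M * exp ((a + \<epsilon>) * Im z)"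
      unfolding nH by (rule mult_right_mono) simp
    then show ?thesis by (simp add: mult.assoc exp_add[symmetric])
  qed
  have "((\<lambda>\<epsilon>. M * exp ((a + \<epsilon>) * Im z)) \<longlongrightarrow> M * exp ((a + 0) * Im z)) (at_right 0)"
    by (intro tendsto_intros)
  then show ?thesis
    by (intro tendsto_lowerbound[of "\<lambda>\<epsilon>. M * exp ((a + \<epsilon>) * Im z)" _ "at_right 0"])
      (auto simp: bound intro: eventually_mono[OF eventually_at_right_less[of 0]])
qed

lemma exponential_type_le_reflect:
  "exponential_type_le a f \<Longrightarrow> exponential_type_le a (\<lambda>z. f (- z))"
  unfolding exponential_type_le_def by (metis norm_minus_cancel)

text \<open>The lower half-plane reduces to the upper one by \<open>z \<mapsto> - z\<close>. This
  estimate stands in for the support of the Fourier transform in what follows.\<close>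

theorem exponential_type_le_bound:
  assumes holo: "G holomorphic_on UNIV" and type: "exponential_type_le a G"
    and re: "\<And>x::real. cmod (G (of_real x)) \<le> M" and M: "M > 0" and a: "a \<ge> 0"
  shows "cmod (G z) \<le> M * exp (a * \<bar>Im z\<bar>)"
proof (cases "Im z \<ge> 0")
  case True
  then show ?thesis using exponential_type_le_bound_upper[OF holo type re M True a] by simp
next
  case False
  have "cmod (G (- (- z))) \<le> M * exp (a * Im (- z))"
  proof (rule exponential_type_le_bound_upper[where G = "\<lambda>w. G (- w)"])
    show "(\<lambda>w. G (- w)) holomorphic_on UNIV"
      by (rule holomorphic_on_compose[OF _ holomorphic_on_subset[OF holo], unfolded o_def])
        (auto intro!: holomorphic_intros)
    show "cmod (G (- of_real x)) \<le> M" for x :: real using re[of "- x"] by simp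
  qed (use type M a False in \<open>auto intro: exponential_type_le_reflect\<close>)
  then show ?thesis using False by simp
qed

section \<open>Square-integrable functions\<close>

text \<open>Measurability is a separate conjunct because integrability of the squared modulus says
  nothing about the argument of \<open>u\<close>.\<close>

definition square_integrable :: "'a measure \<Rightarrow> ('a \<Rightarrow> complex) \<Rightarrow> bool" where
  "square_integrable M u \<longleftrightarrow>
     u \<in> borel_measurable M \<and> integrable M (\<lambda>x. (cmod (u x))\<^sup>2)"

definition l2_norm :: "'a measure \<Rightarrow> ('a \<Rightarrow> complex) \<Rightarrow> real" where
  "l2_norm M u = sqrt (LINT x|M. (cmod (u x))\<^sup>2)"

lemma l2_norm_nonneg [simp]: "0 \<le> l2_norm M u"
  by (simp add: l2_norm_def)

lemma l2_norm_power2: "(l2_norm M u)\<^sup>2 = (LINT x|M. (cmod (u x))\<^sup>2)"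
  by (simp add: l2_norm_def)

lemma integrable_cmod_mult:
  assumes "square_integrable M u" "square_integrable M v"
  shows "integrable M (\<lambda>x. cmod (u x) * cmod (v x))"
proof (rule Bochner_Integration.integrable_bound)
  show "integrable M (\<lambda>x. (cmod (u x))\<^sup>2 + (cmod (v x))\<^sup>2)"
    using assms by (simp add: square_integrable_def)
  have "cmod (u x) * cmod (v x) \<le> (cmod (u x))\<^sup>2 + (cmod (v x))\<^sup>2" for x
    using sum_squares_bound[of "cmod (u x)" "cmod (v x)"]
      mult_nonneg_nonneg[OF norm_ge_zero norm_ge_zero, of "u x" "v x"] by linarith
  then show "AE x in M. norm (cmod (u x) * cmod (v x)) \<le> norm ((cmod (u x))\<^sup>2 + (cmod (v x))\<^sup>2)"
    by simp
qed (use assms in \<open>auto simp: square_integrable_def\<close>)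

lemma integrable_mult_square_integrable:
  assumes "square_integrable M u" "square_integrable M v"
  shows "integrable M (\<lambda>x. u x * v x)"
  by (rule Bochner_Integration.integrable_bound[OF integrable_cmod_mult[OF assms]])
    (use assms in \<open>auto simp: square_integrable_def norm_mult\<close>)

lemma l2_norm_Cauchy_Schwarz:
  assumes "square_integrable M u" "square_integrable M v"
  shows "(LINT x|M. cmod (u x) * cmod (v x)) \<le> l2_norm M u * l2_norm M v"
proof -
  have [measurable]: "u \<in> borel_measurable M" "v \<in> borel_measurable M"
    and int: "integrable M (\<lambda>x. (cmod (u x))\<^sup>2)" "integrable M (\<lambda>x. (cmod (v x))\<^sup>2)"
    using assms by (auto simp: square_integrable_def)
  let ?I = "LINT x|M. cmod (u x) * cmod (v x)"
  have "ennreal (?I\<^sup>2) = (\<integral>\<^sup>+x. ennreal (cmod (u x)) * ennreal (cmod (v x)) \<partial>M)\<^sup>2"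
    using nn_integral_eq_integral[OF integrable_cmod_mult[OF assms]]
    by (simp add: ennreal_mult ennreal_power)
  also have "\<dots> \<le> (\<integral>\<^sup>+x. (ennreal (cmod (u x)))\<^sup>2 \<partial>M) * (\<integral>\<^sup>+x. (ennreal (cmod (v x)))\<^sup>2 \<partial>M)"
    by (rule Cauchy_Schwarz_nn_integral) auto
  also have "\<dots> = ennreal ((l2_norm M u)\<^sup>2 * (l2_norm M v)\<^sup>2)"
    by (simp add: ennreal_power nn_integral_eq_integral[OF int(1)]
      nn_integral_eq_integral[OF int(2)] ennreal_mult l2_norm_power2)
  finally have "?I\<^sup>2 \<le> (l2_norm M u * l2_norm M v)\<^sup>2"
    by (simp add: power_mult_distrib)
  then show ?thesis by (rule power2_le_imp_le) simp
qed

lemma cmod_LINT_mult_le: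
  assumes "square_integrable M u" "square_integrable M v"
  shows "cmod (LINT x|M. u x * v x) \<le> l2_norm M u * l2_norm M v"
proof -
  have "cmod (LINT x|M. u x * v x) \<le> (LINT x|M. cmod (u x * v x))"
    by (rule integral_norm_bound)
  then show ?thesis using l2_norm_Cauchy_Schwarz[OF assms] by (simp add: norm_mult)
qed

lemma square_integrable_cmult:
  "square_integrable M u \<Longrightarrow> square_integrable M (\<lambda>x. k * u x)"
  by (auto simp: square_integrable_def norm_mult power_mult_distrib)

lemma l2_norm_cmult: "l2_norm M (\<lambda>x. k * u x) = cmod k * l2_norm M u"
  by (simp add: l2_norm_def norm_mult power_mult_distrib real_sqrt_mult)

lemma square_integrable_add:
  assumes "square_integrable M u" "square_integrable M v"
  shows "square_integrable M (\<lambda>x. u x + v x)"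
  unfolding square_integrable_def
proof
  show "(\<lambda>x. u x + v x) \<in> borel_measurable M"
    using assms by (auto simp: square_integrable_def)
  show "integrable M (\<lambda>x. (cmod (u x + v x))\<^sup>2)"
  proof (rule Bochner_Integration.integrable_bound)
    show "integrable M (\<lambda>x. 2 * (cmod (u x))\<^sup>2 + 2 * (cmod (v x))\<^sup>2)"
      using assms by (simp add: square_integrable_def)
    have "(cmod (u x + v x))\<^sup>2 \<le> 2 * (cmod (u x))\<^sup>2 + 2 * (cmod (v x))\<^sup>2" for x
    proof -
      have "(cmod (u x + v x))\<^sup>2 \<le> (cmod (u x) + cmod (v x))\<^sup>2"
        by (intro power_mono norm_triangle_ineq) simp
      then show ?thesis
        using sum_squares_bound[of "cmod (u x)" "cmod (v x)"] by (simp add: power2_sum)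
    qed
    then show "AE x in M. norm ((cmod (u x + v x))\<^sup>2)
        \<le> norm (2 * (cmod (u x))\<^sup>2 + 2 * (cmod (v x))\<^sup>2)"
      by simp
  qed (use assms in \<open>auto simp: square_integrable_def\<close>)
qed

lemma l2_norm_triangle:
  assumes "square_integrable M u" "square_integrable M v"
  shows "l2_norm M (\<lambda>x. u x + v x) \<le> l2_norm M u + l2_norm M v"
proof (rule power2_le_imp_le)
  have "(l2_norm M (\<lambda>x. u x + v x))\<^sup>2
      \<le> (LINT x|M. (cmod (u x))\<^sup>2 + (cmod (v x))\<^sup>2 + 2 * (cmod (u x) * cmod (v x)))"
    unfolding l2_norm_power2
  proof (rule integral_mono)
    show "integrable M (\<lambda>x. (cmod (u x + v x))\<^sup>2)"
      using square_integrable_add[OF assms] by (simp add: square_integrable_def)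
    show "(cmod (u x + v x))\<^sup>2
        \<le> (cmod (u x))\<^sup>2 + (cmod (v x))\<^sup>2 + 2 * (cmod (u x) * cmod (v x))" for x
      using power_mono[OF norm_triangle_ineq, of "u x" "v x" 2] by (simp add: power2_sum)
  qed (use assms integrable_cmod_mult[OF assms] in \<open>auto simp: square_integrable_def\<close>)
  also have "\<dots> = (l2_norm M u)\<^sup>2 + (l2_norm M v)\<^sup>2 + 2 * (LINT x|M. cmod (u x) * cmod (v x))"
    using assms integrable_cmod_mult[OF assms]
    by (simp add: square_integrable_def l2_norm_power2)
  also have "\<dots> \<le> (l2_norm M u + l2_norm M v)\<^sup>2"
    using l2_norm_Cauchy_Schwarz[OF assms] by (simp add: power2_sum)
  finally show "(l2_norm M (\<lambda>x. u x + v x))\<^sup>2 \<le> (l2_norm M u + l2_norm M v)\<^sup>2" .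
qed simp

lemma square_integrable_bound:
  assumes "u \<in> borel_measurable M" "square_integrable M v" "\<And>x. x \<in> space M \<Longrightarrow> cmod (u x) \<le> cmod (v x)"
  shows "square_integrable M u"
  unfolding square_integrable_def
proof
  show "integrable M (\<lambda>x. (cmod (u x))\<^sup>2)"
    by (rule Bochner_Integration.integrable_bound[of _ "\<lambda>x. (cmod (v x))\<^sup>2"])
      (use assms in \<open>auto simp: square_integrable_def intro!: AE_I2 power_mono\<close>)
qed (rule assms)

text \<open>Fatou's lemma passes a uniform norm bound to a pointwise limit. It is applied to
  truncations and to partial sums of series, in place of completeness of the space.\<close>

lemma square_integrable_Fatou:
  assumes meas: "u \<in> borel_measurable M" and sq: "\<And>n. square_integrable M (v n)"
    and le: "\<And>n. l2_norm M (v n) \<le> K"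
    and lim: "\<And>x. x \<in> space M \<Longrightarrow> (\<lambda>n. v n x) \<longlonglongrightarrow> u x"
  shows "square_integrable M u" "l2_norm M u \<le> K"
proof -
  have K: "K \<ge> 0" using order_trans[OF l2_norm_nonneg le] .
  have [measurable]: "u \<in> borel_measurable M" "v n \<in> borel_measurable M" for n
    using meas sq by (auto simp: square_integrable_def)
  have "(\<integral>\<^sup>+x. (cmod (u x))\<^sup>2 \<partial>M) = (\<integral>\<^sup>+x. liminf (\<lambda>n. ennreal ((cmod (v n x))\<^sup>2)) \<partial>M)"
  proof (rule nn_integral_cong)
    fix x assume "x \<in> space M"
    then have "(\<lambda>n. ennreal ((cmod (v n x))\<^sup>2)) \<longlonglongrightarrow> ennreal ((cmod (u x))\<^sup>2)"
      by (intro tendsto_ennrealI tendsto_intros lim)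
    then show "ennreal ((cmod (u x))\<^sup>2) = liminf (\<lambda>n. ennreal ((cmod (v n x))\<^sup>2))"
      using lim_imp_Liminf[OF trivial_limit_sequentially] by metis
  qed
  also have "\<dots> \<le> liminf (\<lambda>n. \<integral>\<^sup>+x. ennreal ((cmod (v n x))\<^sup>2) \<partial>M)"
    by (rule nn_integral_liminf) auto
  also have "\<dots> \<le> liminf (\<lambda>n::nat. ennreal (K\<^sup>2))"
  proof (intro Liminf_mono always_eventually allI)
    fix n
    have "(\<integral>\<^sup>+x. ennreal ((cmod (v n x))\<^sup>2) \<partial>M) = ennreal ((l2_norm M (v n))\<^sup>2)"
      using sq[of n] by (simp add: square_integrable_def l2_norm_power2 nn_integral_eq_integral)
    also have "\<dots> \<le> ennreal (K\<^sup>2)"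
      by (intro ennreal_leI power_mono le) simp
    finally show "(\<integral>\<^sup>+x. ennreal ((cmod (v n x))\<^sup>2) \<partial>M) \<le> ennreal (K\<^sup>2)" .
  qed
  also have "\<dots> = ennreal (K\<^sup>2)"
    by (simp add: Liminf_const)
  finally have le': "(\<integral>\<^sup>+x. (cmod (u x))\<^sup>2 \<partial>M) \<le> ennreal (K\<^sup>2)" .
  then have "integrable M (\<lambda>x. (cmod (u x))\<^sup>2)"
    by (intro integrableI_nonneg) (auto intro: le_less_trans ennreal_less_top)
  then show sq: "square_integrable M u" by (simp add: square_integrable_def)
  have "ennreal ((l2_norm M u)\<^sup>2) \<le> ennreal (K\<^sup>2)"
    using le' sq by (simp add: square_integrable_def l2_norm_power2 nn_integral_eq_integral)
  then have "(l2_norm M u)\<^sup>2 \<le> K\<^sup>2" by simp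
  then show "l2_norm M u \<le> K" using K power2_le_imp_le by blast
qed

lemma square_integrable_affine:
  fixes u :: "real \<Rightarrow> complex"
  assumes "square_integrable lborel u" "c \<noteq> 0"
  shows "square_integrable lborel (\<lambda>x. u (t + c * x))"
  using assms lborel_integrable_real_affine[of "\<lambda>x. (cmod (u x))\<^sup>2" c t]
  by (auto simp: square_integrable_def)

lemma l2_norm_affine:
  fixes u :: "real \<Rightarrow> complex"
  assumes "c \<noteq> 0"
  shows "l2_norm lborel (\<lambda>x. u (t + c * x)) = l2_norm lborel u / sqrt \<bar>c\<bar>"
proof -
  have "(LINT x|lborel. (cmod (u x))\<^sup>2) = \<bar>c\<bar> * (LINT x|lborel. (cmod (u (t + c * x)))\<^sup>2)"
    using lborel_integral_real_affine[OF assms, of "\<lambda>x. (cmod (u x))\<^sup>2" t] by simp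
  then show ?thesis using assms by (simp add: l2_norm_def real_sqrt_mult)
qed

section \<open>The Paley-Wiener space as a normed vector space\<close>

lemma continuous_on_of_real_comp:
  "f holomorphic_on UNIV \<Longrightarrow> continuous_on A (\<lambda>t::real. f (of_real t))"
  by (rule continuous_on_compose2[of UNIV f])
    (auto intro: holomorphic_on_imp_continuous_on continuous_intros)

lemma borel_measurable_of_real_comp:
  "f holomorphic_on UNIV \<Longrightarrow> (\<lambda>t::real. f (of_real t)) \<in> borel_measurable lborel"
  using borel_measurable_continuous_onI[OF continuous_on_of_real_comp] by simp

lemma paley_wiener_iff:
  "f \<in> paley_wiener a \<longleftrightarrow>
     f holomorphic_on UNIV \<and> exponential_type_le a f \<and> square_integrable lborel (\<lambda>t. f (of_real t))"
  using borel_measurable_of_real_comp[of f] by (auto simp: paley_wiener_def square_integrable_def)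

lemma pw_norm_eq: "pw_norm f = l2_norm lborel (\<lambda>t. f (of_real t))"
proof -
  have "f (of_real t) * cnj (f (of_real t)) = of_real ((cmod (f (of_real t)))\<^sup>2)" for t
    by (rule complex_norm_square[symmetric])
  then show ?thesis by (simp add: pw_norm_def pw_inner_def l2_norm_def del: of_real_power)
qed

lemma pw_norm_nonneg [simp]: "0 \<le> pw_norm f"
  by (simp add: pw_norm_eq)

lemma pw_norm_cmult: "pw_norm (\<lambda>z. k * f z) = cmod k * pw_norm f"
  by (simp add: pw_norm_eq l2_norm_cmult)

lemma pw_norm_triangle:
  assumes "f \<in> paley_wiener a" "g \<in> paley_wiener b"
  shows "pw_norm (\<lambda>z. f z + g z) \<le> pw_norm f + pw_norm g"
  using assms l2_norm_triangle[of lborel "\<lambda>t. f (of_real t)" "\<lambda>t. g (of_real t)"]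
  by (simp add: pw_norm_eq paley_wiener_iff)

lemma exponential_type_le_add:
  assumes "exponential_type_le a f" "exponential_type_le a g"
  shows "exponential_type_le a (\<lambda>z. f z + g z)"
  unfolding exponential_type_le_def
proof (intro allI impI)
  fix \<epsilon> :: real assume "\<epsilon> > 0"
  then obtain C D where "\<And>z. cmod (f z) \<le> C * exp ((a + \<epsilon>) * cmod z)"
    "\<And>z. cmod (g z) \<le> D * exp ((a + \<epsilon>) * cmod z)"
    using assms unfolding exponential_type_le_def by meson
  then have "cmod (f z + g z) \<le> (C + D) * exp ((a + \<epsilon>) * cmod z)" for z
    using norm_triangle_le add_mono unfolding distrib_right by metis
  then show "\<exists>C. \<forall>z. cmod (f z + g z) \<le> C * exp ((a + \<epsilon>) * cmod z)" by blast
qed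

text \<open>The dilation scales the type while the shift costs only the constant
  \<open>exp ((a + \<epsilon>) * cmod w)\<close>; \<open>cmod c \<le> 1\<close> keeps the excess
  within the same \<open>\<epsilon>\<close>.\<close>

lemma exponential_type_le_affine:
  assumes "exponential_type_le a f" "cmod c \<le> 1" "a \<ge> 0"
  shows "exponential_type_le (a * cmod c) (\<lambda>z. k * f (c * z + w))"
  unfolding exponential_type_le_def
proof (intro allI impI)
  fix \<epsilon> :: real assume \<epsilon>: "\<epsilon> > 0"
  then obtain C where C: "\<And>z. cmod (f z) \<le> C * exp ((a + \<epsilon>) * cmod z)"
    using assms unfolding exponential_type_le_def by meson
  have "C \<ge> 0" using order_trans[OF norm_ge_zero C[of 0]] by simp
  have "cmod (k * f (c * z + w)) \<le> cmod k * (C * exp ((a + \<epsilon>) * cmod w)) * exp ((a * cmod c + \<epsilon>) * cmod z)" for z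
  proof -
    have "cmod (c * z + w) \<le> cmod c * cmod z + cmod w"
      by (metis norm_mult norm_triangle_ineq)
    then have "(a + \<epsilon>) * cmod (c * z + w) \<le> (a + \<epsilon>) * (cmod c * cmod z + cmod w)"
      using assms \<epsilon> by (intro mult_left_mono) auto
    also have "\<dots> = a * cmod c * cmod z + \<epsilon> * (cmod c * cmod z) + (a + \<epsilon>) * cmod w"
      by (simp add: algebra_simps)
    also have "\<epsilon> * (cmod c * cmod z) \<le> \<epsilon> * (1 * cmod z)"
      using assms \<epsilon> by (intro mult_left_mono mult_right_mono) auto
    finally have "(a + \<epsilon>) * cmod (c * z + w) \<le> (a * cmod c + \<epsilon>) * cmod z + (a + \<epsilon>) * cmod w"
      by (simp add: algebra_simps)
    then have "C * exp ((a + \<epsilon>) * cmod (c * z + w)) \<le> C * exp ((a * cmod c + \<epsilon>) * cmod z + (a + \<epsilon>) * cmod w)"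
      using \<open>C \<ge> 0\<close> by (intro mult_left_mono) auto
    then have "cmod (f (c * z + w)) \<le> C * exp ((a + \<epsilon>) * cmod w) * exp ((a * cmod c + \<epsilon>) * cmod z)"
      using C[of "c * z + w"] by (simp add: exp_add mult_ac)
    then show ?thesis
      unfolding norm_mult mult.assoc[of "cmod k"] by (intro mult_left_mono) auto
  qed
  then show "\<exists>C. \<forall>z. cmod (k * f (c * z + w)) \<le> C * exp ((a * cmod c + \<epsilon>) * cmod z)" by blast
qed

lemma exponential_type_le_mono:
  assumes "exponential_type_le b f" "b \<le> a"
  shows "exponential_type_le a f"
  unfolding exponential_type_le_def
proof (intro allI impI)
  fix \<epsilon> :: real assume \<epsilon>: "\<epsilon> > 0"
  then obtain C where C: "\<And>z. cmod (f z) \<le> C * exp ((b + (a - b + \<epsilon>)) * cmod z)"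
    using assms unfolding exponential_type_le_def by (meson add_nonneg_pos diff_ge_0_iff_ge)
  then show "\<exists>C. \<forall>z. cmod (f z) \<le> C * exp ((a + \<epsilon>) * cmod z)"
    by (intro exI[of _ C]) (simp add: algebra_simps)
qed

lemma exponential_type_leI:
  assumes "\<And>z. cmod (f z) \<le> C * exp (a * cmod z)"
  shows "exponential_type_le a f"
  unfolding exponential_type_le_def
proof (intro allI impI exI[of _ C])
  fix \<epsilon> :: real and z assume \<epsilon>: "\<epsilon> > 0"
  have "C \<ge> 0" using order_trans[OF norm_ge_zero assms[of 0]] by simp
  then have "C * exp (a * cmod z) \<le> C * exp ((a + \<epsilon>) * cmod z)"
    using \<epsilon> by (intro mult_left_mono) (auto simp: distrib_right)
  then show "cmod (f z) \<le> C * exp ((a + \<epsilon>) * cmod z)" using assms[of z] by linarith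
qed

lemma paley_wiener_mono: "b \<le> a \<Longrightarrow> paley_wiener b \<subseteq> paley_wiener a"
  using exponential_type_le_mono by (auto simp: paley_wiener_iff)

lemma paley_wiener_zero: "a \<ge> 0 \<Longrightarrow> (\<lambda>z. 0) \<in> paley_wiener a"
  by (auto simp: paley_wiener_def intro: exponential_type_leI[of _ 0])

lemma paley_wiener_add:
  "f \<in> paley_wiener a \<Longrightarrow> g \<in> paley_wiener a \<Longrightarrow> (\<lambda>z. f z + g z) \<in> paley_wiener a"
  by (auto simp: paley_wiener_iff intro: holomorphic_intros exponential_type_le_add square_integrable_add)

lemma paley_wiener_cmult:
  "a \<ge> 0 \<Longrightarrow> f \<in> paley_wiener a \<Longrightarrow> (\<lambda>z. k * f z) \<in> paley_wiener a"
  using exponential_type_le_affine[of a f 1 k 0]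
  by (auto simp: paley_wiener_iff intro: holomorphic_intros square_integrable_cmult)

section \<open>Combinations of translations\<close>

text \<open>An entry \<open>(k, w)\<close> is a coefficient and a shift. On
  \<open>exp (\<i> * s * z)\<close> the sum acts as multiplication by the exponential sum of the
  \<open>k * exp (\<i> * s * w)\<close>, so these are the operators whose Fourier multipliers are
  exponential sums. With lists, concrete combinations unfold by simplification.\<close>

definition translation_sum ::
    "(complex \<times> complex) list \<Rightarrow> (complex \<Rightarrow> complex) \<Rightarrow> complex \<Rightarrow> complex" where
  "translation_sum xs f z = (\<Sum>(k, w)\<leftarrow>xs. k * f (z + w))"

lemma translation_sum_Nil [simp]: "translation_sum [] f z = 0"
  and translation_sum_Cons [simp]:
    "translation_sum ((k, w) # xs) f z = k * f (z + w) + translation_sum xs f z"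
  by (simp_all add: translation_sum_def)

lemma holomorphic_on_affine_comp:
  assumes "f holomorphic_on UNIV"
  shows "(\<lambda>z. f (c * z + w)) holomorphic_on A"
  by (rule holomorphic_on_compose[OF _ holomorphic_on_subset[OF assms], unfolded o_def])
    (auto intro!: holomorphic_intros)

lemma holomorphic_translation_sum:
  assumes "f holomorphic_on UNIV"
  shows "translation_sum xs f holomorphic_on UNIV"
proof (induction xs)
  case (Cons x xs)
  obtain k w where "x = (k, w)" by fastforce
  then show ?case
    using Cons holomorphic_on_affine_comp[OF assms, of 1 w UNIV]
    by (simp add: holomorphic_on_add holomorphic_on_mult cong: holomorphic_cong)
qed (simp cong: holomorphic_cong)

lemma exponential_type_le_translation_sum:
  assumes "exponential_type_le a f" "a \<ge> 0"
  shows "exponential_type_le a (translation_sum xs f)"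
proof (induction xs)
  case Nil
  then show ?case
    by (rule exponential_type_leI[of _ 0]) simp
next
  case (Cons x xs)
  obtain k w where x: "x = (k, w)" by fastforce
  have "exponential_type_le a (\<lambda>z. k * f (z + w))"
    using exponential_type_le_affine[OF assms(1), of 1 k w] assms by simp
  from exponential_type_le_add[OF this Cons]
  show ?case by (simp add: x exponential_type_le_def)
qed

section \<open>Smoothing against a kernel on a bounded interval\<close>

lemma continuous_on_translate:
  "f holomorphic_on UNIV \<Longrightarrow> continuous_on A (\<lambda>t::real. f (z + of_real t))"
  by (rule continuous_on_compose2[of UNIV f])
    (auto intro: holomorphic_on_imp_continuous_on continuous_intros)

lemma has_field_derivative_smoothing:
  fixes \<psi> :: "real \<Rightarrow> complex"
  assumes f: "f holomorphic_on UNIV" and \<psi>: "continuous_on {a..b} \<psi>"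
  shows "((\<lambda>z. integral {a..b} (\<lambda>t. f (z + of_real t) * \<psi> t)) has_field_derivative
    integral {a..b} (\<lambda>t. deriv f (z + of_real t) * \<psi> t)) (at z)"
proof -
  have "((\<lambda>z. integral (cbox a b) (\<lambda>t. f (z + of_real t) * \<psi> t)) has_field_derivative
    integral (cbox a b) (\<lambda>t. deriv f (z + of_real t) * \<psi> t)) (at z within UNIV)"
  proof (rule leibniz_rule_field_derivative)
    fix z :: complex and t :: real assume "t \<in> cbox a b"
    have "(f has_field_derivative deriv f (z + of_real t)) (at (z + of_real t))"
      using f holomorphic_derivI by blast
    then show "((\<lambda>z. f (z + of_real t) * \<psi> t) has_field_derivative deriv f (z + of_real t) * \<psi> t)
        (at z within UNIV)"
      by (intro DERIV_cmult_right) (simp add: DERIV_shift add.commute)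
  next
    fix z :: complex
    show "(\<lambda>t. f (z + of_real t) * \<psi> t) integrable_on cbox a b"
      using \<psi> by (intro integrable_continuous continuous_intros continuous_on_translate f) auto
  next
    have "continuous_on (UNIV \<times> cbox a b) (\<lambda>x. \<psi> (snd x))"
      by (rule continuous_on_compose2[OF \<psi>]) (auto intro: continuous_intros)
    moreover have "continuous_on (UNIV \<times> cbox a b) (\<lambda>x. deriv f (fst x + of_real (snd x)))"
      by (rule continuous_on_compose2[of UNIV "deriv f"])
        (auto intro!: continuous_intros holomorphic_on_imp_continuous_on holomorphic_deriv f)
    ultimately show "continuous_on (UNIV \<times> cbox a b) (\<lambda>(z, t). deriv f (z + of_real t) * \<psi> t)"
      unfolding split_beta by (intro continuous_on_mult)
  qed auto
  then show ?thesis by simp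
qed

lemma smoothing_holomorphic:
  fixes \<psi> :: "real \<Rightarrow> complex"
  assumes "f holomorphic_on UNIV" "continuous_on {a..b} \<psi>"
  shows "(\<lambda>z. integral {a..b} (\<lambda>t. f (z + of_real t) * \<psi> t)) holomorphic_on UNIV"
  using has_field_derivative_smoothing[OF assms]
  by (auto simp: holomorphic_on_open)

text \<open>Smoothing an element of the space against a compactly supported function gives an entire
  function of the same type that is bounded on the real line, hence controlled everywhere.\<close>

lemma smoothing_bound:
  fixes \<psi> :: "real \<Rightarrow> complex"
  assumes a: "a \<ge> 0" and f: "f \<in> paley_wiener a" and \<psi>: "continuous_on {l..r} \<psi>"
    and M: "M > pw_norm f * sqrt (integral {l..r} (\<lambda>t. (cmod (\<psi> t))\<^sup>2))"
  shows "cmod (integral {l..r} (\<lambda>t. f (z + of_real t) * \<psi> t)) \<le> M * exp (a * \<bar>Im z\<bar>)"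
proof -
  have holf: "f holomorphic_on UNIV" and type: "exponential_type_le a f"
    and sq: "square_integrable lborel (\<lambda>t. f (of_real t))"
    using f by (auto simp: paley_wiener_iff)
  define G where "G z = integral {l..r} (\<lambda>t. f (z + of_real t) * \<psi> t)" for z
  have cont: "continuous_on {l..r} (\<lambda>t. f (z + of_real t) * \<psi> t)" for z
    by (intro continuous_intros continuous_on_translate holf \<psi>)
  \<comment> \<open>Extending \<open>\<psi>\<close> by zero turns the smoothed value into an L2
    pairing over the whole line.\<close>
  define v where "v t = indicator {l..r} t *\<^sub>R \<psi> t" for t
  have v: "square_integrable lborel v"
    and v_norm: "l2_norm lborel v = sqrt (integral {l..r} (\<lambda>t. (cmod (\<psi> t))\<^sup>2))"
  proof -
    have eq: "(cmod (v t))\<^sup>2 = indicator {l..r} t *\<^sub>R (cmod (\<psi> t))\<^sup>2" for t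
      by (simp add: v_def indicator_def)
    have si: "set_integrable lborel {l..r} (\<lambda>t. (cmod (\<psi> t))\<^sup>2)"
      by (intro borel_integrable_atLeastAtMost' continuous_intros \<psi>)
    have "set_integrable lborel {l..r} \<psi>"
      by (intro borel_integrable_atLeastAtMost' \<psi>)
    then have "v \<in> borel_measurable lborel"
      unfolding set_integrable_def v_def by (rule borel_measurable_integrable)
    then show "square_integrable lborel v"
      using si by (simp add: square_integrable_def eq set_integrable_def)
    show "l2_norm lborel v = sqrt (integral {l..r} (\<lambda>t. (cmod (\<psi> t))\<^sup>2))"
      using set_borel_integral_eq_integral(2)[OF si]
      by (simp add: l2_norm_def eq set_lebesgue_integral_def)
  qed
  have "cmod (G z) \<le> M * exp (a * \<bar>Im z\<bar>)"
  proof (rule exponential_type_le_bound)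
    show "G holomorphic_on UNIV"
      unfolding G_def by (rule smoothing_holomorphic[OF holf \<psi>])
    show "exponential_type_le a G"
      unfolding exponential_type_le_def
    proof (intro allI impI)
      fix \<epsilon> :: real assume \<epsilon>: "\<epsilon> > 0"
      then obtain C where C: "\<And>z. cmod (f z) \<le> C * exp ((a + \<epsilon>) * cmod z)"
        using type unfolding exponential_type_le_def by meson
      have "C \<ge> 0" using order_trans[OF norm_ge_zero C[of 0]] by simp
      define N where "N = max \<bar>l\<bar> \<bar>r\<bar>"
      define D where "D = integral {l..r} (\<lambda>t. C * exp ((a + \<epsilon>) * N) * cmod (\<psi> t))"
      have "cmod (G z) \<le> D * exp ((a + \<epsilon>) * cmod z)" for z
      proof -
        have "cmod (G z) \<le> integral {l..r} (\<lambda>t. (C * exp ((a + \<epsilon>) * N) * cmod (\<psi> t)) * exp ((a + \<epsilon>) * cmod z))"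
          unfolding G_def
        proof (rule integral_norm_bound_integral)
          show "(\<lambda>t. f (z + of_real t) * \<psi> t) integrable_on {l..r}"
            using cont by (rule integrable_continuous_real)
          show "(\<lambda>t. (C * exp ((a + \<epsilon>) * N) * cmod (\<psi> t)) * exp ((a + \<epsilon>) * cmod z)) integrable_on {l..r}"
            by (intro integrable_continuous_real continuous_intros \<psi>)
          fix t assume t: "t \<in> {l..r}"
          have "cmod (z + of_real t) \<le> N + cmod z"
            using norm_triangle_ineq[of z "of_real t"] t by (auto simp: N_def)
          then have "(a + \<epsilon>) * cmod (z + of_real t) \<le> (a + \<epsilon>) * (N + cmod z)"
            using a \<epsilon> by (intro mult_left_mono) auto
          then have "C * exp ((a + \<epsilon>) * cmod (z + of_real t)) \<le> C * exp ((a + \<epsilon>) * (N + cmod z))"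
            using \<open>C \<ge> 0\<close> by (intro mult_left_mono) auto
          with C[of "z + of_real t"] have "cmod (f (z + of_real t)) \<le> C * exp ((a + \<epsilon>) * (N + cmod z))"
            by linarith
          then have "cmod (f (z + of_real t)) * cmod (\<psi> t) \<le> C * exp ((a + \<epsilon>) * (N + cmod z)) * cmod (\<psi> t)"
            by (intro mult_right_mono) auto
          then show "cmod (f (z + of_real t) * \<psi> t)
              \<le> (C * exp ((a + \<epsilon>) * N) * cmod (\<psi> t)) * exp ((a + \<epsilon>) * cmod z)"
            by (simp add: norm_mult distrib_left exp_add mult_ac)
        qed
        then show ?thesis by (simp add: D_def)
      qed
      then show "\<exists>C. \<forall>z. cmod (G z) \<le> C * exp ((a + \<epsilon>) * cmod z)" by blast
    qed
    \<comment> \<open>A real translation preserves the norm, so Cauchy-Schwarz bounds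
      \<open>G\<close> uniformly on the real line.\<close>
    show "cmod (G (of_real x)) \<le> M" for x
    proof -
      have sqx: "square_integrable lborel (\<lambda>t. f (of_real x + of_real t))"
        using square_integrable_affine[OF sq, of 1 x] by simp
      have nx: "l2_norm lborel (\<lambda>t. f (of_real x + of_real t)) = pw_norm f"
        using l2_norm_affine[of 1 "\<lambda>t. f (of_real t)" x] by (simp add: pw_norm_eq)
      have "G (of_real x) = (LINT t|lborel. f (of_real x + of_real t) * v t)"
        using set_borel_integral_eq_integral(2)[OF borel_integrable_atLeastAtMost'[OF cont[of "of_real x"]]]
        by (simp add: G_def v_def set_lebesgue_integral_def)
      also have "cmod \<dots> \<le> pw_norm f * sqrt (integral {l..r} (\<lambda>t. (cmod (\<psi> t))\<^sup>2))"
        using cmod_LINT_mult_le[OF sqx v] by (simp add: nx v_norm)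
      finally show ?thesis using M by simp
    qed
    \<comment> \<open>The strict inequality assumed for \<open>M\<close> yields \<open>M > 0\<close>
      even when \<open>f\<close> or \<open>\<psi>\<close> vanishes.\<close>
    have "0 \<le> pw_norm f * sqrt (integral {l..r} (\<lambda>t. (cmod (\<psi> t))\<^sup>2))"
      using l2_norm_nonneg[of lborel v] by (simp add: v_norm)
    then show "M > 0" using M by linarith
  qed (rule a)
  then show ?thesis by (simp add: G_def)
qed

text \<open>Translations commute with smoothing. A scalar estimate for the smoothed function at
  \<open>0\<close> thereby becomes an estimate for the pairing of
  \<open>translation_sum xs f\<close> with \<open>\<psi>\<close>.\<close>

lemma translation_sum_smoothing:
  fixes \<psi> :: "real \<Rightarrow> complex"
  assumes f: "f holomorphic_on UNIV" and \<psi>: "continuous_on {l..r} \<psi>"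
  shows "translation_sum xs (\<lambda>z. integral {l..r} (\<lambda>t. f (z + of_real t) * \<psi> t)) z =
    integral {l..r} (\<lambda>t. translation_sum xs f (z + of_real t) * \<psi> t)"
proof (induction xs)
  case (Cons x xs)
  obtain k w where x: "x = (k, w)" by fastforce
  have "(\<lambda>t. k * (f (z + w + of_real t) * \<psi> t)) integrable_on {l..r}"
    "(\<lambda>t. translation_sum xs f (z + of_real t) * \<psi> t) integrable_on {l..r}"
    by (intro integrable_continuous_real continuous_intros continuous_on_translate
      holomorphic_translation_sum f \<psi>)+
  then have "integral {l..r} (\<lambda>t. k * (f (z + w + of_real t) * \<psi> t)
      + translation_sum xs f (z + of_real t) * \<psi> t)
      = k * integral {l..r} (\<lambda>t. f (z + w + of_real t) * \<psi> t)
      + integral {l..r} (\<lambda>t. translation_sum xs f (z + of_real t) * \<psi> t)"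
    by (subst Henstock_Kurzweil_Integration.integral_add) auto
  then show ?case using Cons by (simp add: x algebra_simps)
qed simp

text \<open>A bound for a combination of translations that holds pointwise for all entire functions
  with \<open>\<bar>G z\<bar> \<le> e\<^bsup>a\<bar>Im z\<bar>\<^esup>\<close> passes to the operator norm: test the combination against its own
  conjugate on a long interval.\<close>

theorem translation_sum_norm_le:
  assumes a: "a \<ge> 0" and f: "f \<in> paley_wiener a" and \<delta>: "\<delta> \<ge> 0"
    and scalar: "\<And>G. G holomorphic_on UNIV \<Longrightarrow> (\<And>z. cmod (G z) \<le> exp (a * \<bar>Im z\<bar>)) \<Longrightarrow>
      cmod (translation_sum xs G 0) \<le> \<delta>"
  shows "translation_sum xs f \<in> paley_wiener a" "pw_norm (translation_sum xs f) \<le> \<delta> * pw_norm f"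
proof -
  have holf: "f holomorphic_on UNIV" and type: "exponential_type_le a f"
    using f by (auto simp: paley_wiener_iff)
  define u where "u = translation_sum xs f"
  have holu: "u holomorphic_on UNIV"
    unfolding u_def by (rule holomorphic_translation_sum[OF holf])
  have contu: "continuous_on A (\<lambda>t::real. u (of_real t))" for A
    by (rule continuous_on_of_real_comp[OF holu])
  \<comment> \<open>Square integrability of \<open>u\<close> is still to be proved, so truncations
    to \<open>[-n, n]\<close> are bounded first and Fatou's lemma finishes.\<close>
  define v where "v n t = indicator {- real n..real n} t *\<^sub>R u (of_real t)" for n t
  have sq_v: "square_integrable lborel (v n)"
    and int_v: "(l2_norm lborel (v n))\<^sup>2 = integral {- real n..real n} (\<lambda>t. (cmod (u (of_real t)))\<^sup>2)"
    for n
  proof -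
    have eq: "(cmod (v n t))\<^sup>2 = indicator {- real n..real n} t *\<^sub>R (cmod (u (of_real t)))\<^sup>2" for t
      by (simp add: v_def indicator_def)
    have si: "set_integrable lborel {- real n..real n} (\<lambda>t. (cmod (u (of_real t)))\<^sup>2)"
      by (intro borel_integrable_atLeastAtMost' continuous_intros contu)
    have "set_integrable lborel {- real n..real n} (\<lambda>t. u (of_real t))"
      by (intro borel_integrable_atLeastAtMost' contu)
    then have "v n \<in> borel_measurable lborel"
      unfolding set_integrable_def v_def by (rule borel_measurable_integrable)
    then show "square_integrable lborel (v n)"
      using si by (simp add: square_integrable_def eq set_integrable_def)
    show "(l2_norm lborel (v n))\<^sup>2 = integral {- real n..real n} (\<lambda>t. (cmod (u (of_real t)))\<^sup>2)"
      using set_borel_integral_eq_integral(2)[OF si]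
      by (simp add: l2_norm_power2 eq set_lebesgue_integral_def)
  qed
  have le: "l2_norm lborel (v n) \<le> \<delta> * pw_norm f" for n
  proof -
    define A where "A = l2_norm lborel (v n)"
    \<comment> \<open>With this test function the combination applied to \<open>G\<close> has the
      value \<open>A\<^sup>2\<close> at \<open>0\<close>.\<close>
    define \<psi> where "\<psi> t = cnj (u (of_real t))" for t :: real
    define G where "G z = integral {- real n..real n} (\<lambda>t. f (z + of_real t) * \<psi> t)" for z
    have \<psi>: "continuous_on {- real n..real n} \<psi>"
      unfolding \<psi>_def by (intro continuous_intros contu)
    have "sqrt (integral {- real n..real n} (\<lambda>t. (cmod (\<psi> t))\<^sup>2)) = A"
      using int_v[of n] by (simp add: \<psi>_def A_def real_sqrt_unique)
    note bd = smoothing_bound[OF a f \<psi>, unfolded this]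
    have uG: "translation_sum xs G 0 = of_real (A\<^sup>2)"
    proof -
      have "translation_sum xs G 0 = integral {- real n..real n} (\<lambda>t. u (of_real t) * \<psi> t)"
        using translation_sum_smoothing[OF holf \<psi>, of xs 0] by (simp add: G_def[abs_def] u_def)
      also have "(\<lambda>t::real. u (of_real t) * \<psi> t) = (\<lambda>t. of_real ((cmod (u (of_real t)))\<^sup>2))"
        by (simp only: \<psi>_def complex_norm_square)
      also have "integral {- real n..real n} \<dots> = of_real (integral {- real n..real n} (\<lambda>t. (cmod (u (of_real t)))\<^sup>2))"
        by (rule integral_linear[OF _ bounded_linear_of_real, unfolded o_def])
          (intro integrable_continuous_real continuous_intros contu)
      finally show ?thesis by (simp add: A_def int_v)
    qed
    \<comment> \<open>Dividing \<open>G\<close> by \<open>M\<close> normalises it for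
      \<open>scalar\<close>. Letting \<open>M\<close> decrease to \<open>pw_norm f * A\<close> and
      cancelling one factor \<open>A\<close> gives the claim.\<close>
    have "A\<^sup>2 \<le> \<delta> * M" if M: "M > pw_norm f * A" for M
    proof -
      have "M > 0" using le_less_trans[OF _ M, of 0] by (simp add: A_def)
      have "cmod (translation_sum xs (\<lambda>z. of_real (1 / M) * G z) 0) \<le> \<delta>"
      proof (rule scalar)
        show "(\<lambda>z. of_real (1 / M) * G z) holomorphic_on UNIV"
          unfolding G_def by (intro holomorphic_intros smoothing_holomorphic holf \<psi>)
        show "cmod (of_real (1 / M) * G z) \<le> exp (a * \<bar>Im z\<bar>)" for z
          using bd[OF M, of z] \<open>M > 0\<close>
          by (simp add: norm_mult norm_divide G_def divide_le_eq mult.commute)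
      qed
      moreover have "translation_sum xs (\<lambda>z. k * G z) z = k * translation_sum xs G z" for k z
        by (induction xs) (auto simp: algebra_simps)
      ultimately have "cmod (of_real (1 / M) * of_real (A\<^sup>2)) \<le> \<delta>"
        by (simp only: uG)
      then show ?thesis using \<open>M > 0\<close>
        by (simp add: norm_mult norm_divide norm_power divide_le_eq)
    qed
    then have "A\<^sup>2 \<le> \<delta> * (pw_norm f * A + e)" if "e > 0" for e
      using that by simp
    then have "\<forall>\<^sub>F e in at_right 0. A\<^sup>2 \<le> \<delta> * (pw_norm f * A + e)"
      by (intro eventually_mono[OF eventually_at_right_less[of 0]])
    moreover have "((\<lambda>e. \<delta> * (pw_norm f * A + e)) \<longlongrightarrow> \<delta> * (pw_norm f * A + 0)) (at_right 0)"
      by (intro tendsto_intros)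
    ultimately have "A\<^sup>2 \<le> \<delta> * (pw_norm f * A + 0)"
      by (intro tendsto_lowerbound[OF _ _ trivial_limit_at_right_real])
    then have "A * A \<le> (\<delta> * pw_norm f) * A" by (simp add: power2_eq_square mult_ac)
    then have "A \<le> \<delta> * pw_norm f" if "A > 0" using that by simp
    moreover have "\<delta> * pw_norm f \<ge> 0" using \<delta> by simp
    ultimately show ?thesis unfolding A_def[symmetric] by linarith
  qed
  have lim: "(\<lambda>n. v n t) \<longlonglongrightarrow> u (of_real t)" for t
  proof (rule tendsto_eventually)
    obtain m :: nat where m: "\<bar>t\<bar> \<le> real m" using real_arch_simple by blast
    have "v n t = u (of_real t)" if "n \<ge> m" for n
    proof -
      have "\<bar>t\<bar> \<le> real n" using that m by linarith
      then show ?thesis by (simp add: v_def abs_le_iff)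
    qed
    then show "\<forall>\<^sub>F n in sequentially. v n t = u (of_real t)"
      using eventually_sequentially by blast
  qed
  have meas: "(\<lambda>t. u (of_real t)) \<in> borel_measurable lborel"
    by (rule borel_measurable_of_real_comp[OF holu])
  note F = square_integrable_Fatou[OF meas sq_v le lim]
  show "translation_sum xs f \<in> paley_wiener a"
    using F(1) holu exponential_type_le_translation_sum[OF type a, of xs]
    by (simp add: paley_wiener_iff u_def)
  show "pw_norm (translation_sum xs f) \<le> \<delta> * pw_norm f"
    using F(2) by (simp add: pw_norm_eq u_def)
qed

section \<open>Norms of translations and differences of translations, and point evaluation\<close>

lemma translate_paley_wiener:
  assumes "a \<ge> 0" "f \<in> paley_wiener a"
  shows "(\<lambda>z. f (z + w)) \<in> paley_wiener a" "pw_norm (\<lambda>z. f (z + w)) \<le> exp (a * \<bar>Im w\<bar>) * pw_norm f"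
proof -
  \<comment> \<open>For a single translation the scalar condition is just the growth assumed of
    \<open>G\<close> at the point \<open>w\<close>.\<close>
  have eq: "translation_sum [(1, w)] f = (\<lambda>z. f (z + w))" by auto
  note T = translation_sum_norm_le[of a f "exp (a * \<bar>Im w\<bar>)" "[(1, w)]", OF assms, unfolded eq]
  show "(\<lambda>z. f (z + w)) \<in> paley_wiener a" "pw_norm (\<lambda>z. f (z + w)) \<le> exp (a * \<bar>Im w\<bar>) * pw_norm f"
    by (rule T; simp)+
qed

text \<open>Cauchy's inequality on a circle of radius \<open>r\<close>, along which
  \<open>\<bar>Im\<bar>\<close> increases by at most \<open>r\<close>; a weak form of Bernstein's
  inequality.\<close>

lemma cmod_deriv_le_of_exp_bound:
  assumes G: "G holomorphic_on UNIV" and le: "\<And>z. cmod (G z) \<le> B * exp (a * \<bar>Im z\<bar>)"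
    and r: "r > 0" and a: "a \<ge> 0" and B: "B \<ge> 0"
  shows "cmod (deriv G z) \<le> B * exp (a * (\<bar>Im z\<bar> + r)) / r"
proof -
  have "cmod ((deriv ^^ 1) G z) \<le> fact 1 * (B * exp (a * (\<bar>Im z\<bar> + r))) / r ^ 1"
  proof (rule Cauchy_inequality)
    fix x assume "cmod (z - x) = r"
    then have "\<bar>Im x\<bar> \<le> \<bar>Im z\<bar> + r" using abs_Im_le_cmod[of "z - x"] by simp
    then have "a * \<bar>Im x\<bar> \<le> a * (\<bar>Im z\<bar> + r)" using a by (rule mult_left_mono)
    then have "B * exp (a * \<bar>Im x\<bar>) \<le> B * exp (a * (\<bar>Im z\<bar> + r))"
      using B by (intro mult_left_mono) auto
    then show "cmod (G x) \<le> B * exp (a * (\<bar>Im z\<bar> + r))" using le[of x] by linarith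
  qed (use G r in \<open>auto intro: holomorphic_on_subset holomorphic_on_imp_continuous_on\<close>)
  then show ?thesis by simp
qed

text \<open>The scalar form is the mean value bound for \<open>G w - G 0\<close>, with the
  derivative estimated by Cauchy at radius \<open>1 / a\<close>. Short translations are thus
  norm-close to the identity; this serves both the approximate eigenvectors and the Neumann series
  around the identity.\<close>

lemma translate_diff_norm_le:
  assumes a: "a > 0" and f: "f \<in> paley_wiener a"
  shows "pw_norm (\<lambda>z. f (z + w) - f z) \<le> a * cmod w * exp (1 + a * cmod w) * pw_norm f"
proof -
  have eq: "translation_sum [(1, w), (- 1, 0)] f = (\<lambda>z. f (z + w) - f z)" by auto
  have "pw_norm (translation_sum [(1, w), (- 1, 0)] f) \<le> (a * cmod w * exp (1 + a * cmod w)) * pw_norm f"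
  proof (rule translation_sum_norm_le(2)[of a])
    fix G assume G: "G holomorphic_on UNIV" and le: "\<And>z. cmod (G z) \<le> exp (a * \<bar>Im z\<bar>)"
    have "cmod (G w - G 0) \<le> (a * exp (1 + a * cmod w)) * cmod (w - 0)"
    proof (rule field_differentiable_bound[where S = "cball 0 (cmod w)" and f' = "deriv G"])
      fix z :: complex assume z: "z \<in> cball 0 (cmod w)"
      show "(G has_field_derivative deriv G z) (at z within cball 0 (cmod w))"
        using G holomorphic_derivI by (meson UNIV_I has_field_derivative_at_within open_UNIV)
      have "cmod (deriv G z) \<le> 1 * exp (a * (\<bar>Im z\<bar> + 1 / a)) / (1 / a)"
        using a le by (intro cmod_deriv_le_of_exp_bound G) auto
      also have "\<dots> = a * exp (1 + a * \<bar>Im z\<bar>)" using a by (simp add: algebra_simps)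
      also have "\<dots> \<le> a * exp (1 + a * cmod w)"
        using a z abs_Im_le_cmod[of z] by (intro mult_left_mono) auto
      finally show "cmod (deriv G z) \<le> a * exp (1 + a * cmod w)" .
    qed auto
    then show "cmod (translation_sum [(1, w), (- 1, 0)] G 0) \<le> a * cmod w * exp (1 + a * cmod w)"
      by (simp add: mult_ac)
  qed (use a f in auto)
  then show ?thesis by (simp only: eq)
qed

text \<open>Integration by parts writes \<open>f 0\<close> as a difference of two smoothed values of \<open>f\<close>
  and \<open>f'\<close>, and the derivative is moved off \<open>f\<close> by a Cauchy estimate.\<close>

lemma cmod_le_pw_norm_origin:
  assumes a: "a \<ge> 0" and f: "f \<in> paley_wiener a"
  shows "cmod (f 0) \<le> (1 + exp a) * pw_norm f"
proof -
  have holf: "f holomorphic_on UNIV" using f by (simp add: paley_wiener_iff)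
  have bound: "cmod (f 0) \<le> (1 + exp a) * M" if M: "M > pw_norm f" for M
  proof -
    have M0: "M > 0" using M pw_norm_nonneg[of f] by linarith
    \<comment> \<open>Since \<open>\<psi> 0 = 1\<close> and \<open>\<psi> 1 = 0\<close>, integration
      by parts leaves \<open>f 0\<close> as the only boundary term.\<close>
    define \<psi> where "\<psi> t = 1 - complex_of_real t" for t
    have \<psi>: "continuous_on {0..1} \<psi>" unfolding \<psi>_def by (intro continuous_intros)
    define G where "G z = integral {0..1} (\<lambda>t. f (z + of_real t) * \<psi> t)" for z
    have M': "pw_norm f * sqrt (integral {0..1} (\<lambda>t. (cmod (\<psi> t))\<^sup>2)) < M"
    proof -
      have "integral {0..1} (\<lambda>t. (cmod (\<psi> t))\<^sup>2) \<le> integral {0..1} (\<lambda>t::real. 1)"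
      proof (rule integral_le)
        show "(\<lambda>t. (cmod (\<psi> t))\<^sup>2) integrable_on {0..1}"
          by (intro integrable_continuous_real continuous_intros \<psi>)
        fix t :: real assume t: "t \<in> {0..1}"
        have "cmod (\<psi> t) = \<bar>1 - t\<bar>"
          unfolding \<psi>_def by (metis norm_of_real of_real_1 of_real_diff)
        then show "(cmod (\<psi> t))\<^sup>2 \<le> 1" using t by (simp add: power_le_one)
      qed auto
      then have "sqrt (integral {0..1} (\<lambda>t. (cmod (\<psi> t))\<^sup>2)) \<le> 1" by simp
      then show ?thesis using M mult_left_le[OF _ pw_norm_nonneg[of f]] by fastforce
    qed
    have Gle: "cmod (G z) \<le> M * exp (a * \<bar>Im z\<bar>)" for z
      unfolding G_def by (rule smoothing_bound[OF a f \<psi> M'])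
    have "deriv G 0 = integral {0..1} (\<lambda>t. deriv f (of_real t) * \<psi> t)"
      unfolding G_def[abs_def]
      using has_field_derivative_smoothing[OF holf \<psi>, of 0, THEN DERIV_imp_deriv] by simp
    moreover have "cmod (deriv G 0) \<le> M * exp (a * (\<bar>Im 0\<bar> + 1)) / 1"
      using M0 a Gle
      by (intro cmod_deriv_le_of_exp_bound) (auto simp: G_def[abs_def] intro: smoothing_holomorphic holf \<psi>)
    ultimately have part2: "cmod (integral {0..1} (\<lambda>t. deriv f (of_real t) * \<psi> t)) \<le> M * exp a"
      by simp
    have part1: "cmod (integral {0..1} (\<lambda>t. f (of_real t))) \<le> M"
      using smoothing_bound[OF a f, of 0 1 "\<lambda>_. 1" M 0] M by simp
    have "((\<lambda>t. deriv f (of_real t) * \<psi> t - f (of_real t)) has_integral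
        (f (of_real 1) * \<psi> 1 - f (of_real 0) * \<psi> 0)) {0..1}"
    proof (rule fundamental_theorem_of_calculus)
      fix t :: real
      have "((\<lambda>z. f z * (1 - z)) has_field_derivative deriv f (of_real t) * (1 - of_real t) - f (of_real t))
          (at (of_real t))"
        using holomorphic_derivI[OF holf open_UNIV, of "of_real t"]
        by (auto intro!: derivative_eq_intros)
      then show "((\<lambda>t. f (of_real t) * \<psi> t) has_vector_derivative deriv f (of_real t) * \<psi> t - f (of_real t))
          (at t within {0..1})"
        unfolding \<psi>_def by (rule has_vector_derivative_real_field[THEN has_vector_derivative_at_within])
    qed simp
    then have "f 0 = - integral {0..1} (\<lambda>t. deriv f (of_real t) * \<psi> t - f (of_real t))"
      by (simp add: integral_unique \<psi>_def)
    also have "integral {0..1} (\<lambda>t. deriv f (of_real t) * \<psi> t - f (of_real t)) =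
        integral {0..1} (\<lambda>t. deriv f (of_real t) * \<psi> t) - integral {0..1} (\<lambda>t. f (of_real t))"
      by (intro Henstock_Kurzweil_Integration.integral_diff integrable_continuous_real
        continuous_intros continuous_on_of_real_comp holomorphic_deriv holf \<psi>) auto
    finally have "f 0 = integral {0..1} (\<lambda>t. f (of_real t)) - integral {0..1} (\<lambda>t. deriv f (of_real t) * \<psi> t)"
      by simp
    then have "cmod (f 0) \<le> cmod (integral {0..1} (\<lambda>t. f (of_real t)))
        + cmod (integral {0..1} (\<lambda>t. deriv f (of_real t) * \<psi> t))"
      by (metis norm_triangle_ineq4)
    then show ?thesis using part1 part2 by (simp add: algebra_simps)
  qed
  have "((\<lambda>M. (1 + exp a) * M) \<longlongrightarrow> (1 + exp a) * pw_norm f) (at_right (pw_norm f))"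
    by (intro tendsto_intros)
  then show ?thesis
    by (rule tendsto_lowerbound)
      (auto intro: bound eventually_mono[OF eventually_at_right_less])
qed

text \<open>Translation moves the evaluation point to the origin. The estimate plays the part of the
  reproducing kernel: norm convergence implies uniform convergence on horizontal strips.\<close>

lemma cmod_le_pw_norm:
  assumes a: "a \<ge> 0" and f: "f \<in> paley_wiener a"
  shows "cmod (f z) \<le> (1 + exp a) * exp (a * \<bar>Im z\<bar>) * pw_norm f"
proof -
  have "cmod (f (0 + z)) \<le> (1 + exp a) * pw_norm (\<lambda>x. f (x + z))"
    by (rule cmod_le_pw_norm_origin[OF a translate_paley_wiener(1)[OF a f]])
  also have "\<dots> \<le> (1 + exp a) * (exp (a * \<bar>Im z\<bar>) * pw_norm f)"
    by (intro mult_left_mono translate_paley_wiener(2)[OF a f]) (simp add: add_nonneg_nonneg)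
  finally show ?thesis by (simp add: mult.assoc)
qed

section \<open>Absolutely convergent series and affine substitutions\<close>

lemma paley_wiener_sum:
  assumes "a \<ge> 0" "\<And>n. n \<in> I \<Longrightarrow> f n \<in> paley_wiener a"
  shows "(\<lambda>z. \<Sum>n\<in>I. f n z) \<in> paley_wiener a"
  using assms(2) by (induction I rule: infinite_finite_induct) (auto intro: paley_wiener_zero assms(1) paley_wiener_add)

lemma pw_norm_zero [simp]: "pw_norm (\<lambda>z. 0) = 0"
  by (simp add: pw_norm_eq l2_norm_def)

lemma pw_norm_sum_le:
  assumes "a \<ge> 0" "\<And>n. n \<in> I \<Longrightarrow> f n \<in> paley_wiener a"
  shows "pw_norm (\<lambda>z. \<Sum>n\<in>I. f n z) \<le> (\<Sum>n\<in>I. pw_norm (f n))"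
  using assms(2)
proof (induction I rule: infinite_finite_induct)
  case (insert n I)
  have "pw_norm (\<lambda>z. f n z + (\<Sum>n\<in>I. f n z)) \<le> pw_norm (f n) + pw_norm (\<lambda>z. \<Sum>n\<in>I. f n z)"
    by (rule pw_norm_triangle[where a = a and b = a])
      (use insert assms(1) in \<open>auto intro: paley_wiener_sum\<close>)
  then show ?case using insert by fastforce
qed auto

text \<open>Completeness in the form needed for Neumann series. The evaluation bound gives uniform
  convergence on discs, hence an entire sum, and also its type; Fatou's lemma gives membership and
  the norm bound.\<close>

lemma paley_wiener_suminf:
  assumes a: "a \<ge> 0" and f: "\<And>n. f n \<in> paley_wiener a" and sum: "summable (\<lambda>n. pw_norm (f n))"
  shows "summable (\<lambda>n. f n z)" "(\<lambda>z. \<Sum>n. f n z) \<in> paley_wiener a"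
    "pw_norm (\<lambda>z. \<Sum>n. f n z) \<le> (\<Sum>n. pw_norm (f n))"
proof -
  define E where "E z = (1 + exp a) * exp (a * \<bar>Im z\<bar>)" for z
  have E: "E z > 0" for z unfolding E_def by (intro mult_pos_pos add_pos_pos) auto
  have le: "cmod (f n z) \<le> E z * pw_norm (f n)" for n z
    unfolding E_def by (rule cmod_le_pw_norm[OF a f])
  show summ: "summable (\<lambda>n. f n z)" for z
    by (rule summable_comparison_test'[OF summable_mult[OF sum, of "E z"]]) (rule le)
  let ?F = "\<lambda>z. \<Sum>n. f n z"
  have hol: "?F holomorphic_on UNIV"
  proof (rule holomorphic_uniform_sequence[where f = "\<lambda>N z. \<Sum>n<N. f n z"])
    show "(\<lambda>z. \<Sum>n<N. f n z) holomorphic_on UNIV" for N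
      using f by (auto simp: paley_wiener_iff intro: holomorphic_intros)
    fix z :: complex
    have "uniform_limit (cball z 1) (\<lambda>N x. \<Sum>n<N. f n x) ?F sequentially"
    proof (rule Weierstrass_m_test)
      fix n x assume x: "x \<in> cball z 1"
      have "\<bar>Im x\<bar> \<le> \<bar>Im z\<bar> + 1"
        using x abs_Im_le_cmod[of "z - x"] by (simp add: dist_norm)
      then have "a * \<bar>Im x\<bar> \<le> a * (\<bar>Im z\<bar> + 1)" using a by (rule mult_left_mono)
      then have "E x \<le> (1 + exp a) * exp (a * (\<bar>Im z\<bar> + 1))"
        unfolding E_def by (intro mult_left_mono) (simp_all add: add_nonneg_nonneg)
      then show "cmod (f n x) \<le> (1 + exp a) * exp (a * (\<bar>Im z\<bar> + 1)) * pw_norm (f n)"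
        by (rule order_trans[OF le mult_right_mono[OF _ pw_norm_nonneg]])
    qed (intro summable_mult sum)
    then show "\<exists>d>0. cball z d \<subseteq> UNIV \<and> uniform_limit (cball z d) (\<lambda>N x. \<Sum>n<N. f n x) ?F sequentially"
      using zero_less_one by blast
  qed auto
  have type: "exponential_type_le a ?F"
  proof (rule exponential_type_leI)
    fix z
    have "cmod (?F z) \<le> (\<Sum>n. E z * pw_norm (f n))"
      by (rule norm_suminf_le[OF le summable_mult[OF sum]])
    also have "\<dots> = E z * (\<Sum>n. pw_norm (f n))"
      by (rule suminf_mult[OF sum])
    also have "\<dots> \<le> ((1 + exp a) * exp (a * cmod z)) * (\<Sum>n. pw_norm (f n))"
      unfolding E_def using a abs_Im_le_cmod[of z]
      by (intro mult_right_mono mult_left_mono suminf_nonneg sum) (auto intro: mult_left_mono)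
    finally show "cmod (?F z) \<le> ((1 + exp a) * (\<Sum>n. pw_norm (f n))) * exp (a * cmod z)"
      by (simp add: mult_ac)
  qed
  have part: "(\<lambda>z. \<Sum>n<N. f n z) \<in> paley_wiener a" for N
    by (rule paley_wiener_sum[OF a f])
  have norm: "l2_norm lborel (\<lambda>t. \<Sum>n<N. f n (of_real t)) \<le> (\<Sum>n. pw_norm (f n))" for N
    using pw_norm_sum_le[of a "{..<N}" f, OF a f] sum_le_suminf[OF sum, where I = "{..<N}"]
    by (simp add: pw_norm_eq)
  have sq: "square_integrable lborel (\<lambda>t. \<Sum>n<N. f n (of_real t))" for N
    using part[of N] by (simp add: paley_wiener_iff)
  have lim: "(\<lambda>N. \<Sum>n<N. f n (of_real t)) \<longlonglongrightarrow> ?F (of_real t)" for t :: real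
    by (rule summable_LIMSEQ[OF summ])
  show "?F \<in> paley_wiener a"
    unfolding paley_wiener_iff
    using hol type square_integrable_Fatou(1)[where v = "\<lambda>N t. \<Sum>n<N. f n (of_real t)",
      OF borel_measurable_of_real_comp[OF hol] sq norm lim] by blast
  show "pw_norm ?F \<le> (\<Sum>n. pw_norm (f n))"
    unfolding pw_norm_eq[of ?F]
    by (rule square_integrable_Fatou(2)[where v = "\<lambda>N t. \<Sum>n<N. f n (of_real t)",
      OF borel_measurable_of_real_comp[OF hol] sq norm lim])
qed

text \<open>The map is a translation by \<open>w\<close> followed by a real dilation, which is a
  change of variable on the line. The smaller type \<open>a * \<bar>c\<bar>\<close> is what makes
  the orthogonality argument for \<open>\<bar>c\<bar> < 1\<close> possible.\<close>

lemma paley_wiener_affine: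
  fixes c :: real
  assumes a: "a \<ge> 0" and f: "f \<in> paley_wiener a" and c: "c \<noteq> 0" "\<bar>c\<bar> \<le> 1"
  shows "(\<lambda>z. f (of_real c * z + w)) \<in> paley_wiener (a * \<bar>c\<bar>)"
    "pw_norm (\<lambda>z. f (of_real c * z + w)) \<le> exp (a * \<bar>Im w\<bar>) / sqrt \<bar>c\<bar> * pw_norm f"
proof -
  define g where "g z = f (z + w)" for z
  have g: "g \<in> paley_wiener a" "pw_norm g \<le> exp (a * \<bar>Im w\<bar>) * pw_norm f"
    unfolding g_def by (rule translate_paley_wiener[OF a f])+
  have "square_integrable lborel (\<lambda>t. g (of_real t))"
    using g by (simp add: paley_wiener_iff)
  from square_integrable_affine[OF this c(1), of 0]
  show "(\<lambda>z. f (of_real c * z + w)) \<in> paley_wiener (a * \<bar>c\<bar>)"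
    using f c a exponential_type_le_affine[of a f "of_real c" 1 w]
    by (auto simp: paley_wiener_iff g_def intro: holomorphic_on_affine_comp)
  have "pw_norm (\<lambda>z. f (of_real c * z + w)) = pw_norm g / sqrt \<bar>c\<bar>"
    using l2_norm_affine[OF c(1), of "\<lambda>t. g (of_real t)" 0] by (simp add: pw_norm_eq g_def)
  then show "pw_norm (\<lambda>z. f (of_real c * z + w)) \<le> exp (a * \<bar>Im w\<bar>) / sqrt \<bar>c\<bar> * pw_norm f"
    using g(2) c by (simp add: divide_right_mono)
qed

section \<open>Neumann series of bounded operators\<close>

text \<open>Unlike \<open>pw_invertible\<close>, this names the inverse, so that its norm can be
  bounded and inverses can be composed.\<close>

definition pw_inverse ::
    "real \<Rightarrow> ((complex \<Rightarrow> complex) \<Rightarrow> (complex \<Rightarrow> complex)) \<Rightarrow>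
      ((complex \<Rightarrow> complex) \<Rightarrow> (complex \<Rightarrow> complex)) \<Rightarrow> bool" where
  "pw_inverse a T S \<longleftrightarrow> pw_bounded_operator a T \<and> pw_bounded_operator a S \<and>
     (\<forall>f\<in>paley_wiener a. S (T f) = f \<and> T (S f) = f)"

lemma pw_invertible_iff: "pw_invertible a T \<longleftrightarrow> (\<exists>S. pw_inverse a T S)"
  by (auto simp: pw_invertible_def pw_inverse_def)

lemma pw_bounded_operator_closed:
  "pw_bounded_operator a T \<Longrightarrow> f \<in> paley_wiener a \<Longrightarrow> T f \<in> paley_wiener a"
  by (simp add: pw_bounded_operator_def)

lemma pw_bounded_operator_add:
  "pw_bounded_operator a T \<Longrightarrow> f \<in> paley_wiener a \<Longrightarrow> g \<in> paley_wiener a \<Longrightarrow>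
    T (\<lambda>z. f z + g z) = (\<lambda>z. T f z + T g z)"
  by (simp add: pw_bounded_operator_def)

lemma pw_bounded_operator_cmult:
  "pw_bounded_operator a T \<Longrightarrow> f \<in> paley_wiener a \<Longrightarrow> T (\<lambda>z. k * f z) = (\<lambda>z. k * T f z)"
  by (simp add: pw_bounded_operator_def)

lemma pw_bounded_operator_zero:
  assumes "pw_bounded_operator a T" "a \<ge> 0"
  shows "T (\<lambda>z. 0) = (\<lambda>z. 0)"
  using pw_bounded_operator_cmult[OF assms(1) paley_wiener_zero[OF assms(2)], of 0] by simp

lemma paley_wiener_diff:
  assumes "a \<ge> 0" "f \<in> paley_wiener a" "g \<in> paley_wiener a"
  shows "(\<lambda>z. f z - g z) \<in> paley_wiener a"
  using paley_wiener_add[OF assms(2) paley_wiener_cmult[OF assms(1,3), of "- 1"]] by simp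

lemma pw_bounded_operator_diff:
  assumes "pw_bounded_operator a T" "a \<ge> 0" "f \<in> paley_wiener a" "g \<in> paley_wiener a"
  shows "T (\<lambda>z. f z - g z) = (\<lambda>z. T f z - T g z)"
  using pw_bounded_operator_add[OF assms(1,3) paley_wiener_cmult[OF assms(2,4), of "- 1"]]
    pw_bounded_operator_cmult[OF assms(1,4), of "- 1"] by simp

lemma pw_bounded_operator_bound:
  assumes "pw_bounded_operator a T"
  shows "\<exists>K\<ge>0. \<forall>f\<in>paley_wiener a. pw_norm (T f) \<le> K * pw_norm f"
proof -
  obtain K where K: "\<forall>f\<in>paley_wiener a. pw_norm (T f) \<le> K * pw_norm f"
    using assms unfolding pw_bounded_operator_def by blast
  have "pw_norm (T f) \<le> \<bar>K\<bar> * pw_norm f" if "f \<in> paley_wiener a" for f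
    using K that by (meson order_trans abs_ge_self mult_right_mono pw_norm_nonneg)
  then show ?thesis by (intro exI[of _ "\<bar>K\<bar>"]) simp
qed

lemma pw_bounded_operatorI:
  assumes "\<And>f. f \<in> paley_wiener a \<Longrightarrow> T f \<in> paley_wiener a"
    "\<And>f g. f \<in> paley_wiener a \<Longrightarrow> g \<in> paley_wiener a \<Longrightarrow> T (\<lambda>z. f z + g z) = (\<lambda>z. T f z + T g z)"
    "\<And>f k. f \<in> paley_wiener a \<Longrightarrow> T (\<lambda>z. k * f z) = (\<lambda>z. k * T f z)"
    "\<And>f. f \<in> paley_wiener a \<Longrightarrow> pw_norm (T f) \<le> K * pw_norm f"
  shows "pw_bounded_operator a T"
  unfolding pw_bounded_operator_def
  by (intro conjI ballI allI exI[of _ K] assms)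

lemma pw_bounded_operator_comp:
  assumes S: "pw_bounded_operator a S" and T: "pw_bounded_operator a T"
  shows "pw_bounded_operator a (\<lambda>f. S (T f))"
proof -
  obtain K where K: "K \<ge> 0" "\<And>f. f \<in> paley_wiener a \<Longrightarrow> pw_norm (S f) \<le> K * pw_norm f"
    using pw_bounded_operator_bound[OF S] by blast
  obtain L where L: "L \<ge> 0" "\<And>f. f \<in> paley_wiener a \<Longrightarrow> pw_norm (T f) \<le> L * pw_norm f"
    using pw_bounded_operator_bound[OF T] by blast
  show ?thesis
  proof (rule pw_bounded_operatorI[where K = "K * L"])
    fix f assume f: "f \<in> paley_wiener a"
    have "pw_norm (S (T f)) \<le> K * pw_norm (T f)"
      using K T f pw_bounded_operator_closed by blast
    also have "\<dots> \<le> K * (L * pw_norm f)"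
      using K L f by (intro mult_left_mono) auto
    finally show "pw_norm (S (T f)) \<le> (K * L) * pw_norm f" by (simp add: mult.assoc)
    show "S (T f) \<in> paley_wiener a"
      by (intro pw_bounded_operator_closed[OF S] pw_bounded_operator_closed[OF T] f)
    show "S (T (\<lambda>z. k * f z)) = (\<lambda>z. k * S (T f) z)" for k
      by (simp only: pw_bounded_operator_cmult[OF T f]
        pw_bounded_operator_cmult[OF S pw_bounded_operator_closed[OF T f]])
    show "S (T (\<lambda>z. f z + g z)) = (\<lambda>z. S (T f) z + S (T g) z)" if g: "g \<in> paley_wiener a" for g
      by (simp only: pw_bounded_operator_add[OF T f g]
        pw_bounded_operator_add[OF S pw_bounded_operator_closed[OF T f] pw_bounded_operator_closed[OF T g]])
  qed
qed

lemma pw_bounded_operator_cadd: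
  assumes a: "a \<ge> 0" and T: "pw_bounded_operator a T" and S: "pw_bounded_operator a S"
  shows "pw_bounded_operator a (\<lambda>f z. k * T f z + l * S f z)"
proof -
  obtain K where K: "K \<ge> 0" "\<And>f. f \<in> paley_wiener a \<Longrightarrow> pw_norm (T f) \<le> K * pw_norm f"
    using pw_bounded_operator_bound[OF T] by blast
  obtain L where L: "L \<ge> 0" "\<And>f. f \<in> paley_wiener a \<Longrightarrow> pw_norm (S f) \<le> L * pw_norm f"
    using pw_bounded_operator_bound[OF S] by blast
  show ?thesis
  proof (rule pw_bounded_operatorI[where K = "cmod k * K + cmod l * L"])
    fix f assume f: "f \<in> paley_wiener a"
    note closed = paley_wiener_cmult[OF a pw_bounded_operator_closed[OF T f], of k]
      paley_wiener_cmult[OF a pw_bounded_operator_closed[OF S f], of l]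
    show "(\<lambda>z. k * T f z + l * S f z) \<in> paley_wiener a"
      by (rule paley_wiener_add[OF closed])
    have "pw_norm (\<lambda>z. k * T f z + l * S f z) \<le> cmod k * pw_norm (T f) + cmod l * pw_norm (S f)"
      using pw_norm_triangle[OF closed] by (simp add: pw_norm_cmult)
    also have "\<dots> \<le> cmod k * (K * pw_norm f) + cmod l * (L * pw_norm f)"
      using K L f by (intro add_mono mult_left_mono) auto
    finally show "pw_norm (\<lambda>z. k * T f z + l * S f z) \<le> (cmod k * K + cmod l * L) * pw_norm f"
      by (simp add: algebra_simps)
    show "(\<lambda>z. k * T (\<lambda>z. m * f z) z + l * S (\<lambda>z. m * f z) z) = (\<lambda>z. m * (k * T f z + l * S f z))" for m
      by (simp only: pw_bounded_operator_cmult[OF T f] pw_bounded_operator_cmult[OF S f] algebra_simps)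
    show "(\<lambda>z. k * T (\<lambda>z. f z + g z) z + l * S (\<lambda>z. f z + g z) z) =
        (\<lambda>z. (k * T f z + l * S f z) + (k * T g z + l * S g z))" if g: "g \<in> paley_wiener a" for g
      by (simp only: pw_bounded_operator_add[OF T f g] pw_bounded_operator_add[OF S f g] algebra_simps)
  qed
qed

lemma pw_bounded_operator_ident: "pw_bounded_operator a (\<lambda>f. f)"
  by (rule pw_bounded_operatorI[where K = 1]) auto

lemma pw_bounded_operator_minus_scalar:
  assumes "a \<ge> 0" "pw_bounded_operator a T"
  shows "pw_bounded_operator a (\<lambda>f z. T f z - \<mu> * f z)"
  using pw_bounded_operator_cadd[OF assms pw_bounded_operator_ident, of 1 "- \<mu>"] by simp

lemma pw_inverse_comp:
  assumes "pw_inverse a A A'" "pw_inverse a B B'"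
  shows "pw_inverse a (\<lambda>f. A (B f)) (\<lambda>f. B' (A' f))"
  unfolding pw_inverse_def
proof (intro conjI ballI)
  show "pw_bounded_operator a (\<lambda>f. A (B f))" "pw_bounded_operator a (\<lambda>f. B' (A' f))"
    using assms pw_bounded_operator_comp[of a A B] pw_bounded_operator_comp[of a B' A']
    unfolding pw_inverse_def by blast+
  fix f assume f: "f \<in> paley_wiener a"
  then have "B f \<in> paley_wiener a" "A' f \<in> paley_wiener a"
    using assms pw_bounded_operator_closed unfolding pw_inverse_def by blast+
  then show "B' (A' (A (B f))) = f" "A (B (B' (A' f))) = f"
    using assms f unfolding pw_inverse_def by simp_all
qed

lemma pw_bounded_operator_funpow:
  assumes "pw_bounded_operator a T"
  shows "pw_bounded_operator a (T ^^ n)"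
proof (induction n)
  case 0
  show ?case using pw_bounded_operator_ident by (simp add: id_def)
next
  case (Suc n)
  show ?case using pw_bounded_operator_comp[OF assms Suc] by (simp add: o_def)
qed

lemma pw_bounded_operator_sum:
  assumes T: "pw_bounded_operator a T" and a: "a \<ge> 0" and f: "\<And>n. n \<in> I \<Longrightarrow> f n \<in> paley_wiener a"
  shows "T (\<lambda>z. \<Sum>n\<in>I. f n z) = (\<lambda>z. \<Sum>n\<in>I. T (f n) z)"
  using f
proof (induction I rule: infinite_finite_induct)
  case (insert n I)
  have "T (\<lambda>z. f n z + (\<Sum>n\<in>I. f n z)) = (\<lambda>z. T (f n) z + T (\<lambda>z. \<Sum>n\<in>I. f n z) z)"
    by (rule pw_bounded_operator_add[OF T]) (use insert in \<open>auto intro: paley_wiener_sum a\<close>)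
  then show ?case using insert by simp
qed (use pw_bounded_operator_zero[OF T a] in auto)

text \<open>Boundedness makes \<open>T\<close> of the tail small in norm, and the evaluation bound
  turns this into convergence at \<open>z\<close>.\<close>

lemma pw_bounded_operator_suminf:
  assumes T: "pw_bounded_operator a T" and a: "a \<ge> 0"
    and f: "\<And>n. f n \<in> paley_wiener a" and sum: "summable (\<lambda>n. pw_norm (f n))"
  shows "(\<lambda>n. T (f n) z) sums T (\<lambda>z. \<Sum>n. f n z) z"
proof -
  obtain K where K: "K \<ge> 0" "\<And>f. f \<in> paley_wiener a \<Longrightarrow> pw_norm (T f) \<le> K * pw_norm f"
    using pw_bounded_operator_bound[OF T] by blast
  define C where "C = (1 + exp a) * exp (a * \<bar>Im z\<bar>)"
  define F where "F z = (\<Sum>n. f n z)" for z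
  have F: "F \<in> paley_wiener a"
    unfolding F_def by (rule paley_wiener_suminf[OF a f sum])
  have C: "C \<ge> 0" by (simp add: C_def add_nonneg_nonneg)
  have bound: "cmod ((\<Sum>n<N. T (f n) z) - T F z) \<le> C * (K * (\<Sum>n. pw_norm (f (n + N))))" for N
  proof -
    have sumN: "summable (\<lambda>n. pw_norm (f (n + N)))"
      using sum by (rule summable_ignore_initial_segment)
    note tail = paley_wiener_suminf[OF a f sumN]
    have part: "(\<lambda>z. \<Sum>n<N. f n z) \<in> paley_wiener a"
      by (rule paley_wiener_sum[OF a f])
    have "F = (\<lambda>z. (\<Sum>n<N. f n z) + (\<Sum>n. f (n + N) z))"
    proof
      fix z
      show "F z = (\<Sum>n<N. f n z) + (\<Sum>n. f (n + N) z)"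
        using suminf_split_initial_segment[OF paley_wiener_suminf(1)[OF a f sum, of z], of N]
        by (simp only: F_def add.commute)
    qed
    then have "T F z = (\<Sum>n<N. T (f n) z) + T (\<lambda>z. \<Sum>n. f (n + N) z) z"
      by (simp only: pw_bounded_operator_add[OF T part tail(2)]
        pw_bounded_operator_sum[where I = "{..<N}" and f = f, OF T a f])
    then have "T F z - (\<Sum>n<N. T (f n) z) = T (\<lambda>z. \<Sum>n. f (n + N) z) z"
      by (simp only: add_diff_cancel_left')
    then have "cmod ((\<Sum>n<N. T (f n) z) - T F z) = cmod (T (\<lambda>z. \<Sum>n. f (n + N) z) z)"
      by (metis norm_minus_commute)
    also have "\<dots> \<le> C * pw_norm (T (\<lambda>z. \<Sum>n. f (n + N) z))"
      unfolding C_def by (rule cmod_le_pw_norm[OF a pw_bounded_operator_closed[OF T tail(2)]])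
    also have "\<dots> \<le> C * (K * pw_norm (\<lambda>z. \<Sum>n. f (n + N) z))"
      by (rule mult_left_mono[OF K(2)[OF tail(2)] C])
    also have "\<dots> \<le> C * (K * (\<Sum>n. pw_norm (f (n + N))))"
      by (rule mult_left_mono[OF mult_left_mono[OF tail(3) K(1)] C])
    finally show ?thesis .
  qed
  have "(\<lambda>N. \<Sum>n. pw_norm (f (n + N))) \<longlonglongrightarrow> 0"
    by (rule suminf_exist_split2[OF sum])
  then have lim0: "(\<lambda>N. C * (K * (\<Sum>n. pw_norm (f (n + N))))) \<longlonglongrightarrow> 0"
    by (intro tendsto_mult_right_zero)
  have "(\<lambda>N. (\<Sum>n<N. T (f n) z) - T F z) \<longlonglongrightarrow> 0"
    by (rule Lim_null_comparison[OF always_eventually[OF allI[OF bound]] lim0])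
  then have "(\<lambda>N. \<Sum>n<N. T (f n) z) \<longlonglongrightarrow> T F z"
    by (rule LIM_zero_cancel)
  then show ?thesis
    unfolding sums_def F_def[abs_def] .
qed

text \<open>The inverse is minus the series of \<open>T ^^ n\<close> over
  \<open>\<mu> ^ Suc n\<close>. Bounding the powers by \<open>K * q ^ n\<close> rather than the norm
  of \<open>T\<close> by \<open>q\<close> lets a constant enter once instead of \<open>n\<close>
  times; the norm of the inverse is recorded for the perturbation argument.\<close>

lemma neumann_inverse:
  assumes a: "a \<ge> 0" and T: "pw_bounded_operator a T" and q: "0 \<le> q" "q < cmod \<mu>"
    and pow: "\<And>n f. f \<in> paley_wiener a \<Longrightarrow> pw_norm ((T ^^ n) f) \<le> K * q ^ n * pw_norm f"
  shows "\<exists>S. pw_inverse a (\<lambda>f z. T f z - \<mu> * f z) S \<and>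
    (\<forall>f\<in>paley_wiener a. pw_norm (S f) \<le> K / (cmod \<mu> - q) * pw_norm f)"
proof -
  have \<mu>: "cmod \<mu> > 0" "\<mu> \<noteq> 0" using q by auto
  define U where "U f n z = - (1 / \<mu> ^ Suc n) * (T ^^ n) f z" for f and n :: nat and z
  define S where "S f z = (\<Sum>n. U f n z)" for f z
  have Tn: "pw_bounded_operator a (T ^^ n)" for n by (rule pw_bounded_operator_funpow[OF T])
  have U: "U f n \<in> paley_wiener a" if "f \<in> paley_wiener a" for f n
    unfolding U_def by (rule paley_wiener_cmult[OF a pw_bounded_operator_closed[OF Tn that]])
  have U_norm: "pw_norm (U f n) \<le> K / cmod \<mu> * pw_norm f * (q / cmod \<mu>) ^ n" if f: "f \<in> paley_wiener a" for f n
  proof -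
    have "pw_norm (U f n) = pw_norm ((T ^^ n) f) / cmod \<mu> ^ Suc n"
      unfolding U_def by (subst pw_norm_cmult) (simp add: norm_divide norm_mult norm_power)
    also have "\<dots> \<le> (K * q ^ n * pw_norm f) / cmod \<mu> ^ Suc n"
      by (intro divide_right_mono pow f) simp
    finally show ?thesis by (simp add: field_simps power_divide)
  qed
  have geo: "(\<lambda>n. K / cmod \<mu> * pw_norm f * (q / cmod \<mu>) ^ n) sums (K / (cmod \<mu> - q) * pw_norm f)" for f
  proof -
    have "(\<lambda>n. K / cmod \<mu> * pw_norm f * (q / cmod \<mu>) ^ n) sums (K / cmod \<mu> * pw_norm f * (1 / (1 - q / cmod \<mu>)))"
      using q \<mu> by (intro sums_mult geometric_sums) auto
    also have "K / cmod \<mu> * pw_norm f * (1 / (1 - q / cmod \<mu>)) = K / (cmod \<mu> - q) * pw_norm f"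
      using q \<mu> by (simp add: field_simps)
    finally show ?thesis .
  qed
  have summ: "summable (\<lambda>n. pw_norm (U f n))" if f: "f \<in> paley_wiener a" for f
    by (rule summable_comparison_test'[OF sums_summable[OF geo[of f]]])
      (simp only: real_norm_def abs_of_nonneg[OF pw_norm_nonneg] U_norm[OF f])
  note series = paley_wiener_suminf[OF a U summ]
  have S_norm: "pw_norm (S f) \<le> K / (cmod \<mu> - q) * pw_norm f" if f: "f \<in> paley_wiener a" for f
  proof -
    have "pw_norm (S f) \<le> (\<Sum>n. pw_norm (U f n))"
      unfolding S_def[abs_def] by (rule series(3)[OF f f])
    also have "\<dots> \<le> (\<Sum>n. K / cmod \<mu> * pw_norm f * (q / cmod \<mu>) ^ n)"
      by (rule suminf_le[OF U_norm[OF f] summ[OF f] sums_summable[OF geo[of f]]])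
    also have "\<dots> = K / (cmod \<mu> - q) * pw_norm f"
      by (rule sums_unique[OF geo[of f], symmetric])
    finally show ?thesis .
  qed
  have S: "pw_bounded_operator a S"
  proof (rule pw_bounded_operatorI)
    fix f g assume f: "f \<in> paley_wiener a" and g: "g \<in> paley_wiener a"
    have "U (\<lambda>z. f z + g z) n = (\<lambda>z. U f n z + U g n z)" for n
      using pw_bounded_operator_add[OF Tn f g, of n] by (simp add: U_def fun_eq_iff algebra_simps)
    then show "S (\<lambda>z. f z + g z) = (\<lambda>z. S f z + S g z)"
      by (simp add: S_def fun_eq_iff suminf_add[OF series(1)[OF f f] series(1)[OF g g]])
  next
    fix f k assume f: "f \<in> paley_wiener a"
    have "U (\<lambda>z. k * f z) n = (\<lambda>z. k * U f n z)" for n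
      using pw_bounded_operator_cmult[OF Tn f, of n k] by (simp add: U_def fun_eq_iff)
    then show "S (\<lambda>z. k * f z) = (\<lambda>z. k * S f z)"
      by (simp add: S_def fun_eq_iff suminf_mult[OF series(1)[OF f f]])
  next
    fix f assume f: "f \<in> paley_wiener a"
    show "S f \<in> paley_wiener a" unfolding S_def[abs_def] by (rule series(2)[OF f f])
    show "pw_norm (S f) \<le> K / (cmod \<mu> - q) * pw_norm f" by (rule S_norm[OF f])
  qed
  \<comment> \<open>Applying \<open>T\<close> to the series termwise and applying the series to
    \<open>T f\<close> produce the same sum, so one index shift settles both compositions; the term
    left over is \<open>\<mu> * U f 0 z = - f z\<close>.\<close>
  have tele: "(\<Sum>n. - (1 / \<mu> ^ Suc n) * (T ^^ Suc n) f z) - \<mu> * S f z = f z"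
    and tele_summable: "summable (\<lambda>n. - (1 / \<mu> ^ Suc n) * (T ^^ Suc n) f z)"
    if f: "f \<in> paley_wiener a" for f z
  proof -
    have s: "summable (\<lambda>n. \<mu> * U f n z)" by (intro summable_mult series(1)[OF f f])
    have eq: "\<mu> * U f (Suc n) z = - (1 / \<mu> ^ Suc n) * (T ^^ Suc n) f z" for n
      using \<mu> by (simp add: U_def)
    show "summable (\<lambda>n. - (1 / \<mu> ^ Suc n) * (T ^^ Suc n) f z)"
      unfolding eq[symmetric] using s by (simp only: summable_Suc_iff[of "\<lambda>n. \<mu> * U f n z"])
    have "(\<Sum>n. \<mu> * U f (Suc n) z) = (\<Sum>n. \<mu> * U f n z) - \<mu> * U f 0 z"
      by (rule suminf_split_head[OF s])
    also have "(\<Sum>n. \<mu> * U f n z) = \<mu> * S f z"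
      unfolding S_def by (rule suminf_mult[OF series(1)[OF f f]])
    also have "\<mu> * U f 0 z = - f z" using \<mu> by (simp add: U_def)
    finally show "(\<Sum>n. - (1 / \<mu> ^ Suc n) * (T ^^ Suc n) f z) - \<mu> * S f z = f z"
      unfolding eq[symmetric] by simp
  qed
  have TS: "T (S f) z - \<mu> * S f z = f z" if f: "f \<in> paley_wiener a" for f z
  proof -
    have "(\<lambda>n. T (U f n) z) sums T (S f) z"
      unfolding S_def[abs_def] by (rule pw_bounded_operator_suminf[OF T a U[OF f] summ[OF f]])
    moreover have "T (U f n) z = - (1 / \<mu> ^ Suc n) * (T ^^ Suc n) f z" for n
      unfolding U_def[abs_def]
      by (simp only: pw_bounded_operator_cmult[OF T pw_bounded_operator_closed[OF Tn f]] funpow.simps o_apply)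
    ultimately show ?thesis using tele[OF f, of z] by (simp add: sums_iff)
  qed
  have ST: "S (\<lambda>z. T f z - \<mu> * f z) = f" if f: "f \<in> paley_wiener a" for f
  proof
    fix z
    have Tf: "T f \<in> paley_wiener a" by (rule pw_bounded_operator_closed[OF T f])
    have "S (\<lambda>z. T f z - \<mu> * f z) = (\<lambda>z. S (T f) z - \<mu> * S f z)"
      using pw_bounded_operator_diff[OF S a Tf paley_wiener_cmult[OF a f]]
        pw_bounded_operator_cmult[OF S f] by simp
    moreover have "S (T f) z = (\<Sum>n. - (1 / \<mu> ^ Suc n) * (T ^^ Suc n) f z)"
      by (simp add: S_def U_def funpow_swap1)
    ultimately show "S (\<lambda>z. T f z - \<mu> * f z) z = f z" using tele[OF f, of z] by simp
  qed
  have "(\<lambda>z. T (S f) z - \<mu> * S f z) = f" if "f \<in> paley_wiener a" for f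
    using TS[OF that] by (rule ext)
  then have "pw_inverse a (\<lambda>f z. T f z - \<mu> * f z) S"
    unfolding pw_inverse_def
    using S ST pw_bounded_operator_minus_scalar[OF a T] by blast
  then show ?thesis using S_norm by blast
qed

lemma pw_norm_funpow_le:
  assumes T: "pw_bounded_operator a T" and K: "K \<ge> 0"
    and le: "\<And>f. f \<in> paley_wiener a \<Longrightarrow> pw_norm (T f) \<le> K * pw_norm f" and f: "f \<in> paley_wiener a"
  shows "pw_norm ((T ^^ n) f) \<le> K ^ n * pw_norm f"
proof (induction n)
  case (Suc n)
  have "pw_norm (T ((T ^^ n) f)) \<le> K * pw_norm ((T ^^ n) f)"
    by (rule le[OF pw_bounded_operator_closed[OF pw_bounded_operator_funpow[OF T] f]])
  also have "\<dots> \<le> K * (K ^ n * pw_norm f)" using K Suc by (intro mult_left_mono)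
  finally show ?case by (simp add: mult.assoc)
qed simp

text \<open>With \<open>E = A' (A - B)\<close> one has \<open>A' B = 1 - E\<close> and
  \<open>E\<close> has norm at most \<open>L * \<eta> < 1\<close>, so the inverse of
  \<open>B\<close> is the inverse of \<open>1 - E\<close> composed with \<open>A'\<close>.\<close>

lemma pw_inverse_perturb:
  assumes a: "a \<ge> 0" and A: "pw_inverse a A A'" and B: "pw_bounded_operator a B"
    and L: "L \<ge> 0" "\<And>f. f \<in> paley_wiener a \<Longrightarrow> pw_norm (A' f) \<le> L * pw_norm f"
    and \<eta>: "\<eta> \<ge> 0" "\<And>f. f \<in> paley_wiener a \<Longrightarrow> pw_norm (\<lambda>z. A f z - B f z) \<le> \<eta> * pw_norm f"
    and small: "L * \<eta> < 1"
  shows "pw_invertible a B"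
proof -
  have bA: "pw_bounded_operator a A" and bA': "pw_bounded_operator a A'"
    and inv: "\<And>f. f \<in> paley_wiener a \<Longrightarrow> A' (A f) = f" "\<And>f. f \<in> paley_wiener a \<Longrightarrow> A (A' f) = f"
    using A by (auto simp: pw_inverse_def)
  define E where "E f = A' (\<lambda>z. A f z - B f z)" for f
  have diff: "pw_bounded_operator a (\<lambda>f z. A f z - B f z)"
    using pw_bounded_operator_cadd[OF a bA B, of 1 "- 1"] by simp
  have E: "pw_bounded_operator a E"
    unfolding E_def[abs_def] by (rule pw_bounded_operator_comp[OF bA' diff])
  have E_norm: "pw_norm (E f) \<le> (L * \<eta>) * pw_norm f" if f: "f \<in> paley_wiener a" for f
  proof -
    have "pw_norm (E f) \<le> L * pw_norm (\<lambda>z. A f z - B f z)"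
      unfolding E_def by (rule L(2)[OF pw_bounded_operator_closed[OF diff f]])
    also have "\<dots> \<le> L * (\<eta> * pw_norm f)" by (intro mult_left_mono L \<eta> f)
    finally show ?thesis by (simp add: mult.assoc)
  qed
  have "pw_norm ((E ^^ n) f) \<le> 1 * (L * \<eta>) ^ n * pw_norm f" if f: "f \<in> paley_wiener a" for n f
    using pw_norm_funpow_le[OF E _ E_norm f] L \<eta> by simp
  then obtain S where S: "pw_inverse a (\<lambda>f z. E f z - 1 * f z) S"
    using neumann_inverse[OF a E, of "L * \<eta>" 1 1] L(1) \<eta>(1) small by auto
  then have bS: "pw_bounded_operator a S"
    and invS: "\<And>f. f \<in> paley_wiener a \<Longrightarrow> S (\<lambda>z. E f z - f z) = f"
      "\<And>f. f \<in> paley_wiener a \<Longrightarrow> (\<lambda>z. E (S f) z - S f z) = f"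
    by (auto simp: pw_inverse_def)
  have EB: "A' (B f) = (\<lambda>z. f z - E f z)" if f: "f \<in> paley_wiener a" for f
    using pw_bounded_operator_diff[OF bA' a pw_bounded_operator_closed[OF bA f] pw_bounded_operator_closed[OF B f]]
    by (simp add: E_def inv[OF f] fun_eq_iff)
  \<comment> \<open>The factor \<open>- 1\<close> appears because \<open>S\<close> inverts
    \<open>E - 1\<close>.\<close>
  define R where "R f z = - 1 * S (A' f) z" for f z
  have bR: "pw_bounded_operator a R"
    using pw_bounded_operator_cadd[OF a pw_bounded_operator_comp[OF bS bA'] pw_bounded_operator_ident, of "- 1" 0]
    by (simp add: R_def[abs_def])
  have "R (B f) = f" if f: "f \<in> paley_wiener a" for f
  proof -
    have "A' (B f) = (\<lambda>z. - 1 * (E f z - f z))" using EB[OF f] by simp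
    then have "S (A' (B f)) = (\<lambda>z. - 1 * f z)"
      using pw_bounded_operator_cmult[OF bS paley_wiener_diff[OF a pw_bounded_operator_closed[OF E f] f], of "- 1"]
      by (simp only: invS(1)[OF f])
    then show ?thesis by (simp add: R_def[abs_def])
  qed
  moreover have "B (R f) = f" if f: "f \<in> paley_wiener a" for f
  proof -
    have A'f: "A' f \<in> paley_wiener a" by (rule pw_bounded_operator_closed[OF bA' f])
    \<comment> \<open>For the right inverse, \<open>A' (B g) = - A' f\<close>, and applying
      \<open>A\<close> removes \<open>A'\<close> on both sides.\<close>
    define g where "g = S (A' f)"
    have g: "g \<in> paley_wiener a" unfolding g_def by (rule pw_bounded_operator_closed[OF bS A'f])
    have "A' (B g) = (\<lambda>z. - 1 * A' f z)"
      using EB[OF g] invS(2)[OF A'f] by (simp add: g_def fun_eq_iff) (metis minus_diff_eq)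
    then have "A (A' (B g)) = (\<lambda>z. - 1 * A (A' f) z)"
      using pw_bounded_operator_cmult[OF bA A'f, of "- 1"] by simp
    then have "B g = (\<lambda>z. - 1 * f z)"
      by (simp only: inv(2)[OF f] inv(2)[OF pw_bounded_operator_closed[OF B g]])
    moreover have "B (R f) = (\<lambda>z. - 1 * B g z)"
      unfolding R_def[abs_def] g_def[symmetric] by (rule pw_bounded_operator_cmult[OF B g])
    ultimately show ?thesis by simp
  qed
  ultimately show ?thesis
    using B bR by (auto simp: pw_invertible_iff pw_inverse_def)
qed

section \<open>Modulated sinc functions\<close>

definition csinc :: "complex \<Rightarrow> complex" where
  "csinc z = (if z = 0 then 1 else sin z / z)"

lemma csinc_0 [simp]: "csinc 0 = 1"
  by (simp add: csinc_def)

lemma csinc_minus [simp]: "csinc (- z) = csinc z"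
  by (simp add: csinc_def)

text \<open>This is the difference quotient of \<open>sin\<close> at \<open>0\<close>, completed by
  its derivative there, so the singularity is removable.\<close>

lemma holomorphic_csinc: "csinc holomorphic_on UNIV"
proof -
  have "deriv sin (0::complex) = 1"
    by (rule DERIV_imp_deriv) (auto intro!: derivative_eq_intros)
  then have "csinc = (\<lambda>z. if z = 0 then deriv sin 0 else (sin z - sin 0) / (z - 0))"
    by (auto simp: csinc_def fun_eq_iff)
  then show ?thesis
    using pole_lemma_open[of sin UNIV 0] by (simp add: holomorphic_on_sin)
qed

lemma cmod_csinc_le_divide:
  assumes "z \<noteq> 0"
  shows "cmod (csinc z) \<le> exp \<bar>Im z\<bar> / cmod z"
  using assms cmod_sin_le_exp[of 1 z] by (simp add: csinc_def norm_divide divide_right_mono)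

text \<open>Outside the unit disc the division by \<open>z\<close> only helps; inside, the maximum
  principle transfers the bound from the unit circle.\<close>

lemma cmod_csinc_le: "cmod (csinc z) \<le> exp 1 * exp \<bar>Im z\<bar>"
proof (cases "cmod z \<le> 1")
  case True
  have "cmod (csinc z) \<le> exp 1"
  proof (rule maximum_modulus_frontier[where f = csinc and S = "cball 0 1"])
    fix w :: complex assume "w \<in> frontier (cball 0 1)"
    then have w: "cmod w = 1" by simp
    have "cmod (csinc w) \<le> exp \<bar>Im w\<bar>"
      using cmod_csinc_le_divide[of w] w by fastforce
    also have "\<dots> \<le> exp 1" using abs_Im_le_cmod[of w] w by simp
    finally show "cmod (csinc w) \<le> exp 1" .
  qed (use True holomorphic_on_subset[OF holomorphic_csinc] holomorphic_on_imp_continuous_on in auto)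
  also have "\<dots> \<le> exp 1 * exp \<bar>Im z\<bar>" by simp
  finally show ?thesis .
next
  case False
  then have "cmod (csinc z) \<le> exp \<bar>Im z\<bar> / cmod z"
    by (intro cmod_csinc_le_divide) auto
  also have "\<dots> \<le> exp \<bar>Im z\<bar> / 1"
    using False by (intro divide_left_mono) auto
  also have "\<dots> \<le> exp 1 * exp \<bar>Im z\<bar>" by simp
  finally show ?thesis .
qed

lemma square_integrable_csinc: "square_integrable lborel (\<lambda>t. csinc (of_real t))"
proof -
  have int: "integrable lborel (\<lambda>x::real. inverse (1 + x\<^sup>2))"
    using integrable_inverse_1_plus_square by (simp add: set_integrable_def)
  have meas: "(\<lambda>t. csinc (of_real t)) \<in> borel_measurable lborel"
    by (rule borel_measurable_of_real_comp[OF holomorphic_csinc])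
  have le: "(cmod (csinc (of_real x)))\<^sup>2 \<le> 2 * (exp 1)\<^sup>2 * inverse (1 + x\<^sup>2)" for x :: real
  proof (cases "\<bar>x\<bar> \<le> 1")
    case True
    then have "1 + x\<^sup>2 \<le> 2" by (simp add: abs_square_le_1)
    then have "1 \<le> 2 * inverse (1 + x\<^sup>2)"
      by (simp add: field_simps add_pos_nonneg)
    moreover have "(cmod (csinc (of_real x)))\<^sup>2 \<le> (exp 1)\<^sup>2"
      using cmod_csinc_le[of "of_real x"] by (intro power_mono) auto
    moreover have "(exp 1)\<^sup>2 * 1 \<le> (exp 1)\<^sup>2 * (2 * inverse (1 + x\<^sup>2))"
      using calculation(1) by (rule mult_left_mono) simp
    ultimately have "(cmod (csinc (of_real x)))\<^sup>2 \<le> (exp 1)\<^sup>2 * (2 * inverse (1 + x\<^sup>2))"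
      by linarith
    then show ?thesis by (simp only: mult_ac)
  next
    case False
    then have x: "x \<noteq> 0" "1 \<le> x\<^sup>2" by (auto simp: abs_square_le_1[symmetric] not_le less_imp_le)
    have "(cmod (csinc (of_real x)))\<^sup>2 \<le> (1 / \<bar>x\<bar>)\<^sup>2"
      using cmod_csinc_le_divide[of "of_real x"] x by (intro power_mono) auto
    also have "\<dots> = 1 / x\<^sup>2" by (simp add: power_divide)
    also have "\<dots> \<le> 2 * inverse (1 + x\<^sup>2)"
      using x by (simp add: field_simps add_pos_nonneg)
    also have "\<dots> \<le> (exp 1)\<^sup>2 * (2 * inverse (1 + x\<^sup>2))"
      using mult_right_mono[of 1 "(exp 1)\<^sup>2" "2 * inverse (1 + x\<^sup>2)"]
      by (simp add: one_le_power add_nonneg_nonneg)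
    finally show ?thesis by (simp add: mult_ac)
  qed
  have "integrable lborel (\<lambda>t. (cmod (csinc (of_real t)))\<^sup>2)"
    by (rule Bochner_Integration.integrable_bound[OF integrable_mult_right[OF int, of "2 * (exp 1)\<^sup>2"]])
      (use meas in \<open>auto simp: le add_nonneg_nonneg\<close>)
  then show ?thesis using meas by (simp add: square_integrable_def)
qed

text \<open>For \<open>\<epsilon> > 0\<close> this is the mean of
  \<open>exp (\<i> * \<xi> * z)\<close> over the frequency band
  \<open>[s - \<epsilon>, s + \<epsilon>]\<close>. The modulation is unimodular on the real line, so
  the norm depends on \<open>\<epsilon>\<close> only.\<close>

definition wave :: "real \<Rightarrow> real \<Rightarrow> complex \<Rightarrow> complex" where
  "wave s \<epsilon> z = exp (\<i> * of_real s * z) * csinc (of_real \<epsilon> * z)"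

lemma wave_0 [simp]: "wave s \<epsilon> 0 = 1"
  by (simp add: wave_def)

lemma cmod_wave: "cmod (wave s \<epsilon> z) = exp (- (s * Im z)) * cmod (csinc (of_real \<epsilon> * z))"
  by (simp add: wave_def norm_mult)

lemma wave_paley_wiener:
  assumes "\<epsilon> > 0" "\<bar>s\<bar> + \<epsilon> \<le> a"
  shows "wave s \<epsilon> \<in> paley_wiener a"
proof -
  have hol: "wave s \<epsilon> holomorphic_on UNIV"
    using holomorphic_on_affine_comp[OF holomorphic_csinc, of "of_real \<epsilon>" 0 UNIV]
    unfolding wave_def[abs_def] by (intro holomorphic_intros) simp
  have "exponential_type_le (\<bar>s\<bar> + \<epsilon>) (wave s \<epsilon>)"
  proof (rule exponential_type_leI)
    fix z
    have "- (s * Im z) \<le> \<bar>s\<bar> * cmod z"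
      using abs_Im_le_cmod[of z] mult_left_mono[of "\<bar>Im z\<bar>" "cmod z" "\<bar>s\<bar>"]
        abs_ge_minus_self[of "s * Im z"] by (simp add: abs_mult)
    moreover have "cmod (csinc (of_real \<epsilon> * z)) \<le> exp 1 * exp (\<epsilon> * cmod z)"
    proof -
      have "cmod (csinc (of_real \<epsilon> * z)) \<le> exp 1 * exp \<bar>Im (of_real \<epsilon> * z)\<bar>"
        by (rule cmod_csinc_le)
      also have "\<bar>Im (of_real \<epsilon> * z)\<bar> \<le> \<epsilon> * cmod z"
        using assms(1) abs_Im_le_cmod[of z] by (simp add: abs_mult)
      finally show ?thesis by simp
    qed
    ultimately have "cmod (wave s \<epsilon> z) \<le> exp (\<bar>s\<bar> * cmod z) * (exp 1 * exp (\<epsilon> * cmod z))"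
      unfolding cmod_wave by (intro mult_mono) auto
    then show "cmod (wave s \<epsilon> z) \<le> exp 1 * exp ((\<bar>s\<bar> + \<epsilon>) * cmod z)"
      unfolding distrib_right exp_add by (simp only: mult_ac)
  qed
  then have type: "exponential_type_le a (wave s \<epsilon>)"
    by (rule exponential_type_le_mono) (rule assms)
  have "square_integrable lborel (\<lambda>t. csinc (of_real (0 + \<epsilon> * t)))"
    by (rule square_integrable_affine[OF square_integrable_csinc]) (use assms in auto)
  then have "square_integrable lborel (\<lambda>t. wave s \<epsilon> (of_real t))"
    by (rule square_integrable_bound[rotated])
      (auto simp: cmod_wave intro: borel_measurable_of_real_comp[OF hol, simplified])
  then show ?thesis using hol type by (simp add: paley_wiener_iff)
qed

lemma pw_norm_wave: "pw_norm (wave s \<epsilon>) = pw_norm (wave 0 \<epsilon>)"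
  by (simp add: pw_norm_eq l2_norm_def cmod_wave)

lemma pw_norm_pos:
  assumes "a \<ge> 0" "f \<in> paley_wiener a" "f z \<noteq> 0"
  shows "pw_norm f > 0"
proof (rule ccontr)
  assume "\<not> pw_norm f > 0"
  then have "pw_norm f = 0" using pw_norm_nonneg[of f] by linarith
  then show False using cmod_le_pw_norm[OF assms(1,2), of z] assms(3) by simp
qed

section \<open>Moving the line of integration, and orthogonality of waves to functions of smaller
  type\<close>

lemma LINT_horizontal_shift:
  assumes F: "F holomorphic_on UNIV" and Y: "Y \<ge> 0"
    and int: "integrable lborel (\<lambda>x. F (of_real x))" "integrable lborel (\<lambda>x. F (of_real x - \<i> * of_real Y))"
    and decay: "\<And>z. - Y \<le> Im z \<Longrightarrow> Im z \<le> 0 \<Longrightarrow> z \<noteq> 0 \<Longrightarrow> cmod (F z) \<le> C / cmod z"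
  shows "(LINT x|lborel. F (of_real x - \<i> * of_real Y)) = (LINT x|lborel. F (of_real x))"
proof -
  \<comment> \<open>A primitive does the work of Cauchy's theorem for a rectangle: each horizontal
    integral is a difference of values of \<open>P\<close> at the corners.\<close>
  obtain P where P: "\<And>z. (P has_field_derivative F z) (at z)"
    using holomorphic_convex_primitive'[of UNIV F] F by auto
  define I where "I y n = (LINT x|lborel. indicator {- real n..real n} x *\<^sub>R F (of_real x - \<i> * of_real y))"
    for y :: real and n :: nat
  have I_eq: "I y n = P (of_real (real n) - \<i> * of_real y) - P (of_real (- real n) - \<i> * of_real y)" for y n
  proof -
    have "continuous_on {- real n..real n} (\<lambda>x. F (of_real x - \<i> * of_real y))"
      by (rule continuous_on_compose2[of UNIV F])
        (auto intro!: continuous_intros holomorphic_on_imp_continuous_on F)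
    then have "I y n = integral {- real n..real n} (\<lambda>x. F (of_real x - \<i> * of_real y))"
      using set_borel_integral_eq_integral(2)[OF borel_integrable_atLeastAtMost']
      by (simp add: I_def set_lebesgue_integral_def)
    also have "((\<lambda>x. F (of_real x - \<i> * of_real y)) has_integral
        (P (of_real (real n) - \<i> * of_real y) - P (of_real (- real n) - \<i> * of_real y))) {- real n..real n}"
    proof (rule fundamental_theorem_of_calculus)
      fix x :: real
      have "((\<lambda>z. P (z - \<i> * of_real y)) has_field_derivative F (of_real x - \<i> * of_real y)) (at (of_real x))"
      proof -
        have "((\<lambda>z. z - \<i> * of_real y) has_field_derivative 1) (at (complex_of_real x))"
          by (auto intro!: derivative_eq_intros)
        from DERIV_chain2[OF P this] show ?thesis by simp
      qed
      then show "((\<lambda>x. P (of_real x - \<i> * of_real y)) has_vector_derivative F (of_real x - \<i> * of_real y))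
          (at x within {- real n..real n})"
        by (rule has_vector_derivative_real_field[THEN has_vector_derivative_at_within])
    qed simp
    then have "integral {- real n..real n} (\<lambda>x. F (of_real x - \<i> * of_real y)) =
        P (of_real (real n) - \<i> * of_real y) - P (of_real (- real n) - \<i> * of_real y)"
      by (rule integral_unique)
    finally show ?thesis .
  qed
  have lim: "I y \<longlonglongrightarrow> (LINT x|lborel. F (of_real x - \<i> * of_real y))"
    if int: "integrable lborel (\<lambda>x. F (of_real x - \<i> * of_real y))" for y
    unfolding I_def[abs_def]
  proof (rule integral_dominated_convergence)
    show "integrable lborel (\<lambda>x. cmod (F (of_real x - \<i> * of_real y)))"
      using int by (rule integrable_norm)
    show "AE x in lborel. (\<lambda>n. indicator {- real n..real n} x *\<^sub>R F (of_real x - \<i> * of_real y))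
        \<longlonglongrightarrow> F (of_real x - \<i> * of_real y)"
    proof (rule AE_I2)
      fix x :: real
      obtain m :: nat where m: "\<bar>x\<bar> \<le> real m" using real_arch_simple by blast
      have "indicator {- real n..real n} x *\<^sub>R F (of_real x - \<i> * of_real y) = F (of_real x - \<i> * of_real y)"
        if "n \<ge> m" for n
      proof -
        have "\<bar>x\<bar> \<le> real n" using that m by linarith
        then show ?thesis by (simp add: abs_le_iff)
      qed
      then show "(\<lambda>n. indicator {- real n..real n} x *\<^sub>R F (of_real x - \<i> * of_real y))
          \<longlonglongrightarrow> F (of_real x - \<i> * of_real y)"
        using eventually_sequentially by (intro tendsto_eventually) blast
    qed
  qed (use borel_measurable_integrable[OF int] in \<open>auto simp: indicator_def\<close>)
  \<comment> \<open>The vertical sides have length \<open>Y\<close> and \<open>F\<close> is at most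
    \<open>C / \<bar>r\<bar>\<close> there, so their contribution vanishes as
    \<open>r = \<plusminus>n\<close> recedes.\<close>
  have side: "cmod (P (of_real r) - P (of_real r - \<i> * of_real Y)) \<le> C / \<bar>r\<bar> * Y" if r: "r \<noteq> 0" for r
  proof -
    have "cmod (P (of_real r) - P (of_real r - \<i> * of_real Y))
        \<le> C / \<bar>r\<bar> * cmod (of_real r - (of_real r - \<i> * of_real Y))"
    proof (rule field_differentiable_bound[where S = "{z. r \<le> Re z} \<inter> {z. Re z \<le> r} \<inter> {z. - Y \<le> Im z} \<inter> {z. Im z \<le> 0}" and f' = F])
      show "convex ({z. r \<le> Re z} \<inter> {z. Re z \<le> r} \<inter> {z. - Y \<le> Im z} \<inter> {z. Im z \<le> 0})"
        by (intro convex_Int convex_halfspace_Im_le convex_halfspace_Im_ge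
        convex_halfspace_Re_le convex_halfspace_Re_ge)
      fix z assume z: "z \<in> {z. r \<le> Re z} \<inter> {z. Re z \<le> r} \<inter> {z. - Y \<le> Im z} \<inter> {z. Im z \<le> 0}"
      show "(P has_field_derivative F z) (at z within {z. r \<le> Re z} \<inter> {z. Re z \<le> r} \<inter> {z. - Y \<le> Im z} \<inter> {z. Im z \<le> 0})"
        using P by (rule has_field_derivative_at_within)
      have z0: "z \<noteq> 0" using z r by auto
      have le: "cmod (F z) \<le> C / cmod z" using decay[of z] z z0 by auto
      then have "C \<ge> 0" using z0 norm_ge_zero[of "F z"]
        by (metis order_trans zero_le_divide_iff zero_less_norm_iff not_less)
      then have "C / cmod z \<le> C / \<bar>r\<bar>"
        using z r z0 abs_Re_le_cmod[of z] by (intro divide_left_mono mult_pos_pos) auto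
      then show "cmod (F z) \<le> C / \<bar>r\<bar>" using le by linarith
    qed (use Y in auto)
    then show ?thesis using Y by (simp add: norm_mult)
  qed
  have "(\<lambda>n. I 0 n - I Y n) \<longlonglongrightarrow> 0"
  proof (rule Lim_null_comparison)
    have "cmod (I 0 n - I Y n) \<le> 2 * C * Y / real n" if "n \<ge> 1" for n
    proof -
      have "I 0 n - I Y n = (P (of_real (real n)) - P (of_real (real n) - \<i> * of_real Y))
          - (P (of_real (- real n)) - P (of_real (- real n) - \<i> * of_real Y))"
        by (simp add: I_eq)
      also have "cmod \<dots> \<le> C / \<bar>real n\<bar> * Y + C / \<bar>- real n\<bar> * Y"
        using that by (intro order_trans[OF norm_triangle_ineq4 add_mono] side) auto
      finally show ?thesis by simp
    qed
    then show "\<forall>\<^sub>F n in sequentially. cmod (I 0 n - I Y n) \<le> 2 * C * Y / real n"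
      using eventually_sequentially by blast
    show "(\<lambda>n. 2 * C * Y / real n) \<longlonglongrightarrow> 0" by (rule lim_const_over_n)
  qed
  moreover have "(\<lambda>n. I 0 n - I Y n) \<longlonglongrightarrow>
      (LINT x|lborel. F (of_real x)) - (LINT x|lborel. F (of_real x - \<i> * of_real Y))"
    using tendsto_diff[OF lim[of 0] lim[OF int(2)]] int(1) by simp
  ultimately show ?thesis using LIMSEQ_unique by fastforce
qed

text \<open>The Fourier transform of \<open>wave s \<epsilon>\<close> lives on \<open>[s - \<epsilon>, s + \<epsilon>]\<close>, so it is orthogonal to
  functions of smaller type; pushing the contour to \<open>- \<i> \<infinity>\<close> replaces the Fourier argument.\<close>

lemma wave_orthogonal:
  assumes b: "b \<ge> 0" and h: "h \<in> paley_wiener b" and \<epsilon>: "\<epsilon> > 0" and s: "s - \<epsilon> > b"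
  shows "(LINT x|lborel. h (of_real x) * cnj (wave s \<epsilon> (of_real x))) = 0"
proof -
  \<comment> \<open>On the real line \<open>k\<close> is the conjugate of the wave, but it is
    entire, so the integrand extends holomorphically.\<close>
  define k where "k = wave (- s) \<epsilon>"
  define F where "F z = h z * k z" for z
  have cnj_wave: "cnj (wave s \<epsilon> (of_real x)) = k (of_real x)" for x
    by (simp add: k_def wave_def csinc_def cnj_sin exp_cnj)
  have k: "k \<in> paley_wiener (\<bar>- s\<bar> + \<epsilon>)"
    unfolding k_def by (rule wave_paley_wiener[OF \<epsilon>]) simp
  have w0: "wave 0 \<epsilon> \<in> paley_wiener \<epsilon>" by (rule wave_paley_wiener[OF \<epsilon>]) simp
  have holF: "F holomorphic_on UNIV"
    unfolding F_def using h k by (auto simp: paley_wiener_iff intro: holomorphic_intros)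
  define N where "N = pw_norm h * pw_norm (wave 0 \<epsilon>)"
  \<comment> \<open>At height \<open>- Y\<close> the function \<open>h\<close> contributes
    \<open>exp (b * Y)\<close>, the sinc factor \<open>exp (\<epsilon> * Y)\<close> and the
    modulation \<open>exp (- (s * Y))\<close>. Since \<open>s - \<epsilon> > b\<close>, the product
    decays.\<close>
  have shift: "integrable lborel (\<lambda>x. F (of_real x - \<i> * of_real Y))"
    "cmod (LINT x|lborel. F (of_real x - \<i> * of_real Y)) \<le> N * exp (- ((s - \<epsilon> - b) * Y))"
    if Y: "Y \<ge> 0" for Y
  proof -
    define w where "w = - \<i> * complex_of_real Y"
    have w: "\<bar>Im w\<bar> = Y" using Y by (simp add: w_def)
    note hw = translate_paley_wiener[OF b h, of w, unfolded w]
    have kw: "(\<lambda>z. k (z + w)) \<in> paley_wiener (\<bar>- s\<bar> + \<epsilon>)"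
      using \<epsilon> by (intro translate_paley_wiener k) auto
    note w0w = translate_paley_wiener[OF less_imp_le[OF \<epsilon>] w0, of w, unfolded w]
    have "cmod (k (of_real x + w)) = cmod (of_real (exp (- (s * Y))) * wave 0 \<epsilon> (of_real x + w))" for x :: real
      by (simp add: k_def cmod_wave norm_mult w_def)
    then have "pw_norm (\<lambda>z. k (z + w)) = pw_norm (\<lambda>z. of_real (exp (- (s * Y))) * wave 0 \<epsilon> (z + w))"
      unfolding pw_norm_eq l2_norm_def by simp
    also have "\<dots> = exp (- (s * Y)) * pw_norm (\<lambda>z. wave 0 \<epsilon> (z + w))"
      by (subst pw_norm_cmult) simp
    also have "\<dots> \<le> exp (- (s * Y)) * (exp (\<epsilon> * Y) * pw_norm (wave 0 \<epsilon>))"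
      by (intro mult_left_mono w0w) simp
    finally have kn: "pw_norm (\<lambda>z. k (z + w)) \<le> exp (- (s * Y)) * (exp (\<epsilon> * Y) * pw_norm (wave 0 \<epsilon>))" .
    have sq: "square_integrable lborel (\<lambda>x. h (of_real x + w))" "square_integrable lborel (\<lambda>x. k (of_real x + w))"
      using hw(1) kw by (auto simp: paley_wiener_iff)
    have eq: "F (of_real x - \<i> * of_real Y) = h (of_real x + w) * k (of_real x + w)" for x
      by (simp add: F_def w_def)
    show "integrable lborel (\<lambda>x. F (of_real x - \<i> * of_real Y))"
      unfolding eq by (rule integrable_mult_square_integrable[OF sq])
    have "cmod (LINT x|lborel. F (of_real x - \<i> * of_real Y)) \<le> pw_norm (\<lambda>z. h (z + w)) * pw_norm (\<lambda>z. k (z + w))"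
      unfolding eq pw_norm_eq by (rule cmod_LINT_mult_le[OF sq])
    also have "\<dots> \<le> (exp (b * Y) * pw_norm h) * (exp (- (s * Y)) * (exp (\<epsilon> * Y) * pw_norm (wave 0 \<epsilon>)))"
      by (intro mult_mono hw kn) auto
    also have "\<dots> = N * exp (b * Y + - (s * Y) + \<epsilon> * Y)"
      by (simp only: N_def exp_add mult_ac)
    finally show "cmod (LINT x|lborel. F (of_real x - \<i> * of_real Y)) \<le> N * exp (- ((s - \<epsilon> - b) * Y))"
      by (simp add: algebra_simps)
  qed
  \<comment> \<open>In the strip \<open>h\<close> is bounded by point evaluation and the sinc factor
    decays like \<open>1 / cmod z\<close>, as the contour shift requires.\<close>
  have const: "(LINT x|lborel. F (of_real x - \<i> * of_real Y)) = (LINT x|lborel. F (of_real x))"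
    if Y: "Y \<ge> 0" for Y
  proof (rule LINT_horizontal_shift[OF holF Y _ shift(1)[OF Y]])
    show "integrable lborel (\<lambda>x. F (of_real x))" using shift(1)[of 0] by simp
    fix z assume z: "- Y \<le> Im z" "Im z \<le> 0" "z \<noteq> 0"
    then have Im_z: "\<bar>Im z\<bar> \<le> Y" by auto
    have "cmod (h z) \<le> (1 + exp b) * exp (b * \<bar>Im z\<bar>) * pw_norm h"
      by (rule cmod_le_pw_norm[OF b h])
    also have "\<dots> \<le> (1 + exp b) * exp (b * Y) * pw_norm h"
      using mult_left_mono[OF Im_z b]
      by (intro mult_right_mono mult_left_mono) (auto simp: add_nonneg_nonneg)
    finally have hz: "cmod (h z) \<le> (1 + exp b) * exp (b * Y) * pw_norm h" .
    have "cmod (k z) \<le> 1 * (exp \<bar>Im (of_real \<epsilon> * z)\<bar> / cmod (of_real \<epsilon> * z))"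
      unfolding k_def cmod_wave
      using z s b \<epsilon> cmod_csinc_le_divide[of "of_real \<epsilon> * z"]
      by (intro mult_mono) (auto simp: mult_nonneg_nonpos)
    also have "\<dots> \<le> exp (\<epsilon> * Y) / (\<epsilon> * cmod z)"
      using z \<epsilon> mult_left_mono[OF Im_z, of \<epsilon>] by (auto simp: norm_mult abs_mult intro!: divide_right_mono)
    finally have kz: "cmod (k z) \<le> exp (\<epsilon> * Y) / (\<epsilon> * cmod z)" .
    have "cmod (F z) \<le> ((1 + exp b) * exp (b * Y) * pw_norm h) * (exp (\<epsilon> * Y) / (\<epsilon> * cmod z))"
      unfolding F_def norm_mult using hz kz by (intro mult_mono order_trans[OF norm_ge_zero hz]) auto
    then show "cmod (F z) \<le> ((1 + exp b) * exp (b * Y) * pw_norm h * exp (\<epsilon> * Y) / \<epsilon>) / cmod z"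
      by (simp add: mult_ac)
  qed
  have "((\<lambda>Y. N * exp (- ((s - \<epsilon> - b) * Y))) \<longlongrightarrow> N * 0) at_top"
    using s by (intro tendsto_mult tendsto_const) real_asymp
  moreover have "\<forall>\<^sub>F Y in at_top. cmod (LINT x|lborel. F (of_real x)) \<le> N * exp (- ((s - \<epsilon> - b) * Y))"
    using eventually_ge_at_top[of 0]
  proof eventually_elim
    case (elim Y)
    then show ?case using shift(2)[of Y] const[of Y] by simp
  qed
  ultimately have "cmod (LINT x|lborel. F (of_real x)) \<le> N * 0"
    by (intro tendsto_lowerbound[OF _ _ trivial_limit_at_top_linorder])
  then show ?thesis by (simp add: cnj_wave F_def)
qed

section \<open>The spectra\<close>

lemma pw_bounded_operator_translate:
  assumes "a \<ge> 0"
  shows "pw_bounded_operator a (\<lambda>f z. f (z + w))"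
  by (rule pw_bounded_operatorI[where K = "exp (a * \<bar>Im w\<bar>)"])
    (use translate_paley_wiener[OF assms] in auto)

lemma pw_bounded_operator_composition:
  fixes c :: real
  assumes "a \<ge> 0" "c \<noteq> 0" "\<bar>c\<bar> \<le> 1"
  shows "pw_bounded_operator a (composition_operator (\<lambda>z. of_real c * z + w))"
proof (rule pw_bounded_operatorI)
  fix f assume f: "f \<in> paley_wiener a"
  have "a * \<bar>c\<bar> \<le> a" using assms by (simp add: mult_left_le)
  then show "composition_operator (\<lambda>z. of_real c * z + w) f \<in> paley_wiener a"
    using paley_wiener_affine(1)[OF assms(1) f assms(2,3)] paley_wiener_mono
    by (auto simp: composition_operator_def o_def)
  show "pw_norm (composition_operator (\<lambda>z. of_real c * z + w) f)
      \<le> exp (a * \<bar>Im w\<bar>) / sqrt \<bar>c\<bar> * pw_norm f"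
    using paley_wiener_affine(2)[OF assms(1) f assms(2,3)]
    by (simp add: composition_operator_def o_def)
qed (simp_all add: composition_operator_def o_def)

lemma pw_spectrum_iff: "\<mu> \<in> pw_spectrum a T \<longleftrightarrow> \<not> pw_invertible a (\<lambda>f z. T f z - \<mu> * f z)"
  by (simp add: pw_spectrum_def)

lemma eigenvalue_in_pw_spectrum:
  assumes a: "a \<ge> 0" and f: "f \<in> paley_wiener a" "f w \<noteq> 0" and eig: "\<And>z. T f z = \<mu> * f z"
  shows "\<mu> \<in> pw_spectrum a T"
  unfolding pw_spectrum_iff
proof
  assume "pw_invertible a (\<lambda>f z. T f z - \<mu> * f z)"
  then obtain S where "pw_inverse a (\<lambda>f z. T f z - \<mu> * f z) S"
    by (auto simp: pw_invertible_iff)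
  then have S: "pw_bounded_operator a S" and "S (\<lambda>z. T f z - \<mu> * f z) = f"
    using f(1) by (auto simp: pw_inverse_def)
  then have "f = (\<lambda>z. 0)" using pw_bounded_operator_zero[OF S a] by (simp add: eig)
  then show False using f(2) by simp
qed

section \<open>The reflection, \<open>c = -1\<close>\<close>

lemma pw_spectrum_reflection:
  assumes a: "a > 0"
  shows "pw_spectrum a (composition_operator (\<lambda>z. - z + d)) = {-1, 1}"
proof
  let ?T = "composition_operator (\<lambda>z. - z + d)"
  have T: "pw_bounded_operator a ?T"
    using pw_bounded_operator_composition[of a "- 1" d] a by simp
  have TT: "?T (?T f) = f" for f by (simp add: composition_operator_def o_def)
  show "pw_spectrum a ?T \<subseteq> {-1, 1}"
  proof
    fix \<mu> assume \<mu>: "\<mu> \<in> pw_spectrum a ?T"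
    show "\<mu> \<in> {-1, 1}"
    proof (rule ccontr)
      assume "\<mu> \<notin> {-1, 1}"
      then have ne: "1 - \<mu>\<^sup>2 \<noteq> 0" using power2_eq_1_iff[of \<mu>] by auto
      \<comment> \<open>Because \<open>T\<close> squares to the identity,
        \<open>(T - \<mu>) (T + \<mu>) = 1 - \<mu>\<^sup>2\<close>, so the inverse is
        \<open>k\<close> times \<open>T + \<mu>\<close>.\<close>
      define k where "k = 1 / (1 - \<mu>\<^sup>2)"
      have k: "k * (1 - \<mu>\<^sup>2) = 1" using ne by (simp add: k_def)
      have "pw_inverse a (\<lambda>f z. ?T f z - \<mu> * f z) (\<lambda>f z. k * ?T f z + (k * \<mu>) * f z)"
        unfolding pw_inverse_def
      proof (intro conjI ballI)
        show "pw_bounded_operator a (\<lambda>f z. ?T f z - \<mu> * f z)"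
          using a T by (intro pw_bounded_operator_minus_scalar) auto
        show "pw_bounded_operator a (\<lambda>f z. k * ?T f z + (k * \<mu>) * f z)"
          using a T by (intro pw_bounded_operator_cadd pw_bounded_operator_ident) auto
        have eq: "(k * (1 - \<mu>\<^sup>2)) * f z = f z" for f :: "complex \<Rightarrow> complex" and z
          by (simp only: k mult_1_left)
        fix f :: "complex \<Rightarrow> complex"
        show "(\<lambda>z. k * ?T (\<lambda>z. ?T f z - \<mu> * f z) z + k * \<mu> * (?T f z - \<mu> * f z)) = f"
          using eq[of f] by (simp add: fun_eq_iff composition_operator_def power2_eq_square algebra_simps)
        show "(\<lambda>z. ?T (\<lambda>z. k * ?T f z + k * \<mu> * f z) z - \<mu> * (k * ?T f z + k * \<mu> * f z)) = f"
          using eq[of f] by (simp add: fun_eq_iff composition_operator_def power2_eq_square algebra_simps)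
      qed
      then show False using \<mu> by (auto simp: pw_spectrum_iff pw_invertible_iff)
    qed
  qed
  \<comment> \<open>\<open>E\<close> is even and \<open>D\<close> is odd about \<open>0\<close>, and
    both use only frequencies in \<open>[-a, a]\<close>. Translating them to the fixed point
    \<open>d / 2\<close> gives the eigenfunctions.\<close>
  define E where "E = wave 0 a"
  define D where "D z = wave (a / 2) (a / 2) z - wave (- (a / 2)) (a / 2) z" for z
  have D_odd: "D (- z) = - D z" for z by (simp add: D_def wave_def)
  have E_even: "E (- z) = E z" for z by (simp add: E_def wave_def)
  have D_eq: "D z = 2 * \<i> * sin (of_real (a / 2) * z) * csinc (of_real (a / 2) * z)" for z
  proof -
    have "2 * \<i> * sin (of_real (a / 2) * z) =
        exp (\<i> * of_real (a / 2) * z) - exp (\<i> * of_real (- (a / 2)) * z)"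
      by (simp add: sin_exp_eq mult.assoc diff_divide_distrib)
    then have "2 * \<i> * sin (of_real (a / 2) * z) * csinc (of_real (a / 2) * z) =
        (exp (\<i> * of_real (a / 2) * z) - exp (\<i> * of_real (- (a / 2)) * z)) * csinc (of_real (a / 2) * z)"
      by (rule arg_cong)
    then show ?thesis by (simp only: D_def wave_def left_diff_distrib)
  qed
  have E: "E \<in> paley_wiener a" unfolding E_def using a by (intro wave_paley_wiener) auto
  have D: "D \<in> paley_wiener a"
    unfolding D_def[abs_def] using a by (intro paley_wiener_diff wave_paley_wiener) auto
  show "{-1, 1} \<subseteq> pw_spectrum a ?T"
  proof -
    have "1 \<in> pw_spectrum a ?T"
    proof (rule eigenvalue_in_pw_spectrum)
      show "(\<lambda>z. E (z + - (d / 2))) \<in> paley_wiener a"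
        using a by (intro translate_paley_wiener E) auto
      show "E (d / 2 + - (d / 2)) \<noteq> 0" by (simp add: E_def)
      fix z
      have "- z + d + - (d / 2) = - (z + - (d / 2))" by (simp add: field_simps)
      then show "?T (\<lambda>z. E (z + - (d / 2))) z = 1 * E (z + - (d / 2))"
        by (simp only: composition_operator_def o_def E_even mult_1_left)
    qed (use a in auto)
    moreover have "- 1 \<in> pw_spectrum a ?T"
    proof (rule eigenvalue_in_pw_spectrum)
      show "(\<lambda>z. D (z + - (d / 2))) \<in> paley_wiener a"
        using a by (intro translate_paley_wiener D) auto
      \<comment> \<open>At \<open>1 / a\<close> both factors in \<open>D_eq\<close> are evaluated at
        \<open>1 / 2\<close>, where the sine is positive.\<close>
      define w where "w = complex_of_real (1 / a)"
      have "of_real (a / 2) * w = of_real (1 / 2)" using a by (simp add: w_def)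
      moreover have "sin (complex_of_real (1 / 2)) \<noteq> 0"
        using sin_gt_zero2[of "1/2"] pi_gt3 unfolding sin_of_real by simp
      ultimately have "D w \<noteq> 0" by (simp add: D_eq csinc_def)
      then show "D (w + d / 2 + - (d / 2)) \<noteq> 0" by simp
      fix z
      have "- z + d + - (d / 2) = - (z + - (d / 2))" by (simp add: field_simps)
      then show "?T (\<lambda>z. D (z + - (d / 2))) z = - 1 * D (z + - (d / 2))"
        by (simp only: composition_operator_def o_def D_odd) simp
    qed (use a in auto)
    ultimately show ?thesis by simp
  qed
qed

section \<open>The contraction, \<open>0 < \<bar>c\<bar> < 1\<close>\<close>

lemma pw_spectrum_contraction:
  assumes a: "a > 0" and c: "c \<noteq> 0" "\<bar>c\<bar> < 1"
  shows "pw_spectrum a (composition_operator (\<lambda>z. of_real c * z + d)) = {\<mu>. cmod \<mu> \<le> 1 / sqrt \<bar>c\<bar>}"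
proof (intro equalityI subsetI; unfold mem_Collect_eq)
  let ?T = "composition_operator (\<lambda>z. of_real c * z + d)"
  have T: "pw_bounded_operator a ?T"
    using a c by (intro pw_bounded_operator_composition) auto
  \<comment> \<open>The fixed point of the affine map; recentring there turns the map into the
    dilation by \<open>c\<close>.\<close>
  define p where "p = d / (1 - of_real c)"
  have c1: "complex_of_real c \<noteq> 1" using c by auto
  then have p: "of_real c * p + d = p" by (simp add: p_def field_simps)
  {
    fix \<mu> assume \<mu>: "\<mu> \<in> pw_spectrum a ?T"
    have funpow: "(?T ^^ n) f = (\<lambda>z. f (of_real (c ^ n) * z + p * (1 - of_real (c ^ n))))" for f n
    proof (induction n)
      case (Suc n)
      have "of_real (c ^ n) * (of_real c * z + d) + p * (1 - of_real (c ^ n)) =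
          of_real (c ^ Suc n) * z + p * (1 - of_real (c ^ Suc n))" for z
      proof -
        have "d = p - of_real c * p" using p by (simp add: algebra_simps)
        show ?thesis by (subst \<open>d = p - of_real c * p\<close>) (simp add: algebra_simps)
      qed
      then show ?case using Suc by (simp add: fun_eq_iff composition_operator_def)
    qed simp
    \<comment> \<open>The imaginary part of the shift in the \<open>n\<close>-th iterate is bounded
      by \<open>2 * cmod p\<close>, so the translation factor stays a constant and only
      \<open>sqrt \<bar>c\<bar>\<close> is raised to the power \<open>n\<close>.\<close>
    have pow: "pw_norm ((?T ^^ n) f) \<le> exp (a * (2 * cmod p)) * (1 / sqrt \<bar>c\<bar>) ^ n * pw_norm f"
      if f: "f \<in> paley_wiener a" for f n
    proof -
      have cn: "\<bar>c ^ n\<bar> \<le> 1" using c by (simp add: power_abs power_le_one)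
      have "cmod (1 - of_real (c ^ n)) \<le> 1 + \<bar>c ^ n\<bar>"
        using norm_triangle_ineq4[of 1 "complex_of_real (c ^ n)"] by (simp add: norm_power power_abs)
      also have "\<dots> \<le> 2" using cn by simp
      finally have "cmod p * cmod (1 - of_real (c ^ n)) \<le> cmod p * 2" by (rule mult_left_mono) simp
      then have "\<bar>Im (p * (1 - of_real (c ^ n)))\<bar> \<le> 2 * cmod p"
        using abs_Im_le_cmod[of "p * (1 - of_real (c ^ n))"] unfolding norm_mult by linarith
      then have le: "exp (a * \<bar>Im (p * (1 - of_real (c ^ n)))\<bar>) \<le> exp (a * (2 * cmod p))"
        using a by (simp only: exp_le_cancel_iff mult_le_cancel_left_pos)
      have "pw_norm ((?T ^^ n) f) \<le> exp (a * \<bar>Im (p * (1 - of_real (c ^ n)))\<bar>) / sqrt \<bar>c ^ n\<bar> * pw_norm f"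
        unfolding funpow using a c cn f by (intro paley_wiener_affine) auto
      also have "\<dots> \<le> exp (a * (2 * cmod p)) / sqrt \<bar>c ^ n\<bar> * pw_norm f"
        by (intro mult_right_mono divide_right_mono le) auto
      also have "exp (a * (2 * cmod p)) / sqrt \<bar>c ^ n\<bar> = exp (a * (2 * cmod p)) * (1 / sqrt \<bar>c\<bar>) ^ n"
        by (simp add: power_abs real_sqrt_power power_divide)
      finally show ?thesis .
    qed
    show "cmod \<mu> \<le> 1 / sqrt \<bar>c\<bar>"
    proof (rule ccontr)
      assume "\<not> cmod \<mu> \<le> 1 / sqrt \<bar>c\<bar>"
      then have "\<exists>S. pw_inverse a (\<lambda>f z. ?T f z - \<mu> * f z) S"
        using neumann_inverse[OF less_imp_le[OF a] T, of "1 / sqrt \<bar>c\<bar>" \<mu>, OF _ _ pow] by auto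
      then show False using \<mu> by (simp add: pw_spectrum_iff pw_invertible_iff)
    qed
  next
    fix \<mu> assume \<mu>: "cmod \<mu> \<le> 1 / sqrt \<bar>c\<bar>"
    show "\<mu> \<in> pw_spectrum a ?T"
      unfolding pw_spectrum_iff
    proof
      assume "pw_invertible a (\<lambda>f z. ?T f z - \<mu> * f z)"
      then obtain S where S: "pw_inverse a (\<lambda>f z. ?T f z - \<mu> * f z) S"
        by (auto simp: pw_invertible_iff)
      \<comment> \<open>The band of \<open>g\<close> will be \<open>[a - 2 * \<epsilon>, a]\<close>;
        its lower end is \<open>a * (1 + \<bar>c\<bar>) / 2\<close>, above
        \<open>a * \<bar>c\<bar>\<close>.\<close>
      define \<epsilon> where "\<epsilon> = a * (1 - \<bar>c\<bar>) / 4"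
      define s where "s = a - \<epsilon>"
      have \<epsilon>: "\<epsilon> > 0" "\<epsilon> \<le> a" using a c by (auto simp: \<epsilon>_def)
      have "s - \<epsilon> = a * (1 + \<bar>c\<bar>) / 2" by (simp add: s_def \<epsilon>_def field_simps)
      also have "\<dots> > a * \<bar>c\<bar>" using a c by (simp add: field_simps)
      finally have s: "s - \<epsilon> > a * \<bar>c\<bar>" .
      define g where "g = wave s \<epsilon>"
      have g: "g \<in> paley_wiener a"
        unfolding g_def using \<epsilon> by (intro wave_paley_wiener) (auto simp: s_def)
      \<comment> \<open>The right-hand side is the wave moved to \<open>p\<close>, so that after
        recentring it is \<open>g\<close> itself.\<close>
      have gp: "(\<lambda>z. g (z + - p)) \<in> paley_wiener a"
        using a by (intro translate_paley_wiener g) auto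
      define f0 where "f0 = S (\<lambda>z. g (z + - p))"
      have f0: "f0 \<in> paley_wiener a" "\<And>z. ?T f0 z - \<mu> * f0 z = g (z + - p)"
        using S gp by (auto simp: f0_def pw_inverse_def fun_eq_iff dest: pw_bounded_operator_closed)
      define f where "f z = f0 (z + p)" for z
      have f: "f \<in> paley_wiener a"
        unfolding f_def[abs_def] using a by (intro translate_paley_wiener f0) auto
      define h where "h z = f (of_real c * z + 0)" for z
      have h: "h \<in> paley_wiener (a * \<bar>c\<bar>)"
        unfolding h_def[abs_def] using a c f by (intro paley_wiener_affine) auto
      have eq: "h z - g z = \<mu> * f z" for z
      proof -
        have "of_real c * (z + p) + d = of_real c * z + p"
          using p by (simp add: algebra_simps)
        then have "?T f0 (z + p) = f0 (of_real c * z + p)"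
          by (simp only: composition_operator_def o_apply)
        then show ?thesis
          using f0(2)[of "z + p"] by (simp add: h_def f_def algebra_simps)
      qed
      have sq: "square_integrable lborel (\<lambda>t. h (of_real t))" "square_integrable lborel (\<lambda>t. g (of_real t))"
        using h g by (auto simp: paley_wiener_iff)
      have orth: "(LINT x|lborel. h (of_real x) * cnj (g (of_real x))) = 0"
        unfolding g_def using a \<epsilon> s by (intro wave_orthogonal[OF _ h]) auto
      have norm_h: "(pw_norm h)\<^sup>2 = (pw_norm f)\<^sup>2 / \<bar>c\<bar>"
        using l2_norm_affine[OF c(1), of "\<lambda>t. f (of_real t)" 0]
        by (simp add: pw_norm_eq h_def power_divide)
      have "(cmod \<mu>)\<^sup>2 * (pw_norm f)\<^sup>2 = (pw_norm (\<lambda>z. h z - g z))\<^sup>2"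
        by (simp add: eq pw_norm_cmult power_mult_distrib)
      also have "\<dots> = (LINT x|lborel. (cmod (h (of_real x)))\<^sup>2 + (cmod (g (of_real x)))\<^sup>2
          - 2 * Re (h (of_real x) * cnj (g (of_real x))))"
        unfolding pw_norm_eq l2_norm_power2
        by (intro Bochner_Integration.integral_cong refl) (simp only: cmod_power2, simp add: power2_eq_square algebra_simps)
      also have "\<dots> = (pw_norm h)\<^sup>2 + (pw_norm g)\<^sup>2 - 2 * Re (LINT x|lborel. h (of_real x) * cnj (g (of_real x)))"
      proof -
        have "square_integrable lborel (\<lambda>t. cnj (g (of_real t)))"
          using sq(2) measurable_compose[OF _ borel_measurable_continuous_onI[of cnj], of "\<lambda>t. g (of_real t)"]
          by (auto simp: square_integrable_def intro: continuous_intros)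
        note int = integrable_mult_square_integrable[OF sq(1) this]
        have hi: "integrable lborel (\<lambda>x. (cmod (h (of_real x)))\<^sup>2)"
          and gi: "integrable lborel (\<lambda>x. (cmod (g (of_real x)))\<^sup>2)"
          using sq by (auto simp: square_integrable_def)
        have ri: "integrable lborel (\<lambda>x. 2 * Re (h (of_real x) * cnj (g (of_real x))))"
          by (intro integrable_mult_right integrable_Re int)
        show ?thesis
          unfolding pw_norm_eq l2_norm_power2
          by (simp only: Bochner_Integration.integral_diff[OF Bochner_Integration.integrable_add[OF hi gi] ri]
            Bochner_Integration.integral_add[OF hi gi] integral_mult_right_zero integral_Re[OF int])
      qed
      finally have "(cmod \<mu>)\<^sup>2 * (pw_norm f)\<^sup>2 = (pw_norm f)\<^sup>2 / \<bar>c\<bar> + (pw_norm g)\<^sup>2"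
        by (simp add: orth norm_h)
      moreover have "(cmod \<mu>)\<^sup>2 * (pw_norm f)\<^sup>2 \<le> (pw_norm f)\<^sup>2 / \<bar>c\<bar>"
      proof -
        have "(cmod \<mu>)\<^sup>2 \<le> (1 / sqrt \<bar>c\<bar>)\<^sup>2" using \<mu> by (intro power_mono) auto
        also have "\<dots> = 1 / \<bar>c\<bar>" by (simp add: power_divide)
        finally show ?thesis using mult_right_mono[of "(cmod \<mu>)\<^sup>2" "1 / \<bar>c\<bar>" "(pw_norm f)\<^sup>2"] by simp
      qed
      moreover have "pw_norm g > 0"
        using a g by (intro pw_norm_pos[of a g 0]) (auto simp: g_def)
      then have "(pw_norm g)\<^sup>2 > 0" by simp
      ultimately show False by linarith
    qed
  }
qed

section \<open>Translations: the curve belongs to the spectrum\<close>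

lemma exp_in_pw_spectrum_translate:
  assumes a: "a > 0" and t: "\<bar>t\<bar> \<le> a"
  shows "exp (\<i> * d * of_real t) \<in> pw_spectrum a (\<lambda>f z. f (z + d))"
  unfolding pw_spectrum_iff
proof
  define \<mu> where "\<mu> = exp (\<i> * d * of_real t)"
  assume "pw_invertible a (\<lambda>f z. f (z + d) - exp (\<i> * d * of_real t) * f z)"
  then obtain S where S: "pw_inverse a (\<lambda>f z. f (z + d) - \<mu> * f z) S"
    by (auto simp: pw_invertible_iff \<mu>_def)
  then obtain K where K: "K \<ge> 0" "\<And>f. f \<in> paley_wiener a \<Longrightarrow> pw_norm (S f) \<le> K * pw_norm f"
    using pw_bounded_operator_bound[of a S] by (auto simp: pw_inverse_def)
  \<comment> \<open>This bounds the norm of \<open>T_d - \<mu>\<close> on a wave relative to the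
    norm of the wave. The first term is the error from moving the frequency \<open>t\<close> to
    \<open>t * (1 - \<eta>)\<close>, the second comes from the bandwidth
    \<open>a * \<eta>\<close>.\<close>
  define \<beta> where "\<beta> \<eta> = cmod (exp (\<i> * of_real (t * (1 - \<eta>)) * d) - \<mu>) * exp (a * \<eta> * \<bar>Im d\<bar>)
      + cmod \<mu> * (a * \<eta> * cmod d * exp (1 + a * \<eta> * cmod d))" for \<eta> :: real
  have le: "1 \<le> K * \<beta> \<eta>" if \<eta>: "0 < \<eta>" "\<eta> < 1" for \<eta>
  proof -
    \<comment> \<open>Pulling the frequency inward leaves room for a band of half-width
      \<open>a * \<eta>\<close> inside \<open>[-a, a]\<close>, even at
      \<open>t = \<plusminus>a\<close>.\<close>
    define s where "s = t * (1 - \<eta>)"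
    define \<epsilon> where "\<epsilon> = a * \<eta>"
    have \<epsilon>: "\<epsilon> > 0" using a \<eta> by (simp add: \<epsilon>_def)
    have "\<bar>s\<bar> \<le> a * (1 - \<eta>)" using t \<eta> by (simp add: s_def abs_mult mult_right_mono)
    then have sa: "\<bar>s\<bar> + \<epsilon> \<le> a" by (simp add: \<epsilon>_def algebra_simps)
    define f where "f = wave s \<epsilon>"
    define v where "v = wave 0 \<epsilon>"
    have f: "f \<in> paley_wiener a" unfolding f_def by (rule wave_paley_wiener[OF \<epsilon> sa])
    have v: "v \<in> paley_wiener \<epsilon>" unfolding v_def by (rule wave_paley_wiener[OF \<epsilon>]) simp
    have v_pos: "pw_norm v > 0"
      using \<epsilon> v by (intro pw_norm_pos[of \<epsilon> v 0]) (auto simp: v_def)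
    note vd = translate_paley_wiener[OF less_imp_le[OF \<epsilon>] v, of d]
    have vdiff: "(\<lambda>z. v (z + d) - v z) \<in> paley_wiener \<epsilon>"
      using \<epsilon> v vd by (intro paley_wiener_diff) auto
    define e where "e = exp (\<i> * of_real s * d)"
    \<comment> \<open>The modulation is split off because it has modulus one on the real line; what
      remains involves only the unmodulated \<open>v\<close>, of small type
      \<open>\<epsilon>\<close>.\<close>
    have Tf: "f (z + d) - \<mu> * f z = exp (\<i> * of_real s * z) * ((e - \<mu>) * v (z + d) + \<mu> * (v (z + d) - v z))" for z
      by (simp add: f_def v_def e_def wave_def exp_add algebra_simps)
    have Tf_in: "(\<lambda>z. f (z + d) - \<mu> * f z) \<in> paley_wiener a"
      using a f by (intro paley_wiener_diff paley_wiener_cmult translate_paley_wiener) auto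
    have "pw_norm (\<lambda>z. f (z + d) - \<mu> * f z) = pw_norm (\<lambda>z. (e - \<mu>) * v (z + d) + \<mu> * (v (z + d) - v z))"
      by (simp add: pw_norm_eq l2_norm_def Tf norm_mult)
    also have "\<dots> \<le> pw_norm (\<lambda>z. (e - \<mu>) * v (z + d)) + pw_norm (\<lambda>z. \<mu> * (v (z + d) - v z))"
      using \<epsilon> vd vdiff by (intro pw_norm_triangle[of _ \<epsilon> _ \<epsilon>] paley_wiener_cmult) auto
    also have "\<dots> \<le> cmod (e - \<mu>) * (exp (\<epsilon> * \<bar>Im d\<bar>) * pw_norm v)
        + cmod \<mu> * (\<epsilon> * cmod d * exp (1 + \<epsilon> * cmod d) * pw_norm v)"
      unfolding pw_norm_cmult
      using vd translate_diff_norm_le[OF \<epsilon> v, of d] by (intro add_mono mult_left_mono) auto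
    also have "\<dots> = \<beta> \<eta> * pw_norm v"
      by (simp add: \<beta>_def e_def s_def \<epsilon>_def algebra_simps)
    finally have Tf_le: "pw_norm (\<lambda>z. f (z + d) - \<mu> * f z) \<le> \<beta> \<eta> * pw_norm v" .
    have "pw_norm v = pw_norm f" by (simp add: f_def v_def pw_norm_wave[of s])
    also have "\<dots> = pw_norm (S (\<lambda>z. f (z + d) - \<mu> * f z))"
      using S f by (simp add: pw_inverse_def)
    also have "\<dots> \<le> K * pw_norm (\<lambda>z. f (z + d) - \<mu> * f z)" by (rule K(2)[OF Tf_in])
    also have "\<dots> \<le> K * (\<beta> \<eta> * pw_norm v)" using Tf_le K(1) by (rule mult_left_mono)
    finally have "1 * pw_norm v \<le> (K * \<beta> \<eta>) * pw_norm v" by simp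
    then show ?thesis using v_pos by (simp only: mult_le_cancel_right_pos)
  qed
  have "((\<lambda>\<eta>. K * \<beta> \<eta>) \<longlongrightarrow> K * \<beta> 0) (at_right 0)"
    unfolding \<beta>_def by (intro tendsto_intros)
  moreover have "\<forall>\<^sub>F \<eta> in at_right 0. 1 \<le> K * \<beta> \<eta>"
    using eventually_at_right_less[of 0] eventually_at_right_real[of 0 1]
    by (auto elim!: eventually_mono simp: le)
  ultimately have "1 \<le> K * \<beta> 0"
    by (rule tendsto_lowerbound) simp
  moreover have "\<beta> 0 = 0" by (simp add: \<beta>_def \<mu>_def mult_ac)
  ultimately show False by simp
qed

section \<open>Translations: invertibility off the curve\<close>

lemma translate_funpow: "((\<lambda>f z. f (z + w)) ^^ n) f = (\<lambda>z. f (z + of_nat n * w))"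
  for w :: "'a::comm_semiring_1"
  by (induction n arbitrary: f) (simp_all add: fun_eq_iff algebra_simps)

text \<open>The difference of squares: translation by \<open>h\<close> minus
  \<open>\<nu>\<^sup>2\<close> is the composition of translation by \<open>h / 2\<close> minus
  \<open>\<nu>\<close> and plus \<open>\<nu>\<close>.\<close>

lemma translate_minus_invertible_halve:
  assumes "pw_invertible a (\<lambda>f z. f (z + h / 2) - \<nu> * f z)"
    "pw_invertible a (\<lambda>f z. f (z + h / 2) - (- \<nu>) * f z)"
  shows "pw_invertible a (\<lambda>f z. f (z + h) - \<nu>\<^sup>2 * f z)"
proof -
  obtain S S' where "pw_inverse a (\<lambda>f z. f (z + h / 2) - \<nu> * f z) S"
    "pw_inverse a (\<lambda>f z. f (z + h / 2) - (- \<nu>) * f z) S'"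
    using assms by (auto simp: pw_invertible_iff)
  from pw_inverse_comp[OF this] show ?thesis
    by (auto simp: pw_invertible_iff power2_eq_square algebra_simps)
qed

lemma translate_minus_invertible_roots:
  assumes "\<And>\<nu>. \<nu> ^ (2 ^ m) = \<mu> \<Longrightarrow> pw_invertible a (\<lambda>f z. f (z + h / 2 ^ m) - \<nu> * f z)"
  shows "pw_invertible a (\<lambda>f z. f (z + h) - \<mu> * f z)"
  using assms
proof (induction m arbitrary: h \<mu>)
  case (Suc m)
  have "pw_invertible a (\<lambda>f z. f (z + h / 2) - \<nu> * f z)" if "\<nu>\<^sup>2 = \<mu>" for \<nu>
  proof (rule Suc.IH)
    fix \<kappa> assume "\<kappa> ^ 2 ^ m = \<nu>"
    moreover have "\<kappa> ^ 2 ^ Suc m = (\<kappa> ^ 2 ^ m)\<^sup>2" by (simp add: power_mult[symmetric] mult.commute)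
    ultimately have "\<kappa> ^ 2 ^ Suc m = \<mu>" using that by simp
    then show "pw_invertible a (\<lambda>f z. f (z + h / 2 / 2 ^ m) - \<kappa> * f z)"
      using Suc.prems by (simp add: divide_divide_eq_left)
  qed
  from this[of "csqrt \<mu>"] this[of "- csqrt \<mu>"] show ?case
    using translate_minus_invertible_halve[of a h "csqrt \<mu>"] by simp
qed (use assms in simp)

text \<open>Translation minus the identity has small norm, so its Neumann series converges at the
  point \<open>\<nu> - 1\<close>.\<close>

lemma translate_minus_invertible_far:
  assumes a: "a > 0" and far: "a * cmod h * exp (1 + a * cmod h) < cmod (\<nu> - 1)"
  shows "pw_invertible a (\<lambda>f z. f (z + h) - \<nu> * f z)"
proof -
  let ?T = "\<lambda>f z. f (z + h) - f z"
  define q where "q = a * cmod h * exp (1 + a * cmod h)"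
  have q: "q \<ge> 0" using a by (simp add: q_def)
  have T: "pw_bounded_operator a ?T"
    using pw_bounded_operator_minus_scalar[OF less_imp_le[OF a] pw_bounded_operator_translate[OF less_imp_le[OF a]], of h 1]
    by simp
  have "pw_norm (?T f) \<le> q * pw_norm f" if "f \<in> paley_wiener a" for f
    unfolding q_def by (rule translate_diff_norm_le[OF a that])
  note pow = pw_norm_funpow_le[OF T q this]
  have "\<exists>S. pw_inverse a (\<lambda>f z. ?T f z - (\<nu> - 1) * f z) S"
    using neumann_inverse[OF less_imp_le[OF a] T q, of "\<nu> - 1" 1] pow far by (auto simp: q_def)
  then show ?thesis by (simp add: pw_invertible_iff algebra_simps)
qed

lemma pw_inverse_scale:
  assumes a: "a \<ge> 0" and A: "pw_inverse a A S" and k: "k \<noteq> 0"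
  shows "pw_inverse a (\<lambda>f z. k * A f z) (\<lambda>f z. (1 / k) * S f z)"
proof -
  have bA: "pw_bounded_operator a A" and bS: "pw_bounded_operator a S"
    using A by (auto simp: pw_inverse_def)
  show ?thesis
    unfolding pw_inverse_def
  proof (intro conjI ballI)
    show "pw_bounded_operator a (\<lambda>f z. k * A f z)"
      using pw_bounded_operator_cadd[OF a bA pw_bounded_operator_ident, of k 0] by simp
    show "pw_bounded_operator a (\<lambda>f z. (1 / k) * S f z)"
      using pw_bounded_operator_cadd[OF a bS pw_bounded_operator_ident, of "1 / k" 0] by simp
    fix f assume f: "f \<in> paley_wiener a"
    show "(\<lambda>z. 1 / k * S (\<lambda>z. k * A f z) z) = f"
      using A f k pw_bounded_operator_cmult[OF bS pw_bounded_operator_closed[OF bA f], of k]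
      by (simp add: pw_inverse_def)
    show "(\<lambda>z. k * A (\<lambda>z. 1 / k * S f z) z) = f"
      using A f k pw_bounded_operator_cmult[OF bA pw_bounded_operator_closed[OF bS f], of "1 / k"]
      by (simp add: pw_inverse_def)
  qed
qed

text \<open>The direction \<open>u\<close> points from the segment \<open>\<i> [- a, a]\<close> to \<open>\<omega>\<close>. Translation in this direction
  grows more slowly than \<open>e\<^bsup>\<omega>h\<^esup>\<close>, which makes the resolvent a convergent geometric series.\<close>

lemma separating_direction:
  fixes \<omega> :: complex
  assumes a: "a \<ge> 0" and \<delta>: "\<delta> > 0" and far: "\<And>t. \<bar>t\<bar> \<le> a \<Longrightarrow> \<delta> \<le> cmod (\<omega> - \<i> * of_real t)"
  obtains u where "cmod u = 1" "Re (\<omega> * u) \<ge> \<delta> + a * \<bar>Im u\<bar>"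
proof -
  \<comment> \<open>\<open>\<i> * of_real t0\<close> is the point of the segment nearest to
    \<open>\<omega>\<close>.\<close>
  define t0 where "t0 = max (- a) (min a (Im \<omega>))"
  define v where "v = \<omega> - \<i> * of_real t0"
  have t0: "\<bar>t0\<bar> \<le> a" using a by (auto simp: t0_def)
  have v: "cmod v \<ge> \<delta>" unfolding v_def by (rule far[OF t0])
  then have v0: "cmod v > 0" using \<delta> by linarith
  \<comment> \<open>Multiplication by \<open>u\<close> rotates \<open>v\<close> onto the positive
    real axis.\<close>
  define u where "u = cnj v / of_real (cmod v)"
  have "cmod u = 1" using v0 by (simp add: u_def norm_divide)
  have Imu: "Im u = - Im v / cmod v" by (simp add: u_def Im_divide_of_real)
  have "\<omega> * u = v * cnj v / of_real (cmod v) + \<i> * of_real t0 * u"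
    by (simp add: v_def u_def algebra_simps add_divide_distrib diff_divide_distrib)
  also have "v * cnj v / of_real (cmod v) = of_real (cmod v)"
    using v0 by (simp add: complex_norm_square[symmetric] power2_eq_square)
  finally have "Re (\<omega> * u) = cmod v - t0 * Im u" by simp
  \<comment> \<open>If \<open>Im v \<noteq> 0\<close>, the projection was cut off at an endpoint
    \<open>\<plusminus>a\<close> having the sign of \<open>Im v\<close>.\<close>
  moreover have "- t0 * Im u = a * \<bar>Im u\<bar>"
  proof -
    have "t0 * Im v = a * \<bar>Im v\<bar>"
    proof -
      consider "Im \<omega> > a" | "Im \<omega> < - a" | "\<bar>Im \<omega>\<bar> \<le> a" by linarith
      then show ?thesis
        by cases (use a in \<open>auto simp: t0_def v_def abs_if max_def min_def algebra_simps\<close>)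
    qed
    then show ?thesis using v0 by (simp add: Imu abs_divide field_simps)
  qed
  ultimately have "Re (\<omega> * u) \<ge> \<delta> + a * \<bar>Im u\<bar>" using v by simp
  with \<open>cmod u = 1\<close> show ?thesis by (rule that)
qed

text \<open>The constant is Cauchy's bound at radius \<open>1 / 2\<close> for the second derivative:
  \<open>2 * B / (1/2)\<^sup>2 = 8 * B\<close>.\<close>

lemma holomorphic_Taylor_first_order:
  assumes Q: "Q holomorphic_on UNIV" and B: "\<And>w. cmod w \<le> 1 \<Longrightarrow> cmod (Q w) \<le> B" and h: "cmod h \<le> 1 / 2"
  shows "cmod (Q h - (Q 0 + deriv Q 0 * h)) \<le> 8 * B * (cmod h)\<^sup>2"
proof -
  have "cmod ((deriv ^^ 0) Q h - (\<Sum>i\<le>1. (deriv ^^ i) Q 0 * (h - 0) ^ i / fact i))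
      \<le> 8 * B * cmod (h - 0) ^ Suc 1 / fact 1"
  proof (rule complex_Taylor[where S = "cball 0 (1/2)"])
    fix i x
    show "((deriv ^^ i) Q has_field_derivative (deriv ^^ Suc i) Q x) (at x within cball 0 (1/2))"
      using holomorphic_derivI[OF holomorphic_higher_deriv[OF Q open_UNIV] open_UNIV, of x i]
      by (simp add: has_field_derivative_at_within)
  next
    fix x :: complex assume x: "x \<in> cball 0 (1/2)"
    have "cmod ((deriv ^^ 2) Q x) \<le> fact 2 * B / (1/2) ^ 2"
    proof (rule Cauchy_inequality)
      fix y assume "cmod (x - y) = 1 / 2"
      then show "cmod (Q y) \<le> B"
        using x norm_triangle_ineq4[of x "x - y"] by (intro B) auto
    qed (use Q in \<open>auto intro: holomorphic_on_subset holomorphic_on_imp_continuous_on\<close>)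
    then show "cmod ((deriv ^^ Suc 1) Q x) \<le> 8 * B"
      by (simp add: power2_eq_square numeral_2_eq_2)
  qed (use h in auto)
  then show ?thesis by (simp add: power2_eq_square)
qed

text \<open>\<open>h\<close> is compared with \<open>h'\<close> of the same length
  \<open>\<rho>\<close> in the separating direction. There the inverse has norm at most
  \<open>1 / (\<rho> * \<delta>)\<close>, while the two operators, suitably scaled, differ by
  \<open>O(\<rho>\<^sup>2)\<close>, so a small \<open>\<rho>\<close> suffices.\<close>

lemma translate_minus_invertible_near:
  assumes a: "a > 0" and \<delta>: "\<delta> > 0"
    and h: "h \<noteq> 0" "cmod h \<le> 1 / 2" "16 * (exp a + exp \<Lambda>) * cmod h < \<delta>"
    and \<omega>: "cmod \<omega> \<le> \<Lambda>" and far: "\<And>t. \<bar>t\<bar> \<le> a \<Longrightarrow> \<delta> \<le> cmod (\<omega> - \<i> * of_real t)"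
  shows "pw_invertible a (\<lambda>f z. f (z + h) - exp (h * \<omega>) * f z)"
proof -
  have a0: "a \<ge> 0" using a by simp
  obtain u where u: "cmod u = 1" "Re (\<omega> * u) \<ge> \<delta> + a * \<bar>Im u\<bar>"
    using separating_direction[OF a0 \<delta> far] by blast
  define \<rho> where "\<rho> = cmod h"
  have \<rho>: "\<rho> > 0" using h by (simp add: \<rho>_def)
  define h' where "h' = of_real \<rho> * u"
  have h': "h' \<noteq> 0" "cmod h' = \<rho>" using \<rho> u by (auto simp: h'_def norm_mult)
  define \<mu> where "\<mu> = exp (h' * \<omega>)"
  define q where "q = exp (a * \<bar>Im h'\<bar>)"
  have q: "q \<ge> 1" using a by (simp add: q_def)
  \<comment> \<open>\<open>q\<close> bounds the norm of translation by \<open>h'\<close>, and the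
    choice of \<open>u\<close> gives \<open>Re (h' * \<omega>) \<ge> \<rho> * \<delta> + a *
    \<bar>Im h'\<bar>\<close>.\<close>
  have gap: "cmod \<mu> - q \<ge> \<rho> * \<delta>"
  proof -
    have "Re (h' * \<omega>) = \<rho> * Re (\<omega> * u)" by (simp add: h'_def algebra_simps)
    also have "\<dots> \<ge> \<rho> * (\<delta> + a * \<bar>Im u\<bar>)" using u \<rho> by (intro mult_left_mono) auto
    finally have "Re (h' * \<omega>) \<ge> \<rho> * \<delta> + a * \<bar>Im h'\<bar>"
      using \<rho> by (simp add: h'_def abs_mult algebra_simps)
    then have "cmod \<mu> \<ge> exp (\<rho> * \<delta>) * q" by (simp add: \<mu>_def q_def exp_add[symmetric])
    moreover have "exp (\<rho> * \<delta>) * q \<ge> (1 + \<rho> * \<delta>) * q"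
      using q by (intro mult_right_mono exp_ge_add_one_self) auto
    moreover have "\<rho> * \<delta> * q \<ge> \<rho> * \<delta> * 1" using q \<rho> \<delta> by (intro mult_left_mono) auto
    ultimately show ?thesis by (simp add: distrib_right)
  qed
  have gap0: "\<rho> * \<delta> > 0" using \<rho> \<delta> by simp
  have pow: "pw_norm (((\<lambda>f z. f (z + h')) ^^ n) f) \<le> 1 * q ^ n * pw_norm f" if f: "f \<in> paley_wiener a" for f n
  proof -
    have "pw_norm (((\<lambda>f z. f (z + h')) ^^ n) f) \<le> exp (a * \<bar>Im (of_nat n * h')\<bar>) * pw_norm f"
      unfolding translate_funpow by (rule translate_paley_wiener(2)[OF a0 f])
    also have "exp (a * \<bar>Im (of_nat n * h')\<bar>) = q ^ n"
      by (simp add: q_def abs_mult exp_of_nat_mult[symmetric] mult_ac)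
    finally show ?thesis by simp
  qed
  obtain S where S: "pw_inverse a (\<lambda>f z. f (z + h') - \<mu> * f z) S"
    and S_norm: "\<And>f. f \<in> paley_wiener a \<Longrightarrow> pw_norm (S f) \<le> 1 / (cmod \<mu> - q) * pw_norm f"
    using neumann_inverse[OF a0 pw_bounded_operator_translate[OF a0], of q \<mu> h' 1, OF _ _ pow] gap gap0 q by auto
  \<comment> \<open>This unimodular factor makes the first-order terms in \<open>h\<close> and
    \<open>h'\<close> agree.\<close>
  define k where "k = h / h'"
  have k: "k \<noteq> 0" "cmod k = 1" using h h' \<rho> by (auto simp: k_def norm_divide \<rho>_def)
  have inv: "pw_inverse a (\<lambda>f z. k * (f (z + h') - \<mu> * f z)) (\<lambda>f z. (1 / k) * S f z)"
    by (rule pw_inverse_scale[OF a0 S k(1)])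
  define B where "B = exp a + exp \<Lambda>"
  have B: "B > 0" by (simp add: B_def add_pos_pos)
  show ?thesis
  proof (rule pw_inverse_perturb[OF a0 inv, where L = "1 / (\<rho> * \<delta>)" and \<eta> = "16 * B * \<rho>\<^sup>2"])
    show "pw_bounded_operator a (\<lambda>f z. f (z + h) - exp (h * \<omega>) * f z)"
      by (intro pw_bounded_operator_minus_scalar pw_bounded_operator_translate a0)
    show "1 / (\<rho> * \<delta>) \<ge> 0" "16 * B * \<rho>\<^sup>2 \<ge> 0" using gap0 B by auto
    have "1 / (\<rho> * \<delta>) * (16 * B * \<rho>\<^sup>2) = 16 * B * \<rho> / \<delta>"
      using \<rho> \<delta> by (simp add: power2_eq_square)
    also have "\<dots> < 1" using h(3) \<delta> by (simp add: B_def \<rho>_def)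
    finally show "1 / (\<rho> * \<delta>) * (16 * B * \<rho>\<^sup>2) < 1" .
  next
    fix f assume f: "f \<in> paley_wiener a"
    have "pw_norm (\<lambda>z. (1 / k) * S f z) = pw_norm (S f)"
      unfolding pw_norm_cmult using k by (simp add: norm_divide)
    also have "\<dots> \<le> 1 / (cmod \<mu> - q) * pw_norm f" by (rule S_norm[OF f])
    also have "\<dots> \<le> 1 / (\<rho> * \<delta>) * pw_norm f"
      using gap gap0 by (intro mult_right_mono divide_left_mono mult_pos_pos[of "_ - _"]) auto
    finally show "pw_norm (\<lambda>z. (1 / k) * S f z) \<le> 1 / (\<rho> * \<delta>) * pw_norm f" .
  next
    fix f assume f: "f \<in> paley_wiener a"
    define xs where "xs = [(k, h'), (- 1, h), (exp (h * \<omega>) - k * \<mu>, 0)]"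
    have "translation_sum xs f = (\<lambda>z. k * (f (z + h') - \<mu> * f z) - (f (z + h) - exp (h * \<omega>) * f z))"
      by (simp add: xs_def fun_eq_iff algebra_simps)
    moreover have "pw_norm (translation_sum xs f) \<le> (16 * B * \<rho>\<^sup>2) * pw_norm f"
    proof (rule translation_sum_norm_le(2)[OF a0 f])
      show "16 * B * \<rho>\<^sup>2 \<ge> 0" using B by simp
      fix G assume G: "G holomorphic_on UNIV" and le: "\<And>z. cmod (G z) \<le> exp (a * \<bar>Im z\<bar>)"
      \<comment> \<open>Since \<open>Q 0 = 0\<close>, the combination \<open>k * Q h' - Q h\<close>
        has no constant term, and its linear terms cancel because \<open>k * h' = h\<close>.\<close>
      define Q where "Q w = G w - exp (w * \<omega>) * G 0" for w
      have Q: "Q holomorphic_on UNIV" unfolding Q_def by (intro holomorphic_intros G)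
      have Q_le: "cmod (Q w) \<le> B" if w: "cmod w \<le> 1" for w
      proof -
        have "a * \<bar>Im w\<bar> \<le> a * 1" using a abs_Im_le_cmod[of w] w by (intro mult_left_mono) auto
        then have "cmod (G w) \<le> exp a" by (intro order_trans[OF le]) simp
        moreover have "cmod (exp (w * \<omega>) * G 0) \<le> exp \<Lambda> * 1"
          unfolding norm_mult
        proof (rule mult_mono)
          have "Re (w * \<omega>) \<le> cmod w * cmod \<omega>" using complex_Re_le_cmod[of "w * \<omega>"] by (simp only: norm_mult)
          also have "\<dots> \<le> 1 * \<Lambda>" using w \<omega> by (intro mult_mono) auto
          finally show "cmod (exp (w * \<omega>)) \<le> exp \<Lambda>" by simp
          show "cmod (G 0) \<le> 1" using le[of 0] by simp
        qed auto
        ultimately show ?thesis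
          unfolding Q_def B_def using norm_triangle_ineq4[of "G w" "exp (w * \<omega>) * G 0"] by linarith
      qed
      have Q0: "Q 0 = 0" by (simp add: Q_def)
      have T: "cmod (Q w - deriv Q 0 * w) \<le> 8 * B * \<rho>\<^sup>2" if "cmod w = \<rho>" for w
        using holomorphic_Taylor_first_order[OF Q Q_le, of w] that h(2) by (simp add: Q0 \<rho>_def)
      have "translation_sum xs G 0 = k * Q h' - Q h"
        by (simp add: xs_def Q_def \<mu>_def algebra_simps)
      also have "\<dots> = k * (Q h' - deriv Q 0 * h') - (Q h - deriv Q 0 * h)"
        using h'(1) by (simp add: k_def right_diff_distrib)
      also have "cmod \<dots> \<le> cmod (k * (Q h' - deriv Q 0 * h')) + cmod (Q h - deriv Q 0 * h)"
        by (rule norm_triangle_ineq4)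
      also have "\<dots> \<le> 8 * B * \<rho>\<^sup>2 + 8 * B * \<rho>\<^sup>2"
        unfolding norm_mult k(2) using T[OF h'(2)] T[of h] by (simp add: \<rho>_def)
      finally show "cmod (translation_sum xs G 0) \<le> 16 * B * \<rho>\<^sup>2" by simp
    qed
    ultimately show "pw_norm (\<lambda>z. k * (f (z + h') - \<mu> * f z) - (f (z + h) - exp (h * \<omega>) * f z))
        \<le> 16 * B * \<rho>\<^sup>2 * pw_norm f" by simp
  qed
qed

lemma translate_minus_invertible:
  assumes a: "a > 0" and \<mu>: "\<And>t. \<bar>t\<bar> \<le> a \<Longrightarrow> \<mu> \<noteq> exp (\<i> * d * of_real t)"
  shows "pw_invertible a (\<lambda>f z. f (z + d) - \<mu> * f z)"
proof (cases "d = 0 \<or> \<mu> = 0")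
  case True
  then show ?thesis
  proof
    assume d: "d = 0"
    have "\<mu> \<noteq> 1" using \<mu>[of 0] a by simp
    then show ?thesis
      using d by (intro translate_minus_invertible_far[OF a]) simp
  next
    assume "\<mu> = 0"
    moreover have "pw_inverse a (\<lambda>f z. f (z + d)) (\<lambda>f z. f (z + - d))"
      unfolding pw_inverse_def
      using pw_bounded_operator_translate[of a d] pw_bounded_operator_translate[of a "- d"] a
      by (auto simp: fun_eq_iff)
    ultimately show ?thesis by (auto simp: pw_invertible_iff)
  qed
next
  case False
  then have d: "d \<noteq> 0" and \<mu>0: "\<mu> \<noteq> 0" by auto
  \<comment> \<open>\<open>\<kappa> * cmod h\<close> bounds the norm of translation by
    \<open>h\<close> minus the identity when \<open>cmod h \<le> 1\<close>.\<close>
  define \<kappa> where "\<kappa> = a * exp (1 + a)"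
  have \<kappa>: "\<kappa> > 0" using a by (simp add: \<kappa>_def)
  \<comment> \<open>\<open>Z\<close> holds every exponent that can occur for a root near
    \<open>1\<close>, whatever the number of halvings. As it is compact and misses the segment
    \<open>W\<close>, one distance \<open>\<delta>\<close> works before \<open>m\<close> is
    chosen.\<close>
  define Z where "Z = {\<omega>. cmod \<omega> \<le> 2 * \<kappa> \<and> exp (d * \<omega>) = \<mu>}"
  have "Z = cball 0 (2 * \<kappa>) \<inter> (\<lambda>\<omega>. exp (d * \<omega>)) -` {\<mu>}" by (auto simp: Z_def)
  moreover have "closed ((\<lambda>\<omega>. exp (d * \<omega>)) -` {\<mu>})"
    by (intro continuous_closed_vimage closed_singleton) (auto intro!: continuous_intros)
  ultimately have "compact Z" by (auto intro: compact_Int_closed)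
  moreover define W where "W = (\<lambda>t. \<i> * complex_of_real t) ` {-a..a}"
  have "closed W"
    unfolding W_def by (intro compact_imp_closed compact_continuous_image continuous_intros compact_Icc)
  moreover have "Z \<inter> W = {}"
  proof (rule ccontr)
    assume "Z \<inter> W \<noteq> {}"
    then obtain t where t: "t \<in> {-a..a}" "\<i> * of_real t \<in> Z" unfolding W_def by blast
    then have "\<bar>t\<bar> \<le> a" "exp (d * (\<i> * of_real t)) = \<mu>" by (auto simp: Z_def)
    then show False using \<mu>[of t] by (simp add: mult_ac)
  qed
  ultimately obtain \<delta> where \<delta>: "\<delta> > 0" "\<And>x y. x \<in> Z \<Longrightarrow> y \<in> W \<Longrightarrow> \<delta> \<le> dist x y"
    using separate_compact_closed[of Z W] by blast
  define B where "B = exp a + exp (2 * \<kappa>)"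
  have B: "B > 0" by (simp add: B_def add_pos_pos)
  \<comment> \<open>The three entries serve the Taylor estimate, the logarithm estimate near
    \<open>1\<close>, and the smallness required for the perturbation.\<close>
  define r where "r = min (1 / 2) (min (1 / (4 * \<kappa>)) (\<delta> / (32 * B)))"
  have r: "r > 0" using \<kappa> \<delta> B by (simp add: r_def)
  obtain m where m: "cmod d / 2 ^ m < r"
  proof -
    have "(\<lambda>m. cmod d * (1 / 2) ^ m) \<longlonglongrightarrow> cmod d * 0"
      by (intro tendsto_intros LIMSEQ_realpow_zero) auto
    then have "\<forall>\<^sub>F m in sequentially. cmod d * (1 / 2) ^ m < r"
      by (rule order_tendstoD(2)) (use r in simp)
    then obtain m where "cmod d * (1 / 2) ^ m < r"
      using eventually_happens'[OF sequentially_bot] by blast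
    then show ?thesis using that[of m] by (simp add: power_divide)
  qed
  define h where "h = d / 2 ^ m"
  have h_norm: "cmod h = cmod d / 2 ^ m" by (simp add: h_def norm_divide norm_power)
  have h0: "h \<noteq> 0" using d by (simp add: h_def)
  have h_half: "cmod h \<le> 1 / 2" and h_\<kappa>: "\<kappa> * cmod h < 1 / 2" and h_\<delta>: "16 * B * cmod h < \<delta>"
  proof -
    have "cmod h < 1 / 2" "cmod h < 1 / (4 * \<kappa>)" "cmod h < \<delta> / (32 * B)"
      using m unfolding h_norm[symmetric] r_def by auto
    then show "cmod h \<le> 1 / 2" "\<kappa> * cmod h < 1 / 2" "16 * B * cmod h < \<delta>"
      using \<kappa> B \<delta>(1) by (auto simp: field_simps)
  qed
  show ?thesis
  proof (rule translate_minus_invertible_roots[where m = m])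
    fix \<nu> assume \<nu>: "\<nu> ^ 2 ^ m = \<mu>"
    have "pw_invertible a (\<lambda>f z. f (z + h) - \<nu> * f z)"
    proof (cases "\<kappa> * cmod h < cmod (\<nu> - 1)")
      case True
      have "a * cmod h * exp (1 + a * cmod h) \<le> a * cmod h * exp (1 + a)"
        using a h_half by (intro mult_left_mono) (auto simp: mult_left_le)
      also have "\<dots> = \<kappa> * cmod h" by (simp add: \<kappa>_def)
      finally show ?thesis using True by (intro translate_minus_invertible_far[OF a]) linarith
    next
      case False
      then have \<nu>1: "cmod (\<nu> - 1) \<le> \<kappa> * cmod h" "cmod (\<nu> - 1) < 1 / 2" using h_\<kappa> by auto
      have \<nu>0: "\<nu> \<noteq> 0" using \<nu>1(2) by auto
      \<comment> \<open>As \<open>2 ^ m * h = d\<close>, the equation for \<open>\<nu>\<close> gives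
        \<open>exp (d * \<omega>) = \<mu>\<close>, and
        \<open>cmod (Ln \<nu>) \<le> 2 * cmod (\<nu> - 1)\<close> places \<open>\<omega>\<close> in
        \<open>Z\<close>.\<close>
      define \<omega> where "\<omega> = Ln \<nu> / h"
      have exp_h: "exp (h * \<omega>) = \<nu>" using \<nu>0 h0 by (simp add: \<omega>_def)
      have "cmod (Ln \<nu>) \<le> 2 * (\<kappa> * cmod h)"
        using norm_Ln_le[OF \<nu>1(2)] \<nu>1(1) by simp
      then have \<omega>_le: "cmod \<omega> \<le> 2 * \<kappa>"
        using h0 by (simp add: \<omega>_def norm_divide divide_le_eq)
      have "exp (d * \<omega>) = exp (of_nat (2 ^ m) * (h * \<omega>))" by (simp add: h_def)
      also have "\<dots> = \<mu>" unfolding exp_of_nat_mult exp_h by (rule \<nu>)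
      finally have "\<omega> \<in> Z" using \<omega>_le by (simp add: Z_def)
      then have far: "\<delta> \<le> cmod (\<omega> - \<i> * of_real t)" if "\<bar>t\<bar> \<le> a" for t
        using \<delta>(2)[of \<omega> "\<i> * of_real t"] that by (auto simp: W_def dist_norm abs_le_iff)
      show ?thesis
        using translate_minus_invertible_near[OF a \<delta>(1) h0 h_half _ \<omega>_le far] h_\<delta>
        by (simp add: exp_h B_def)
    qed
    then show "pw_invertible a (\<lambda>f z. f (z + d / 2 ^ m) - \<nu> * f z)" by (simp add: h_def)
  qed
qed

section \<open>The spectrum in the cases \<open>c = -1\<close>, \<open>0 < \<bar>c\<bar> < 1\<close>
  and \<open>c = 1\<close>\<close>

theorem proposition3p3:
  fixes a c :: real and d :: complex and \<phi> :: "complex \<Rightarrow> complex"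
  assumes "a > 0" and "0 < \<bar>c\<bar>" and "\<bar>c\<bar> \<le> 1"
    and "\<And>z. \<phi> z = of_real c * z + d"
  shows "(c = -1 \<longrightarrow> pw_spectrum a (composition_operator \<phi>) = {-1, 1}) \<and>
    (\<bar>c\<bar> < 1 \<longrightarrow>
       pw_spectrum a (composition_operator \<phi>) = {\<mu>. cmod \<mu> \<le> 1 / sqrt \<bar>c\<bar>}) \<and>
    (c = 1 \<longrightarrow>
       pw_spectrum a (composition_operator \<phi>) = {exp (\<i> * d * of_real t) | t. t \<in> {-a..a}})"
proof (intro conjI impI)
  have \<phi>: "\<phi> = (\<lambda>z. of_real c * z + d)" using assms(4) by (rule ext)
  show "pw_spectrum a (composition_operator \<phi>) = {-1, 1}" if "c = -1"
    using pw_spectrum_reflection[OF assms(1), of d] that by (simp add: \<phi>)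
  show "pw_spectrum a (composition_operator \<phi>) = {\<mu>. cmod \<mu> \<le> 1 / sqrt \<bar>c\<bar>}" if "\<bar>c\<bar> < 1"
    unfolding \<phi> using assms that by (intro pw_spectrum_contraction) auto
  show "pw_spectrum a (composition_operator \<phi>) = {exp (\<i> * d * of_real t) | t. t \<in> {-a..a}}" if "c = 1"
  proof -
    have T: "composition_operator \<phi> = (\<lambda>f z. f (z + d))"
      by (simp add: \<phi> that composition_operator_def fun_eq_iff)
    show ?thesis
    proof (intro equalityI subsetI)
      fix \<mu> assume "\<mu> \<in> pw_spectrum a (composition_operator \<phi>)"
      then have "\<not> pw_invertible a (\<lambda>f z. f (z + d) - \<mu> * f z)"
        by (simp add: T pw_spectrum_iff)
      then obtain t where "\<bar>t\<bar> \<le> a" "\<mu> = exp (\<i> * d * of_real t)"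
        using translate_minus_invertible[OF assms(1)] by blast
      then show "\<mu> \<in> {exp (\<i> * d * of_real t) | t. t \<in> {-a..a}}"
        by (auto simp: abs_le_iff intro!: exI[of _ t])
    next
      fix \<mu> assume "\<mu> \<in> {exp (\<i> * d * of_real t) | t. t \<in> {-a..a}}"
      then obtain t where "t \<in> {-a..a}" "\<mu> = exp (\<i> * d * of_real t)" by blast
      moreover from this have "\<bar>t\<bar> \<le> a" by auto
      ultimately
      show "\<mu> \<in> pw_spectrum a (composition_operator \<phi>)"
        using exp_in_pw_spectrum_translate[OF assms(1)] by (simp add: T)
    qed
  qed
qed

end
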